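(* Let $V$ be a $\mathbb Z_2$-graded $\mathbf k$-module equipped with a nondegenerate even graded symmetric inner product $\langle\cdot,\cdot\rangle$. (i) If $\varphi,\psi\in C(V)=\mathrm{Hom}(\bigwedge V,V)$ are cyclic, then $\{\varphi,\psi\}$ is cyclic, and (for homogeneous $v_1,\dots,v_{n+1}$ and $\psi_j$ homogeneous for each $j$) $$\widetilde{\{\varphi,\psi\}}(v_1,\dots,v_{n+1})=\sum_{\substack{k+j=n+1\\ \sigma\in\mathrm{Sh}(j,k)}}(-1)^\sigma\epsilon(\sigma)(-1)^{(k-1)|\psi_j|}\,\tilde\varphi_k(\psi_j(v_{\sigma(1)},\dots,v_{\sigma(j)}),v_{\sigma(j+1)},\dots,v_{\sigma(n+1)}).$$ Thus the inner product induces a structure of $\mathbb Z_2\times\mathbb Z$-graded Lie algebra (with respect to the inner product $\langle(\bar a,r),(\bar b,s)\rangle=(\bar a+r)(\bar b+s)$ on $\mathbb Z_2\times\mathbb Z$) on the module $CC(V)$ of cyclic elements of $C(V)$, equivalently on $CC(V,\mathbf k)$ by $\{\tilde\varphi,\tilde\psi\}=\widetilde{\{\varphi,\psi\}}$. (ii) If $l$ is an $L_\infty$ structure on $V$, then there is a differential $D$ (so $D^2=0$) on $CC(V)\cong CC(V,\mathbf k)$ given by $$D(\tilde\varphi)(v_1,\dots,v_{n+1})=\sum_{\substack{k+j=n+1\\ \sigma\in\mathrm{Sh}(j,k)}}(-1)^\sigma\epsilon(\sigma)(-1)^{(k-1)j}\,\tilde\varphi_k(l_j(v_{\sigma(1)},\dots,v_{\sigma(j)}),v_{\sigma(j+1)},\dots,v_{\sigma(n+1)}).$$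 (iii) If moreover the inner product is invariant (i.e. $l$ is cyclic), then $D(\tilde\varphi)=\{\tilde\varphi,\tilde l\}$. Thus $CC(V)$ inherits the structure of a differential graded Lie algebra.
   Context: $\mathbf k$ is a commutative ring, $V=V_0\oplus V_1$ a $\mathbb Z_2$-graded $\mathbf k$-module, $|v|$ the parity. For a permutation $\sigma$ of $\{1,\dots,n\}$ and homogeneous $v_i$, $\epsilon(\sigma)=\epsilon(\sigma;v_1,\dots,v_n)$ is the Koszul sign determined by $v_1\cdots v_n=\epsilon(\sigma)v_{\sigma(1)}\cdots v_{\sigma(n)}$ in the graded symmetric algebra; $(-1)^\sigma$ is the sign of $\sigma$. $\mathrm{Sh}(p,q)$ is the set of unshuffles: permutations $\sigma$ of $\{1,\dots,p+q\}$ with $\sigma(i)<\sigma(i+1)$ for $i\ne p$. $\bigwedge V=\bigoplus_{n\ge1}\bigwedge^nV$ is the quotient of the tensor algebra (without degree $0$ part) by the ideal generated by $x\otimes y+(-1)^{|x||y|}y\otimes x$. $C(V)=\mathrm{Hom}(\bigwedge V,V)=\prod_{k\ge1}C^k(V)$, $C^k(V)=\mathrm{Hom}(\bigwedge^kV,V)$; $\varphi_k$ is the restriction of $\varphi$ to $\bigwedge^kV$. A homogeneous $\varphi_k\in C^k(V)$ has parity $|\varphi_k|$, degree $k-1$, bidegree $(|\varphi_k|,k-1)$. For homogeneous $\varphi_k\in C^k(V)$, $\psi_j\in C^j(V)$, $n=k+j-1$: $$(\varphi_k\circ\psi_j)(v_1,\dots,v_n)=\sum_{\sigma\in\mathrm{Sh}(j,n-j)}(-1)^\sigma\epsilon(\sigma)\varphi_k(\psi_j(v_{\sigma(1)},\dots,v_{\sigma(j)}),v_{\sigma(j+1)},\dots,v_{\sigma(n)}),$$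 $[\varphi_k,\psi_j]=\varphi_k\circ\psi_j-(-1)^{|\varphi_k||\psi_j|+(k-1)(j-1)}\psi_j\circ\varphi_k$, $\{\varphi_k,\psi_j\}=(-1)^{(k-1)|\psi_j|}[\varphi_k,\psi_j]$, extended bilinearly and by $\{\varphi,\psi\}_n=\sum_{k+j=n+1}\{\varphi_k,\psi_j\}$. Inner product: a bilinear form $V\times V\to\mathbf k$ that is even ($\langle v,w\rangle=0$ if $|v|\ne|w|$), graded symmetric ($\langle v,w\rangle=(-1)^{|v||w|}\langle w,v\rangle$) and nondegenerate ($v\mapsto\langle v,\cdot\rangle$ is an isomorphism $V\to\mathrm{Hom}(V,\mathbf k)$). For $\varphi\in C^n(V)$ put $\tilde\varphi(v_1,\dots,v_{n+1})=\langle\varphi(v_1,\dots,v_n),v_{n+1}\rangle$. $\varphi\in C^n(V)$ is cyclic if $\tilde\varphi$ is graded antisymmetric, i.e. $\tilde\varphi\in CC^n(V,\mathbf k):=\mathrm{Hom}(\bigwedge^{n+1}V,\mathbf k)$; $\varphi\in C(V)$ is cyclic if all $\varphi_n$ are. $CC(V)=\prod_{n\ge 1}CC^n(V)$ is the module of cyclic elements, $CC(V,\mathbf k)=\prod_{n\ge1}CC^n(V,\mathbf k)$, and $\varphi\mapsto\tilde\varphi$ is an isomorphism $CC(V)\cong CC(V,\mathbf k)$. An $L_\infty$ structure on $V$ is $l\in C(V)$ with $|l_k|=k\bmod2$ and, for all $n\ge1$, $$\sum_{\substack{k+j=n+1\\ \sigma\in\mathrm{Sh}(j,n-j)}}(-1)^\sigma\epsilon(\sigma)(-1)^{(k-1)j}\,l_k(l_j(v_{\sigma(1)},\dots,v_{\sigma(j)}),v_{\sigma(j+1)},\dots,v_{\sigma(n)})=0.$$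 The inner product is invariant for $l$ if $l$ is cyclic. Graded Lie algebra with respect to a symmetric $\mathbb Z_2$-valued bilinear form on the grading group: the bracket is bilinear, additive on degrees, and for homogeneous elements $\{u,v\}=-(-1)^{\langle u,v\rangle}\{v,u\}$ and $\{u,\{v,w\}\}=\{\{u,v\},w\}+(-1)^{\langle u,v\rangle}\{v,\{u,w\}\}$ ($\langle u,v\rangle$ being the form evaluated on the degrees); for direct products the identities are understood for homogeneous components. Differential graded Lie algebra: additionally a map $D$ with $D^2=0$ and $D\{\varphi,\psi\}=\{\varphi,D\psi\}+(-1)^{q}\{D\varphi,\psi\}$, $q=|\psi|+\deg\psi$ the total parity of $\psi$. *)

theory Defs
  imports
    Complex_Main
    "HOL-Combinatorics.Permutations"
    "HOL-Library.Z2"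
    "HOL-Library.Function_Algebras"
    "HOL-Library.Product_Plus"
begin

section \<open>Graded modules and signs\<close>

text \<open>
  The module \<open>V\<close> is the type \<^typ>\<open>'v\<close> with scalar multiplication \<open>s\<close>, and \<open>V 0\<close>, \<open>V 1\<close> are its
  even and odd parts. The parity of an element is never a function of the element, because \<open>0\<close> lies
  in both parts: statements about homogeneous \<open>v\<^sub>1, \<dots>, v\<^sub>n\<close> quantify over a list of parities as well.
\<close>

locale super_module = module s
  for s :: "'k::comm_ring_1 \<Rightarrow> 'v::ab_group_add \<Rightarrow> 'v" +
  fixes V :: "bit \<Rightarrow> 'v set"
  assumes subspace_part: "subspace (V p)"
    and parts_disjoint: "V 0 \<inter> V 1 = {0}"
    and parts_span: "\<exists>x\<in>V 0. \<exists>y\<in>V 1. v = x + y"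

definition homog_args :: "(bit \<Rightarrow> 'v set) \<Rightarrow> 'v list \<Rightarrow> bit list \<Rightarrow> bool" where
  "homog_args V xs es \<longleftrightarrow> list_all2 (\<lambda>x e. x \<in> V e) xs es"

definition hproj :: "(bit \<Rightarrow> 'v::ab_group_add set) \<Rightarrow> bit \<Rightarrow> 'v \<Rightarrow> 'v" where
  "hproj V p v = (THE x. x \<in> V p \<and> v - x \<in> V (p + 1))"

definition ground_grading :: "bit \<Rightarrow> 'k::zero set" where
  "ground_grading p = (if p = 0 then UNIV else {0})"

definition psgn :: "bit \<Rightarrow> 'k::comm_ring_1" where
  "psgn p = (if p = 0 then 1 else - 1)"

text \<open>
  The Koszul sign of \<open>v\<^sub>1 \<cdots> v\<^sub>n = \<epsilon>(\<sigma>) v\<^sub>\<sigma>\<^sub>(\<^sub>1\<^sub>) \<cdots> v\<^sub>\<sigma>\<^sub>(\<^sub>n\<^sub>)\<close> in the graded symmetric algebra, where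
  \<open>x y = (-1)\<^bsup>|x||y|\<^esup> y x\<close>: every pair of factors whose order is reversed contributes the product
  of their parities. Positions are counted from \<open>0\<close>.
\<close>

definition koszul :: "bit list \<Rightarrow> (nat \<Rightarrow> nat) \<Rightarrow> 'k::comm_ring_1" where
  "koszul es \<sigma> =
     (\<Prod>(a, b) \<in> {(a, b). a < b \<and> b < length es \<and> \<sigma> b < \<sigma> a}. psgn (es ! \<sigma> a * es ! \<sigma> b))"

text \<open>With positions counted from \<open>0\<close>, the exceptional index \<open>i = p\<close> is the position with \<open>Suc i = p\<close>.\<close>

definition unshuffles :: "nat \<Rightarrow> nat \<Rightarrow> (nat \<Rightarrow> nat) set" where
  "unshuffles p q = {\<sigma>. \<sigma> permutes {..<p + q} \<and>
     (\<forall>i. Suc i < p + q \<and> Suc i \<noteq> p \<longrightarrow> \<sigma> i < \<sigma> (Suc i))}"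


section \<open>Maps on the exterior algebra\<close>

text \<open>
  A homomorphism \<open>\<And>V \<rightarrow> W\<close>, where \<open>\<And>V\<close> is the sum of the \<open>\<And>\<^sup>nV\<close> with \<open>n \<ge> 1\<close>, is a function on the
  lists of elements of \<open>V\<close>: its values on lists of length \<open>n\<close> are those of the restriction to \<open>\<And>\<^sup>nV\<close>
  on the products \<open>v\<^sub>1 \<and> \<cdots> \<and> v\<^sub>n\<close>. By the universal properties of tensor products and quotients, these are
  the functions that are linear in each argument and annihilate the ideal generated by the
  \<open>x \<otimes> y + (-1)\<^bsup>|x||y|\<^esup> y \<otimes> x\<close> with \<open>x\<close>, \<open>y\<close> homogeneous, that is, every
  \<open>u \<otimes> (x \<otimes> y + (-1)\<^bsup>|x||y|\<^esup> y \<otimes> x) \<otimes> w\<close>. The product over \<open>n\<close> of the modules of homomorphisms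
  is automatic. The value on the empty list, which carries no information, is \<open>0\<close>.
\<close>

definition hom_ext_alg ::
  "('k::comm_ring_1 \<Rightarrow> 'v::ab_group_add \<Rightarrow> 'v) \<Rightarrow> (bit \<Rightarrow> 'v set) \<Rightarrow>
   ('k \<Rightarrow> 'w::ab_group_add \<Rightarrow> 'w) \<Rightarrow> ('v list \<Rightarrow> 'w) set" where
  "hom_ext_alg s V t = {\<phi>. \<phi> [] = 0 \<and>
     (\<forall>us ws. module_hom s t (\<lambda>x. \<phi> (us @ x # ws))) \<and>
     (\<forall>us ws p q. \<forall>x\<in>V p. \<forall>y\<in>V q.
        \<phi> (us @ x # y # ws) + t (psgn (p * q)) (\<phi> (us @ y # x # ws)) = 0)}"

definition cochains :: "('k::comm_ring_1 \<Rightarrow> 'v::ab_group_add \<Rightarrow> 'v) \<Rightarrow> (bit \<Rightarrow> 'v set) \<Rightarrow> ('v list \<Rightarrow> 'v) set" where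
  "cochains s V = hom_ext_alg s V s"

definition arity_part :: "nat \<Rightarrow> ('v list \<Rightarrow> 'w::zero) \<Rightarrow> 'v list \<Rightarrow> 'w" where
  "arity_part n \<phi> xs = (if length xs = n then \<phi> xs else 0)"

definition has_parity ::
  "(bit \<Rightarrow> 'v set) \<Rightarrow> (bit \<Rightarrow> 'w set) \<Rightarrow> bit \<Rightarrow> ('v list \<Rightarrow> 'w) \<Rightarrow> bool" where
  "has_parity V W p \<phi> \<longleftrightarrow> (\<forall>xs es. homog_args V xs es \<longrightarrow> \<phi> xs \<in> W (p + sum_list es))"

text \<open>
  Multilinear extension of an expression \<open>F\<close> given on homogeneous arguments together with their
  parities: every argument is split into its even and its odd part.
\<close>

definition homog_extend ::
  "(bit \<Rightarrow> 'v::ab_group_add set) \<Rightarrow> (bit list \<Rightarrow> 'v list \<Rightarrow> 'w::comm_monoid_add) \<Rightarrow> 'v list \<Rightarrow> 'w" where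
  "homog_extend V F xs = (\<Sum>es | length es = length xs. F es (map2 (hproj V) es xs))"

lemma homog_extend_homog:
  assumes "super_module s V" and "homog_args V xs es"
    and zero: "\<And>es' ys. length ys = length es' \<Longrightarrow> 0 \<in> set ys \<Longrightarrow> F es' ys = 0"
  shows "homog_extend V F xs = F es xs"
proof -
  interpret super_module s V by fact
  have eq: "hproj V p v = x" if "x \<in> V p" "v - x \<in> V (p + 1)" for p v x
    unfolding hproj_def
  proof (rule the_equality)
    show "x \<in> V p \<and> v - x \<in> V (p + 1)" using that by simp
    fix z assume z: "z \<in> V p \<and> v - z \<in> V (p + 1)"
    have "z - x \<in> V p" using z that subspace_diff[OF subspace_part] by blast
    moreover have "(v - x) - (v - z) \<in> V (p + 1)"
      using z that subspace_diff[OF subspace_part] by blast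
    ultimately have "z - x \<in> V 0 \<inter> V 1" by (cases p) auto
    then show "z = x" using parts_disjoint by simp
  qed
  have same: "hproj V p v = v" if "v \<in> V p" for p v
    using that subspace_0[OF subspace_part] by (intro eq) auto
  have other: "hproj V p' v = 0" if "v \<in> V p" "p' \<noteq> p" for p p' v
  proof (rule eq)
    show "0 \<in> V p'" by (rule subspace_0[OF subspace_part])
    have "p' + 1 = p" using that(2) by (cases p; cases p') auto
    then show "v - 0 \<in> V (p' + 1)" using that by simp
  qed
  have len: "length es = length xs" and nth: "\<And>i. i < length xs \<Longrightarrow> xs ! i \<in> V (es ! i)"
    using assms(2) by (auto simp: homog_args_def list_all2_conv_all_nth)
  have fin: "finite {es' :: bit list. length es' = length xs}"
  proof -
    have "b \<in> {0, 1}" for b :: bit by (cases b) simp_all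
    then have "finite (UNIV :: bit set)" by (intro finite_subset[of UNIV "{0, 1}"]) blast+
    from finite_lists_length_eq[OF this] show ?thesis by simp
  qed
  have "F es' (map2 (hproj V) es' xs) = 0" if l: "length es' = length xs" and ne: "es' \<noteq> es" for es'
  proof (rule zero)
    show "length (map2 (hproj V) es' xs) = length es'" using l by simp
    obtain i where i: "i < length xs" "es' ! i \<noteq> es ! i"
      using l ne len by (metis nth_equalityI)
    then have "map2 (hproj V) es' xs ! i = 0" using l other[OF nth[OF i(1)] i(2)] by simp
    then show "0 \<in> set (map2 (hproj V) es' xs)" using i l by (metis length_map length_zip min.idem nth_mem)
  qed
  moreover have "map2 (hproj V) es xs = xs"
    using len by (intro nth_equalityI) (auto simp: same nth)
  ultimately show ?thesis unfolding homog_extend_def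
    using len fin by (subst sum.remove[of _ es]) (auto intro!: sum.neutral)
qed

definition parity_part ::
  "(bit \<Rightarrow> 'v::ab_group_add set) \<Rightarrow> bit \<Rightarrow> ('v list \<Rightarrow> 'v) \<Rightarrow> 'v list \<Rightarrow> 'v" where
  "parity_part V p \<phi> = homog_extend V (\<lambda>es ys. hproj V (p + sum_list es) (\<phi> ys))"


section \<open>Composition and bracket\<close>

text \<open>
  \<open>\<Sum>\<^bsub>\<sigma> \<in> Sh(j, m)\<^esub> (-1)\<^sup>\<sigma> \<epsilon>(\<sigma>) \<phi>(\<psi>(v\<^sub>\<sigma>\<^sub>(\<^sub>1\<^sub>), \<dots>, v\<^sub>\<sigma>\<^sub>(\<^sub>j\<^sub>)), v\<^sub>\<sigma>\<^sub>(\<^sub>j\<^sub>+\<^sub>1\<^sub>), \<dots>, v\<^sub>\<sigma>\<^sub>(\<^sub>j\<^sub>+\<^sub>m\<^sub>))\<close> for homogeneous arguments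
  with parities \<open>es\<close>. The list lengths select the components of \<open>\<phi>\<close> and \<open>\<psi>\<close>.
\<close>

definition insertion ::
  "('k::comm_ring_1 \<Rightarrow> 'w::comm_monoid_add \<Rightarrow> 'w) \<Rightarrow> bit list \<Rightarrow> nat \<Rightarrow> nat \<Rightarrow>
   ('v list \<Rightarrow> 'w) \<Rightarrow> ('v list \<Rightarrow> 'v) \<Rightarrow> 'v list \<Rightarrow> 'w" where
  "insertion t es j m \<phi> \<psi> xs = (\<Sum>\<sigma>\<in>unshuffles j m. t (of_int (sign \<sigma>) * koszul es \<sigma>)
     (\<phi> (\<psi> (take j (permute_list \<sigma> xs)) # drop j (permute_list \<sigma> xs))))"

definition circ ::
  "('k::comm_ring_1 \<Rightarrow> 'v::ab_group_add \<Rightarrow> 'v) \<Rightarrow> (bit \<Rightarrow> 'v set) \<Rightarrow> nat \<Rightarrow> nat \<Rightarrow>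
   ('v list \<Rightarrow> 'v) \<Rightarrow> ('v list \<Rightarrow> 'v) \<Rightarrow> 'v list \<Rightarrow> 'v" where
  "circ s V k j \<phi> \<psi> xs = (if length xs = k + j - 1
     then homog_extend V (\<lambda>es ys. insertion s es j (k - 1) \<phi> \<psi> ys) xs else 0)"

text \<open>
  The brackets \<open>[\<phi>, \<psi>]\<close> and \<open>{\<phi>, \<psi>}\<close> of \<open>\<phi> \<in> C\<^sup>k(V)\<close> of parity \<open>a\<close> and \<open>\<psi> \<in> C\<^sup>j(V)\<close> of parity \<open>b\<close>.
\<close>

definition homog_commutator ::
  "('k::comm_ring_1 \<Rightarrow> 'v::ab_group_add \<Rightarrow> 'v) \<Rightarrow> (bit \<Rightarrow> 'v set) \<Rightarrow> nat \<Rightarrow> nat \<Rightarrow> bit \<Rightarrow> bit \<Rightarrow>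
   ('v list \<Rightarrow> 'v) \<Rightarrow> ('v list \<Rightarrow> 'v) \<Rightarrow> 'v list \<Rightarrow> 'v" where
  "homog_commutator s V k j a b \<phi> \<psi> xs = circ s V k j \<phi> \<psi> xs
     - s (psgn (a * b + of_nat (k - 1) * of_nat (j - 1))) (circ s V j k \<psi> \<phi> xs)"

definition homog_bracket ::
  "('k::comm_ring_1 \<Rightarrow> 'v::ab_group_add \<Rightarrow> 'v) \<Rightarrow> (bit \<Rightarrow> 'v set) \<Rightarrow> nat \<Rightarrow> nat \<Rightarrow> bit \<Rightarrow> bit \<Rightarrow>
   ('v list \<Rightarrow> 'v) \<Rightarrow> ('v list \<Rightarrow> 'v) \<Rightarrow> 'v list \<Rightarrow> 'v" where
  "homog_bracket s V k j a b \<phi> \<psi> xs =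
     s (psgn (of_nat (k - 1) * b)) (homog_commutator s V k j a b \<phi> \<psi> xs)"

definition arity_pairs :: "nat \<Rightarrow> (nat \<times> nat) set" where
  "arity_pairs m = {(k, j). 1 \<le> k \<and> 1 \<le> j \<and> k + j = m}"

definition bracket ::
  "('k::comm_ring_1 \<Rightarrow> 'v::ab_group_add \<Rightarrow> 'v) \<Rightarrow> (bit \<Rightarrow> 'v set) \<Rightarrow>
   ('v list \<Rightarrow> 'v) \<Rightarrow> ('v list \<Rightarrow> 'v) \<Rightarrow> 'v list \<Rightarrow> 'v" where
  "bracket s V \<phi> \<psi> xs = (\<Sum>(k, j)\<in>arity_pairs (length xs + 1). \<Sum>a\<in>{0, 1}. \<Sum>b\<in>{0, 1}.
     homog_bracket s V k j a b
       (parity_part V a (arity_part k \<phi>)) (parity_part V b (arity_part j \<psi>)) xs)"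


section \<open>Inner products and cyclic elements\<close>

definition inner_product ::
  "('k::comm_ring_1 \<Rightarrow> 'v::ab_group_add \<Rightarrow> 'v) \<Rightarrow> (bit \<Rightarrow> 'v set) \<Rightarrow> ('v \<Rightarrow> 'v \<Rightarrow> 'k) \<Rightarrow> bool" where
  "inner_product s V ip \<longleftrightarrow>
     (\<forall>w. module_hom s (*) (\<lambda>v. ip v w)) \<and> (\<forall>v. module_hom s (*) (\<lambda>w. ip v w)) \<and>
     (\<forall>p q. \<forall>v\<in>V p. \<forall>w\<in>V q. p \<noteq> q \<longrightarrow> ip v w = 0) \<and>
     (\<forall>p q. \<forall>v\<in>V p. \<forall>w\<in>V q. ip v w = psgn (p * q) * ip w v) \<and>
     bij_betw (\<lambda>v w. ip v w) UNIV {f. module_hom s (*) f}"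

definition tilde :: "('v \<Rightarrow> 'v \<Rightarrow> 'k) \<Rightarrow> ('v list \<Rightarrow> 'v) \<Rightarrow> 'v list \<Rightarrow> 'k" where
  "tilde ip \<phi> xs = ip (\<phi> (butlast xs)) (last xs)"

text \<open>\<open>CC(V, k)\<close> is the product of the \<open>Hom(\<And>\<^sup>n\<^sup>+\<^sup>1V, k)\<close> with \<open>n \<ge> 1\<close>: there is no part on \<open>\<And>\<^sup>1V\<close>.\<close>

definition CC_form ::
  "('k::comm_ring_1 \<Rightarrow> 'v::ab_group_add \<Rightarrow> 'v) \<Rightarrow> (bit \<Rightarrow> 'v set) \<Rightarrow> ('v list \<Rightarrow> 'k) set" where
  "CC_form s V = {\<Phi> \<in> hom_ext_alg s V (*). \<forall>v. \<Phi> [v] = 0}"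

definition CC ::
  "('k::comm_ring_1 \<Rightarrow> 'v::ab_group_add \<Rightarrow> 'v) \<Rightarrow> (bit \<Rightarrow> 'v set) \<Rightarrow> ('v \<Rightarrow> 'v \<Rightarrow> 'k) \<Rightarrow>
   ('v list \<Rightarrow> 'v) set" where
  "CC s V ip = {\<phi> \<in> cochains s V. tilde ip \<phi> \<in> CC_form s V}"

text \<open>The homogeneous parts of bidegree \<open>(a, r)\<close>; they vanish for \<open>r < 0\<close>.\<close>

definition CC_part ::
  "('k::comm_ring_1 \<Rightarrow> 'v::ab_group_add \<Rightarrow> 'v) \<Rightarrow> (bit \<Rightarrow> 'v set) \<Rightarrow> ('v \<Rightarrow> 'v \<Rightarrow> 'k) \<Rightarrow>
   bit \<times> int \<Rightarrow> ('v list \<Rightarrow> 'v) set" where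
  "CC_part s V ip = (\<lambda>(a, r). {\<phi> \<in> CC s V ip. has_parity V V a \<phi> \<and>
     (\<forall>xs. int (length xs) \<noteq> r + 1 \<longrightarrow> \<phi> xs = 0)})"

definition CC_form_part ::
  "('k::comm_ring_1 \<Rightarrow> 'v::ab_group_add \<Rightarrow> 'v) \<Rightarrow> (bit \<Rightarrow> 'v set) \<Rightarrow>
   bit \<times> int \<Rightarrow> ('v list \<Rightarrow> 'k) set" where
  "CC_form_part s V = (\<lambda>(a, r). {\<Phi> \<in> CC_form s V. has_parity V ground_grading a \<Phi> \<and>
     (\<forall>xs. int (length xs) \<noteq> r + 2 \<longrightarrow> \<Phi> xs = 0)})"

definition untilde ::
  "('k::comm_ring_1 \<Rightarrow> 'v::ab_group_add \<Rightarrow> 'v) \<Rightarrow> (bit \<Rightarrow> 'v set) \<Rightarrow> ('v \<Rightarrow> 'v \<Rightarrow> 'k) \<Rightarrow>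
   ('v list \<Rightarrow> 'k) \<Rightarrow> 'v list \<Rightarrow> 'v" where
  "untilde s V ip = the_inv_into (CC s V ip) (tilde ip)"

definition form_bracket ::
  "('k::comm_ring_1 \<Rightarrow> 'v::ab_group_add \<Rightarrow> 'v) \<Rightarrow> (bit \<Rightarrow> 'v set) \<Rightarrow> ('v \<Rightarrow> 'v \<Rightarrow> 'k) \<Rightarrow>
   ('v list \<Rightarrow> 'k) \<Rightarrow> ('v list \<Rightarrow> 'k) \<Rightarrow> 'v list \<Rightarrow> 'k" where
  "form_bracket s V ip \<Phi> \<Psi> = tilde ip (bracket s V (untilde s V ip \<Phi>) (untilde s V ip \<Psi>))"


section \<open>\<open>L\<^sub>\<infinity>\<close> structures and the differential\<close>

definition L_infinity ::
  "('k::comm_ring_1 \<Rightarrow> 'v::ab_group_add \<Rightarrow> 'v) \<Rightarrow> (bit \<Rightarrow> 'v set) \<Rightarrow> ('v list \<Rightarrow> 'v) \<Rightarrow> bool" where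
  "L_infinity s V l \<longleftrightarrow> l \<in> cochains s V \<and>
     (\<forall>k\<ge>1. has_parity V V (of_nat k) (arity_part k l)) \<and>
     (\<forall>n\<ge>1. \<forall>xs es. length xs = n \<and> homog_args V xs es \<longrightarrow>
        (\<Sum>(k, j)\<in>arity_pairs (n + 1).
           s (psgn (of_nat (k - 1) * of_nat j)) (insertion s es j (n - j) l l xs)) = 0)"

text \<open>For a list of length \<open>n + 1\<close> the sum runs over \<open>k + j = n + 1\<close> with \<open>k, j \<ge> 1\<close>.\<close>

definition form_diff ::
  "(bit \<Rightarrow> 'v::ab_group_add set) \<Rightarrow> ('v list \<Rightarrow> 'v) \<Rightarrow> ('v list \<Rightarrow> 'k::comm_ring_1) \<Rightarrow> 'v list \<Rightarrow> 'k" where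
  "form_diff V l \<Phi> = homog_extend V (\<lambda>es ys. \<Sum>(k, j)\<in>arity_pairs (length ys).
     psgn (of_nat (k - 1) * of_nat j) * insertion (*) es j k \<Phi> l ys)"

definition cyclic_diff ::
  "('k::comm_ring_1 \<Rightarrow> 'v::ab_group_add \<Rightarrow> 'v) \<Rightarrow> (bit \<Rightarrow> 'v set) \<Rightarrow> ('v \<Rightarrow> 'v \<Rightarrow> 'k) \<Rightarrow>
   ('v list \<Rightarrow> 'v) \<Rightarrow> ('v list \<Rightarrow> 'v) \<Rightarrow> 'v list \<Rightarrow> 'v" where
  "cyclic_diff s V ip l \<phi> = untilde s V ip (form_diff V l (tilde ip \<phi>))"


section \<open>Graded Lie algebras\<close>

definition pointwise_scale :: "('k \<Rightarrow> 'w \<Rightarrow> 'w) \<Rightarrow> 'k \<Rightarrow> ('a \<Rightarrow> 'w) \<Rightarrow> 'a \<Rightarrow> 'w" where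
  "pointwise_scale t c \<phi> = (\<lambda>x. t c (\<phi> x))"

definition linear_map_on ::
  "('k \<Rightarrow> 'a::plus \<Rightarrow> 'a) \<Rightarrow> ('k \<Rightarrow> 'b::plus \<Rightarrow> 'b) \<Rightarrow> 'a set \<Rightarrow> ('a \<Rightarrow> 'b) \<Rightarrow> bool" where
  "linear_map_on sc sc' L f \<longleftrightarrow>
     (\<forall>x\<in>L. \<forall>y\<in>L. f (x + y) = f x + f y) \<and> (\<forall>c. \<forall>x\<in>L. f (sc c x) = sc' c (f x))"

text \<open>\<open>L\<close> is the direct product of its submodules \<open>H g\<close>, with projections \<open>\<pi> g\<close>.\<close>

definition product_graded ::
  "('k::comm_ring_1 \<Rightarrow> 'a::ab_group_add \<Rightarrow> 'a) \<Rightarrow> 'a set \<Rightarrow> ('g \<Rightarrow> 'a set) \<Rightarrow> bool" where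
  "product_graded sc L H \<longleftrightarrow> module sc \<and> module.subspace sc L \<and>
     (\<forall>g. module.subspace sc (H g) \<and> H g \<subseteq> L) \<and>
     (\<exists>\<pi>. (\<forall>g. linear_map_on sc sc L (\<pi> g)) \<and>
          (\<forall>g h. \<forall>x\<in>H g. \<pi> h x = (if h = g then x else 0)) \<and>
          bij_betw (\<lambda>x g. \<pi> g x) L {f. \<forall>g. f g \<in> H g})"

definition graded_lie_algebra ::
  "('k::comm_ring_1 \<Rightarrow> 'a::ab_group_add \<Rightarrow> 'a) \<Rightarrow> 'a set \<Rightarrow> ('g::ab_group_add \<Rightarrow> 'a set) \<Rightarrow>
   ('g \<Rightarrow> 'g \<Rightarrow> bit) \<Rightarrow> ('a \<Rightarrow> 'a \<Rightarrow> 'a) \<Rightarrow> bool" where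
  "graded_lie_algebra sc L H form br \<longleftrightarrow> product_graded sc L H \<and>
     (\<forall>x\<in>L. \<forall>y\<in>L. br x y \<in> L) \<and>
     (\<forall>x\<in>L. linear_map_on sc sc L (\<lambda>y. br x y)) \<and>
     (\<forall>y\<in>L. linear_map_on sc sc L (\<lambda>x. br x y)) \<and>
     (\<forall>g h. \<forall>x\<in>H g. \<forall>y\<in>H h. br x y \<in> H (g + h)) \<and>
     (\<forall>g h. \<forall>x\<in>H g. \<forall>y\<in>H h. br x y = - sc (psgn (form g h)) (br y x)) \<and>
     (\<forall>g h i. \<forall>x\<in>H g. \<forall>y\<in>H h. \<forall>z\<in>H i.
        br x (br y z) = br (br x y) z + sc (psgn (form g h)) (br y (br x z)))"

definition total_parity :: "bit \<times> int \<Rightarrow> bit" where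
  "total_parity = (\<lambda>(a, r). a + of_int r)"

definition bidegree_form :: "bit \<times> int \<Rightarrow> bit \<times> int \<Rightarrow> bit" where
  "bidegree_form g h = total_parity g * total_parity h"

definition differential ::
  "('k::comm_ring_1 \<Rightarrow> 'a::ab_group_add \<Rightarrow> 'a) \<Rightarrow> 'a set \<Rightarrow> ('a \<Rightarrow> 'a) \<Rightarrow> bool" where
  "differential sc L D \<longleftrightarrow>
     (\<forall>x\<in>L. D x \<in> L) \<and> linear_map_on sc sc L D \<and> (\<forall>x\<in>L. D (D x) = 0)"

definition dg_lie_algebra ::
  "('k::comm_ring_1 \<Rightarrow> 'a::ab_group_add \<Rightarrow> 'a) \<Rightarrow> 'a set \<Rightarrow> (bit \<times> int \<Rightarrow> 'a set) \<Rightarrow>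
   ('a \<Rightarrow> 'a \<Rightarrow> 'a) \<Rightarrow> ('a \<Rightarrow> 'a) \<Rightarrow> bool" where
  "dg_lie_algebra sc L H br D \<longleftrightarrow>
     graded_lie_algebra sc L H bidegree_form br \<and> differential sc L D \<and>
     (\<forall>x\<in>L. \<forall>g. \<forall>y\<in>H g. D (br x y) = br x (D y) + sc (psgn (total_parity g)) (br (D x) y))"

end

theory Submission
  imports Defs
begin

text \<open>
  A sum over unshuffles is a signed sum over the ways to split a list into two subsequences, which
  is the coproduct of the exterior coalgebra. Its coassociativity and graded cocommutativity are
  inductions on the list, and no permutation is needed beyond them.

  The associator of the insertion product inserts two maps into different slots of a third one,
  hence is graded symmetric in these two: this pre-Lie identity gives the Jacobi identity. The same
  decomposition of \<open>D (D \<Phi>)\<close> gives a nested part, which vanishes by the \<open>L\<^sub>\<infinity>\<close> relation, and a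
  part with two disjoint insertions, whose terms cancel in pairs.

  Inserting \<open>\<psi>\<close> into the form of \<open>\<phi>\<close> yields \<open>\<phi> \<circ> \<psi>\<close> or, when the last argument enters \<open>\<psi>\<close>,
  a term of \<open>\<psi> \<circ> \<phi>\<close> by cyclicity. So the form of \<open>{\<phi>, \<psi>}\<close> is a single insertion, which is
  alternating, and for odd \<open>l\<close> it coincides with \<open>D\<close>. The Leibniz rule is then the Jacobi identity.
\<close>

text \<open>Parity is not a function of a vector, since 0 is both even and odd. The computations
  therefore run on lists of pairs (parity, vector), and the value of a homogeneous map is tagged
  again before it becomes an argument of another map. Elements of \<open>hom_ext_alg\<close> are
  determined by their values on such lists, because every argument splits by \<open>hproj\<close>.

  The structure \<open>l\<close> behind the differential need not be cyclic. Hence \<open>D\<close>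
  is in general not a bracket, and that it squares to zero needs its own computation. To share the
  work, a single insertion with a weight depending on the two block lengths covers the composition,
  the L_infinity relation and \<open>D\<close>.

  Elements of the products have infinitely many components. The Leibniz rule for homogeneous
  components therefore reaches arbitrary elements by truncation at the length of the argument list.

  The factor \<open>(-1)^((k-1)|\<psi>_j|)\<close> turns the bigraded sign of the commutator into
  the product of the total parities.\<close>

section \<open>Signs\<close>

text \<open>Sign exponents are compared as elements of the Boolean ring \<^typ>\<open>bit\<close>, not as truth values.\<close>

declare add_bit_eq_xor [simp del] mult_bit_eq_and [simp del]

text \<open>Signs act on every abelian group without scalars, so the same rules serve values in
  \<open>V\<close> and in the ground ring, and all sign bookkeeping becomes addition of exponents in
  \<open>bit\<close>.\<close>

definition sg :: "bit \<Rightarrow> 'w::ab_group_add \<Rightarrow> 'w" where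
  "sg e x = (if e = 0 then x else - x)"

lemma bit_UNIV: "(UNIV :: bit set) = {0, 1}"
  by (metis (full_types) UNIV_eq_I bit.exhaust insert_iff)

lemma finite_bits [simp]: "finite (A :: bit set)"
  by (metis bit_UNIV finite.emptyI finite.insertI finite_subset subset_UNIV)

lemma bit_self:
  fixes x y :: bit
  shows "x + x = 0" "x + (x + y) = y" "x * x = x" "x * (x * y) = x * y"
  by (cases x; cases y; simp)+

text \<open>Cancellation \<open>x + x = 0\<close> and idempotence \<open>x * x = x\<close>, with
  their variants inside longer sums and products, let simp compare sign exponents.\<close>

lemmas bit_ring = distrib_left distrib_right add_ac mult_ac bit_self

lemma sg_0 [simp]: "sg 0 x = x" and sg_1 [simp]: "sg 1 x = - x"
  by (simp_all add: sg_def)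

lemma sg_sg [simp]: "sg a (sg b x) = sg (a + b) x"
  by (cases a; cases b; simp)

lemma minus_sg: "- sg a x = sg (a + 1) x"
  by (cases a; simp)

lemma sg_zero [simp]: "sg a 0 = 0"
  by (cases a; simp)

lemma sg_add: "sg a (x + y) = sg a x + sg a y"
  by (cases a; simp)

lemma sg_diff: "sg a (x - y) = sg a x - sg a y"
  by (cases a; simp)

lemma psgn_add: "psgn (a + b) = psgn a * psgn b"
  by (cases a; cases b; simp add: psgn_def)

lemma psgn_mult: "psgn e * x = sg e x"
  by (simp add: psgn_def sg_def)

lemma (in module) scale_psgn: "scale (psgn e) x = sg e x"
  by (simp add: psgn_def sg_def)

lemma (in module) scale_sg: "scale c (sg e x) = sg e (scale c x)"
  by (simp add: sg_def)


section \<open>Signed sums over splittings of a list\<close>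

definition par :: "(bit \<times> 'v) list \<Rightarrow> bit" where
  "par zs = sum_list (map fst zs)"

abbreviation lb :: "'a list \<Rightarrow> bit" where
  "lb zs \<equiv> of_nat (length zs)"

text \<open>The sign of moving the block \<open>A\<close> past the block \<open>B\<close> in the exterior algebra.\<close>

definition xsg :: "(bit \<times> 'v) list \<Rightarrow> (bit \<times> 'v) list \<Rightarrow> bit" where
  "xsg A B = lb A * lb B + par A * par B"

lemma par_simps [simp]: "par [] = 0" "par (z # zs) = fst z + par zs" "par (xs @ ys) = par xs + par ys"
  by (simp_all add: par_def)

text \<open>The head either stays in front of \<open>A\<close> or goes to \<open>B\<close> past all
  of \<open>A\<close>, which costs \<open>xsg [z] A\<close>. Blocks of every length are included, so
  that components of all arities are handled in one sum.\<close>

primrec split_sum ::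
  "(bit \<times> 'v) list \<Rightarrow> ((bit \<times> 'v) list \<Rightarrow> (bit \<times> 'v) list \<Rightarrow> 'w::ab_group_add) \<Rightarrow> 'w" where
  "split_sum [] G = G [] []"
| "split_sum (z # zs) G =
     split_sum zs (\<lambda>A B. G (z # A) B) + split_sum zs (\<lambda>A B. sg (xsg [z] A) (G A (z # B)))"

lemma split_sum_cong:
  assumes "\<And>A B. length A + length B = length zs \<Longrightarrow> par A + par B = par zs \<Longrightarrow>
    set A \<union> set B = set zs \<Longrightarrow> G A B = H A B"
  shows "split_sum zs G = split_sum zs H"
  using assms
proof (induction zs arbitrary: G H)
  case (Cons z zs)
  have "split_sum zs (\<lambda>A B. G (z # A) B) = split_sum zs (\<lambda>A B. H (z # A) B)"
    by (rule Cons.IH, rule Cons.prems) (auto simp: add_ac)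
  moreover have "split_sum zs (\<lambda>A B. sg (xsg [z] A) (G A (z # B))) =
      split_sum zs (\<lambda>A B. sg (xsg [z] A) (H A (z # B)))"
    by (rule Cons.IH, subst Cons.prems) (auto simp: add_ac)
  ultimately show ?case by simp
qed simp

lemma split_sum_hom:
  assumes "\<And>x y. f (x + y) = f x + f (y::'a::ab_group_add)"
  shows "f (split_sum zs G) = split_sum zs (\<lambda>A B. f (G A B))"
proof -
  have f0: "f 0 = 0" using assms[of 0 0] by simp
  have "f (- x) = - f x" for x using assms[of x "- x"] f0 by (simp add: eq_neg_iff_add_eq_0 add.commute)
  then have f_sg: "f (sg a x) = sg a (f x)" for a x by (simp add: sg_def)
  show ?thesis by (induction zs arbitrary: G) (simp_all add: assms f_sg)
qed

lemma split_sum_sg: "split_sum zs (\<lambda>A B. sg a (G A B)) = sg a (split_sum zs G)"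
  by (rule split_sum_hom[symmetric]) (rule sg_add)

lemma split_sum_add:
  "split_sum zs (\<lambda>A B. G A B + H A B) = split_sum zs G + split_sum zs H"
  by (induction zs arbitrary: G H) (simp_all add: sg_add add_ac)

lemma split_sum_0 [simp]: "split_sum zs (\<lambda>A B. 0) = 0"
  by (induction zs) simp_all

lemma split_sum_sum:
  "split_sum zs (\<lambda>A B. \<Sum>i\<in>I. G i A B) = (\<Sum>i\<in>I. split_sum zs (G i))"
  by (induction I rule: infinite_finite_induct) (simp_all add: split_sum_add)

text \<open>The mirror image of the recursion: now joining \<open>B\<close> is free and reaching
  \<open>A\<close> costs \<open>xsg [z] B\<close>. Unshuffles are built up by their largest index,
  and \<open>tilde\<close> singles out the last argument; both need this end of the list.\<close>

lemma split_sum_snoc: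
  "split_sum (zs @ [z]) G =
     split_sum zs (\<lambda>A B. G A (B @ [z])) + split_sum zs (\<lambda>A B. sg (xsg [z] B) (G (A @ [z]) B))"
proof (induction zs arbitrary: G)
  case Nil
  show ?case by (simp add: xsg_def add.commute)
next
  case (Cons y ys)
  show ?case
    by (simp add: Cons.IH sg_add xsg_def) (simp add: bit_ring)
qed

text \<open>The two branches of the recursion trade places when the blocks are exchanged; the signs
  agree since \<open>xsg\<close> is symmetric and additive in each block.\<close>

lemma split_sum_comm: "split_sum zs G = split_sum zs (\<lambda>A B. sg (xsg A B) (G B A))"
proof (induction zs arbitrary: G)
  case (Cons z zs)
  have "split_sum zs (\<lambda>A B. sg (xsg [z] B + xsg A B) (G B (z # A))) =
      split_sum zs (\<lambda>A B. sg (xsg (z # A) B) (G B (z # A)))"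
    by (simp add: xsg_def bit_ring)
  moreover have "split_sum zs (\<lambda>A B. sg (xsg A B) (G (z # B) A)) =
      split_sum zs (\<lambda>A B. sg (xsg [z] A + xsg A (z # B)) (G (z # B) A))"
    by (simp add: xsg_def bit_ring)
  ultimately show ?case
    using Cons[of "\<lambda>A B. G (z # A) B"] Cons[of "\<lambda>A B. sg (xsg [z] A) (G A (z # B))"]
    by (simp add: add.commute)
qed (simp add: xsg_def)

text \<open>Both sides distribute the list over three blocks. Passing a block costs as much as
  passing its two pieces, \<open>xsg [z] P = xsg [z] A + xsg [z] B\<close>, so the signs
  agree.\<close>

lemma split_sum_assoc:
  "split_sum zs (\<lambda>P C. split_sum P (\<lambda>A B. G A B C)) = split_sum zs (\<lambda>A R. split_sum R (\<lambda>B C. G A B C))"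
proof (induction zs arbitrary: G)
  case (Cons z zs)
  have "split_sum zs (\<lambda>P C. sg (xsg [z] P) (split_sum P (\<lambda>A B. G A B (z # C)))) =
      split_sum zs (\<lambda>P C. split_sum P (\<lambda>A B. sg (xsg [z] A + xsg [z] B) (G A B (z # C))))"
    unfolding split_sum_sg[symmetric]
  proof (intro split_sum_cong arg_cong2[of _ _ _ _ sg] refl)
    fix P A B :: "(bit \<times> 'b) list"
    assume "length A + length B = length P"
    then have "lb P = lb A + lb B" by (metis of_nat_add)
    moreover assume "par A + par B = par P"
    ultimately show "xsg [z] P = xsg [z] A + xsg [z] B"
      by (simp add: xsg_def algebra_simps flip: \<open>par A + par B = par P\<close>)
  qed
  then show ?case
    by (simp add: split_sum_add Cons sg_add split_sum_sg[symmetric])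
qed simp

text \<open>No division by \<open>2\<close>: \<open>A\<close> and \<open>B\<close> are exchanged freely, but one of them contains the first entry.\<close>

lemma split_sum_cancel:
  assumes anti: "\<And>A B. set A \<union> set B = set zs \<Longrightarrow> sg (xsg A B) (G B A) = - G A B" and nil: "G [] [] = 0"
  shows "split_sum zs G = 0"
proof (cases zs)
  case (Cons y ys)
  have "split_sum ys (\<lambda>A B. sg (xsg [y] A) (G A (y # B))) =
      split_sum ys (\<lambda>A B. sg (xsg A B) (sg (xsg [y] B) (G B (y # A))))"
    by (rule split_sum_comm)
  also have "\<dots> = sg 1 (split_sum ys (\<lambda>A B. G (y # A) B))"
    unfolding split_sum_sg[symmetric]
  proof (rule split_sum_cong)
    fix A B assume "set A \<union> set B = set ys"
    then have "sg (xsg (y # A) B) (G B (y # A)) = - G (y # A) B"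
      by (intro anti) (auto simp: Cons)
    then show "sg (xsg A B) (sg (xsg [y] B) (G B (y # A))) = sg 1 (G (y # A) B)"
      by (simp add: xsg_def bit_ring)
  qed
  finally show ?thesis by (simp add: Cons)
next
  case Nil
  then show ?thesis by (simp add: nil)
qed


section \<open>Unshuffles\<close>

text \<open>\<open>\<tau> \<circ> cyc p n\<close> inserts the new last entry at position \<open>p\<close>.\<close>

definition cyc :: "nat \<Rightarrow> nat \<Rightarrow> nat \<Rightarrow> nat" where
  "cyc p n i = (if i < p \<or> n < i then i else if i = p then n else i - 1)"

text \<open>The cycle is a product of \<open>n - p\<close> adjacent transpositions; each step of the
  induction multiplies by \<open>transpose n (Suc n)\<close> on the left.\<close>

lemma cyc_permutes_sign:
  assumes "p \<le> n"
  shows "cyc p n permutes {..<Suc n} \<and> sign (cyc p n) = (- 1) ^ (n - p)"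
  using assms
proof (induction n rule: dec_induct)
  case base
  have "cyc p p = id" by (auto simp: cyc_def fun_eq_iff)
  then show ?case by (simp add: permutes_id[unfolded id_def] id_def)
next
  case (step n)
  have eq: "cyc p (Suc n) = transpose n (Suc n) \<circ> cyc p n"
    using step.hyps by (auto simp: cyc_def fun_eq_iff transpose_def)
  have c: "cyc p n permutes {..<Suc (Suc n)}"
    by (rule permutes_subset[of _ "{..<Suc n}"]) (use step.IH in auto)
  have t: "transpose n (Suc n) permutes {..<Suc (Suc n)}"
    by (rule permutes_swap_id) auto
  have "permutation (cyc p n)" "permutation (transpose n (Suc n))"
    using c t by (auto simp: permutation_permutes)
  then have "sign (cyc p (Suc n)) = (- 1) ^ (Suc n - p)"
    using step by (simp add: eq sign_compose sign_swap_id Suc_diff_le)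
  then show ?case using permutes_compose[OF c t] by (simp only: eq)
qed

lemmas cyc_permutes = cyc_permutes_sign[THEN conjunct1]
lemmas sign_cyc = cyc_permutes_sign[THEN conjunct2]

lemma permutes_lessThan_Suc:
  assumes "\<sigma> permutes {..<Suc n}" "\<sigma> n = n"
  shows "\<sigma> permutes {..<n}"
  by (rule permutes_superset[OF assms(1)]) (use assms(2) less_Suc_eq in auto)

text \<open>Being increasing on both blocks, \<open>\<sigma>\<close> takes its largest value
  \<open>n\<close> at the end of one of them, at position \<open>n\<close> or \<open>j - 1\<close>.
  Removing this position leaves an unshuffle of \<open>n\<close> indices, and conversely. For
  \<open>m = 0\<close> the second block is empty, so the value belongs to the first.\<close>

lemma unshuffles_Suc:
  assumes jm: "j + m = Suc n"
  shows "unshuffles j m = (if m = 0 then {} else unshuffles j (m - 1)) \<union>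
    (if j = 0 then {} else (\<lambda>\<tau>. \<tau> \<circ> cyc (j - 1) n) ` unshuffles (j - 1) m)" (is "_ = ?A \<union> ?B")
proof (intro equalityI subsetI)
  fix \<sigma> assume "\<sigma> \<in> unshuffles j m"
  then have perm: "\<sigma> permutes {..<Suc n}"
    and mono: "\<And>i. Suc i < Suc n \<Longrightarrow> Suc i \<noteq> j \<Longrightarrow> \<sigma> i < \<sigma> (Suc i)"
    using jm by (auto simp: unshuffles_def)
  obtain p where p: "\<sigma> p = n" "p < Suc n"
    using permutes_image[OF perm] by (metis imageE lessI lessThan_iff)
  have "\<sigma> i < Suc n" if "i < Suc n" for i
    using permutes_in_image[OF perm, of i] that by simp
  then have "p = n \<or> Suc p = j"
    using mono[of p] p by (metis less_antisym less_Suc_eq not_less_eq Suc_less_eq)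
  then consider "p = n" "m > 0" | "Suc p = j"
    using jm by fastforce
  then show "\<sigma> \<in> ?A \<union> ?B"
  proof cases
    case 1
    then have "\<sigma> \<in> unshuffles j (m - 1)"
      using permutes_lessThan_Suc[OF perm] p mono jm by (auto simp: unshuffles_def)
    then show ?thesis using 1 by simp
  next
    case 2
    have c: "cyc p n permutes {..<Suc n}" using p by (intro cyc_permutes) simp
    define \<tau> where "\<tau> = \<sigma> \<circ> inv (cyc p n)"
    have \<sigma>: "\<sigma> = \<tau> \<circ> cyc p n"
      by (simp add: \<tau>_def fun_eq_iff permutes_inverses(2)[OF c])
    have at: "\<tau> i = \<sigma> (if i < p then i else Suc i)" if "i < n" for i
      using that by (auto simp: \<sigma> cyc_def)
    have "\<tau> n = n" using p by (simp add: \<sigma> cyc_def)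
    moreover have "\<tau> permutes {..<Suc n}"
      unfolding \<tau>_def by (intro permutes_compose permutes_inv c perm)
    ultimately have "\<tau> permutes {..<n}" by (rule permutes_lessThan_Suc[rotated])
    moreover have "\<tau> i < \<tau> (Suc i)" if "Suc i < n" "Suc i \<noteq> p" for i
    proof (cases "i < p")
      case True
      then show ?thesis using that 2 mono[of i] at[of i] at[of "Suc i"] by simp
    next
      case False
      then show ?thesis using that 2 mono[of "Suc i"] at[of i] at[of "Suc i"] by simp
    qed
    ultimately have "\<tau> \<in> unshuffles (j - 1) m" using 2 jm by (auto simp: unshuffles_def)
    then show ?thesis using 2 \<sigma> by auto
  qed
next
  fix \<sigma> assume "\<sigma> \<in> ?A \<union> ?B"
  then consider "m > 0" "\<sigma> \<in> unshuffles j (m - 1)"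
    | \<tau> where "j > 0" "\<sigma> = \<tau> \<circ> cyc (j - 1) n" "\<tau> \<in> unshuffles (j - 1) m"
    by (auto split: if_splits)
  then show "\<sigma> \<in> unshuffles j m"
  proof cases
    case 1
    then have perm: "\<sigma> permutes {..<n}"
      and mono: "\<And>i. Suc i < n \<Longrightarrow> Suc i \<noteq> j \<Longrightarrow> \<sigma> i < \<sigma> (Suc i)"
      using jm by (auto simp: unshuffles_def)
    have "\<sigma> i < \<sigma> (Suc i)" if "Suc i < Suc n" "Suc i \<noteq> j" for i
    proof (cases "Suc i = n")
      case True
      then have "\<sigma> i < n" using permutes_in_image[OF perm, of i] by auto
      then show ?thesis using True permutes_not_in[OF perm, of n] by simp
    qed (use that mono in auto)
    then show ?thesis
      using permutes_subset[OF perm, of "{..<Suc n}"] jm by (auto simp: unshuffles_def)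
  next
    case 2
    define p where "p = j - 1"
    have j: "j = Suc p" using 2 by (simp add: p_def)
    have \<sigma>: "\<sigma> = \<tau> \<circ> cyc p n" using 2 by (simp add: p_def)
    have perm: "\<tau> permutes {..<n}"
      and mono: "\<And>i. Suc i < n \<Longrightarrow> Suc i \<noteq> p \<Longrightarrow> \<tau> i < \<tau> (Suc i)"
      using 2 jm by (auto simp: unshuffles_def j)
    have "\<sigma> permutes {..<Suc n}"
      unfolding \<sigma>
      using permutes_subset[OF perm, of "{..<Suc n}"] j jm by (intro permutes_compose cyc_permutes) auto
    moreover have "\<sigma> i < \<sigma> (Suc i)" if i: "Suc i < Suc n" "Suc i \<noteq> Suc p" for i
    proof -
      consider "Suc i < p" | "Suc i = p" | "i > p" using i by linarith
      then show ?thesis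
      proof cases
        case 1
        then show ?thesis using mono[of i] i jm j by (simp add: \<sigma> cyc_def)
      next
        case h: 2
        then have "\<tau> i < n" using permutes_in_image[OF perm, of i] i by auto
        then show ?thesis using h permutes_not_in[OF perm, of n] i by (simp add: \<sigma> cyc_def)
      next
        case 3
        then show ?thesis using mono[of "i - 1"] i by (simp add: \<sigma> cyc_def)
      qed
    qed
    ultimately show ?thesis using jm j by (auto simp: unshuffles_def)
  qed
qed

lemma finite_unshuffles: "finite (unshuffles j m)"
  by (rule finite_subset[OF _ finite_permutations[of "{..<j + m}"]]) (auto simp: unshuffles_def)

lemma koszul_snoc_fixed:
  assumes "\<sigma> permutes {..<n}" "length es = n"
  shows "koszul (es @ [e]) \<sigma> = koszul es \<sigma>"
proof -
  have lt: "\<sigma> a < n" if "a < n" for a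
    using permutes_in_image[OF assms(1), of a] that by simp
  have "\<sigma> n = n" using permutes_not_in[OF assms(1), of n] by simp
  then have "{(a, b). a < b \<and> b < Suc n \<and> \<sigma> b < \<sigma> a} = {(a, b). a < b \<and> b < n \<and> \<sigma> b < \<sigma> a}"
    using lt by (auto simp: less_Suc_eq) (metis less_asym)
  moreover have "(es @ [e]) ! \<sigma> a = es ! \<sigma> a" if "a < n" for a
    using lt[OF that] assms(2) by (simp add: nth_append)
  ultimately show ?thesis
    by (simp add: koszul_def assms(2)) (intro prod.cong refl, clarsimp)
qed

lemma psgn_sum: "psgn (sum f S) = (\<Prod>x\<in>S. psgn (f x))"
  by (induction S rule: infinite_finite_induct) (simp_all add: psgn_add, simp_all add: psgn_def)

lemma psgn_of_nat: "psgn (of_nat n) = (- 1) ^ n"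
  by (induction n) (simp_all add: psgn_add, simp_all add: psgn_def)

text \<open>Putting the largest value at position \<open>p\<close> keeps the old inversions, with
  shifted positions, and adds one inversion of \<open>p\<close> with every later position. The new
  factor is thus the sign of moving a factor of parity \<open>e\<close> past the entries from
  \<open>p\<close> on.\<close>

lemma koszul_snoc_cyc:
  assumes perm: "\<tau> permutes {..<n}" and len: "length es = n" and p: "p \<le> n"
  shows "koszul (es @ [e]) (\<tau> \<circ> cyc p n) = koszul es \<tau> * psgn (e * (\<Sum>b\<in>{p..<n}. es ! \<tau> b))"
proof -
  have lt: "\<tau> a < n" if "a < n" for a
    using permutes_in_image[OF perm, of a] that by simp
  have n: "\<tau> n = n" using permutes_not_in[OF perm, of n] by simp
  \<comment> \<open>The old positions in the new numbering, which skips \<open>p\<close>; below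
    \<open>n\<close> this is a right inverse of \<open>cyc p n\<close>.\<close>
  define s where "s i = (if i < p then i else Suc i)" for i
  have cs: "cyc p n (s i) = i" if "i < n" for i using that by (auto simp: s_def cyc_def)
  have cp: "cyc p n p = n" using p by (simp add: cyc_def)
  have s_less: "s a < s b \<longleftrightarrow> a < b" for a b by (auto simp: s_def)
  have s_Suc: "s a < Suc n \<longleftrightarrow> a < n" for a using p by (auto simp: s_def)
  have s_ex: "\<exists>a'. a = s a'" if "a \<noteq> p" for a
    using that by (intro exI[of _ "if a < p then a else a - 1"]) (auto simp: s_def)
  let ?I = "{(a, b). a < b \<and> b < n \<and> \<tau> b < \<tau> a}"
  let ?J = "{(a, b). a < b \<and> b < Suc n \<and> (\<tau> \<circ> cyc p n) b < (\<tau> \<circ> cyc p n) a}"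
  let ?h = "\<lambda>(a, b). (s a, s b)" and ?k = "\<lambda>b. (p, s b)"
  have J: "?J = ?h ` ?I \<union> ?k ` {p..<n}"
  proof (intro equalityI subsetI)
    fix x assume "x \<in> ?J"
    then obtain a b where x: "x = (a, b)" "a < b" "b < Suc n" "\<tau> (cyc p n b) < \<tau> (cyc p n a)" by auto
    have "b \<noteq> p"
    proof
      assume b: "b = p"
      then have "cyc p n a < n" using x p by (auto simp: cyc_def)
      then show False using x lt[of "cyc p n a"] b by (simp add: cp n)
    qed
    then obtain b' where b': "b = s b'" using s_ex by blast
    show "x \<in> ?h ` ?I \<union> ?k ` {p..<n}"
    proof (cases "a = p")
      case True
      then show ?thesis using x b' s_Suc by (auto simp: s_def split: if_splits)
    next
      case False
      then obtain a' where a': "a = s a'" using s_ex by blast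
      have "(a', b') \<in> ?I" using x s_less s_Suc by (auto simp: a' b' cs)
      then show ?thesis using x a' b' by force
    qed
  next
    fix x assume "x \<in> ?h ` ?I \<union> ?k ` {p..<n}"
    then show "x \<in> ?J"
      using s_less s_Suc by (auto simp: cs cp n lt) (auto simp: s_def)
  qed
  have fin: "finite ?I" by (rule finite_subset[of _ "{..<n} \<times> {..<n}"]) auto
  have inj: "inj_on ?h ?I" "inj_on ?k {p..<n}"
    by (auto simp: inj_on_def s_def split: if_splits)
  have disj: "?h ` ?I \<inter> ?k ` {p..<n} = {}" by (auto simp: s_def split: if_splits)
  have nth: "(es @ [e]) ! i = es ! i" if "i < n" for i using that len by (simp add: nth_append)
  have nth_n: "(es @ [e]) ! n = e" using len by (simp add: nth_append)
  let ?f = "\<lambda>(a, b). psgn ((es @ [e]) ! (\<tau> \<circ> cyc p n) a * (es @ [e]) ! (\<tau> \<circ> cyc p n) b)"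
  have "koszul (es @ [e]) (\<tau> \<circ> cyc p n) = prod ?f (?h ` ?I) * prod ?f (?k ` {p..<n})"
    unfolding koszul_def using len fin disj J by (simp add: prod.union_disjoint)
  also have "prod ?f (?h ` ?I) = koszul es \<tau>"
    unfolding koszul_def len using inj
    by (subst prod.reindex) (auto intro!: prod.cong simp: nth cs lt)
  also have "prod ?f (?k ` {p..<n}) = psgn (e * (\<Sum>b\<in>{p..<n}. es ! \<tau> b))"
    using inj unfolding sum_distrib_left psgn_sum
    by (subst prod.reindex) (auto intro!: prod.cong simp: nth nth_n cs cp n lt)
  finally show ?thesis .
qed

lemma permute_list_snoc_fixed:
  assumes "\<sigma> permutes {..<length zs}"
  shows "permute_list \<sigma> (zs @ [z]) = permute_list \<sigma> zs @ [z]"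
proof -
  have "\<sigma> a < length zs" if "a < length zs" for a
    using permutes_in_image[OF assms, of a] that by simp
  moreover have "\<sigma> (length zs) = length zs" using permutes_not_in[OF assms, of "length zs"] by simp
  ultimately show ?thesis
    by (auto simp: permute_list_def nth_append)
qed

lemma permute_list_snoc_cyc:
  assumes "\<tau> permutes {..<length zs}" "p \<le> length zs"
  shows "permute_list (\<tau> \<circ> cyc p (length zs)) (zs @ [z]) =
    take p (permute_list \<tau> zs) @ z # drop p (permute_list \<tau> zs)" (is "?l = ?r")
proof (rule nth_equalityI)
  have lt: "\<tau> a < length zs" if "a < length zs" for a
    using permutes_in_image[OF assms(1), of a] that by simp
  have n: "\<tau> (length zs) = length zs" using permutes_not_in[OF assms(1), of "length zs"] by simp
  show "length ?l = length ?r" using assms(2) by simp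
  fix i assume "i < length ?l"
  then have i: "i < Suc (length zs)" by simp
  consider "i < p" | "i = p" | "i > p" by linarith
  then show "?l ! i = ?r ! i"
    using i assms(2) lt[of i] lt[of "i - 1"] n
    by cases (simp_all add: permute_list_def nth_append cyc_def nth_Cons' del: upt_Suc)
qed

text \<open>Reverse induction matches \<open>unshuffles_Suc\<close> with
  \<open>split_sum_snoc\<close>: an unshuffle that fixes the last index appends it to
  \<open>B\<close>, and one of the form \<open>\<tau> \<circ> cyc (j - 1) n\<close> appends it to
  \<open>A\<close>.\<close>

lemma sum_unshuffles_eq_split_sum:
  fixes t :: "'k::comm_ring_1 \<Rightarrow> 'w::ab_group_add \<Rightarrow> 'w"
  assumes "module t" "length zs = j + m"
  shows "(\<Sum>\<sigma>\<in>unshuffles j m. t (of_int (sign \<sigma>) * koszul (map fst zs) \<sigma>)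
      (G (take j (permute_list \<sigma> zs)) (drop j (permute_list \<sigma> zs)))) =
    split_sum zs (\<lambda>A B. if length A = j then G A B else 0)"
  using assms(2)
proof (induction zs arbitrary: j m G rule: rev_induct)
  case Nil
  interpret module t by fact
  have "unshuffles 0 0 = {id}" by (auto simp: unshuffles_def)
  then show ?case using Nil by (simp add: koszul_def)
next
  case (snoc z zs)
  interpret module t by fact
  define n where "n = length zs"
  have jm: "j + m = Suc n" using snoc.prems by (simp add: n_def)
  let ?F = "\<lambda>\<sigma>. t (of_int (sign \<sigma>) * koszul (map fst (zs @ [z])) \<sigma>)
      (G (take j (permute_list \<sigma> (zs @ [z]))) (drop j (permute_list \<sigma> (zs @ [z]))))"
  let ?A = "if m = 0 then {} else unshuffles j (m - 1)"
  let ?B = "if j = 0 then {} else (\<lambda>\<tau>. \<tau> \<circ> cyc (j - 1) n) ` unshuffles (j - 1) m"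
  have "sum ?F ?A = split_sum zs (\<lambda>A B. if length A = j then G A (B @ [z]) else 0)"
  proof (cases "m = 0")
    case True
    have "split_sum zs (\<lambda>A B. if length A = j then G A (B @ [z]) else 0) = split_sum zs (\<lambda>A B. 0)"
      using True jm by (intro split_sum_cong) (auto simp: n_def)
    then show ?thesis using True by simp
  next
    case False
    have "sum ?F (unshuffles j (m - 1)) = (\<Sum>\<sigma>\<in>unshuffles j (m - 1).
        t (of_int (sign \<sigma>) * koszul (map fst zs) \<sigma>)
          (G (take j (permute_list \<sigma> zs)) (drop j (permute_list \<sigma> zs) @ [z])))"
    proof (rule sum.cong[OF refl])
      fix \<sigma> assume "\<sigma> \<in> unshuffles j (m - 1)"
      then have "\<sigma> permutes {..<n}" using False jm by (auto simp: unshuffles_def)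
      then show "?F \<sigma> = t (of_int (sign \<sigma>) * koszul (map fst zs) \<sigma>)
          (G (take j (permute_list \<sigma> zs)) (drop j (permute_list \<sigma> zs) @ [z]))"
        using False jm
        by (simp add: n_def permute_list_snoc_fixed koszul_snoc_fixed[of _ "length zs"])
    qed
    then show ?thesis using False snoc.IH[of j "m - 1" "\<lambda>A B. G A (B @ [z])"] jm by (simp add: n_def)
  qed
  moreover have "sum ?F ?B =
      split_sum zs (\<lambda>A B. sg (xsg [z] B) (if Suc (length A) = j then G (A @ [z]) B else 0))"
  proof (cases j)
    case 0
    then show ?thesis by simp
  next
    case (Suc p)
    have p: "p \<le> n" "n - p = m" using Suc jm by auto
    have c: "cyc p n permutes {..<Suc n}" using p by (intro cyc_permutes)
    have "inj_on (\<lambda>\<tau>. \<tau> \<circ> cyc p n) (unshuffles p m)"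
      by (intro inj_onI) (metis comp_assoc comp_id permutes_inv_o(1)[OF c])
    then have "sum ?F ?B = (\<Sum>\<tau>\<in>unshuffles p m. ?F (\<tau> \<circ> cyc p n))"
      using Suc by (simp add: sum.reindex)
    also have "\<dots> = (\<Sum>\<tau>\<in>unshuffles p m. t (of_int (sign \<tau>) * koszul (map fst zs) \<tau>)
        ((\<lambda>A B. sg (xsg [z] B) (G (A @ [z]) B)) (take p (permute_list \<tau> zs)) (drop p (permute_list \<tau> zs))))"
    proof (rule sum.cong[OF refl])
      fix \<tau> assume "\<tau> \<in> unshuffles p m"
      then have perm: "\<tau> permutes {..<n}" using p by (auto simp: unshuffles_def)
      then have "permutation \<tau>" "permutation (cyc p n)" using c by (auto simp: permutation_permutes)
      then have sgn: "sign (\<tau> \<circ> cyc p n) = sign \<tau> * (- 1) ^ m"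
        using p by (simp add: sign_compose sign_cyc)
      let ?B = "drop p (permute_list \<tau> zs)"
      have "map fst ?B = map (\<lambda>b. map fst zs ! \<tau> b) [p..<n]"
      proof -
        have "\<tau> a < n" if "a < n" for a using permutes_in_image[OF perm, of a] that by simp
        then show ?thesis
          by (auto simp: permute_list_def drop_map simp flip: n_def)
      qed
      then have parB: "par ?B = (\<Sum>b\<in>{p..<n}. map fst zs ! \<tau> b)"
        by (simp add: par_def interv_sum_list_conv_sum_set_nat)
      have "length ?B = m" using p by (simp add: n_def)
      \<comment> \<open>The cycle contributes \<open>(-1)^m\<close>, one transposition per entry of
        \<open>B\<close>, and the Koszul sign contributes the parities; together they form
        \<open>xsg [z] B\<close>.\<close>
      then have x: "psgn (xsg [z] ?B) = (- 1) ^ m * (psgn (fst z * (\<Sum>b\<in>{p..<n}. map fst zs ! \<tau> b)) :: 'k)"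
        by (simp add: xsg_def psgn_add parB psgn_of_nat)
      have "?F (\<tau> \<circ> cyc p n) = t (of_int (sign \<tau>) * koszul (map fst zs) \<tau> * psgn (xsg [z] ?B))
          (G (take p (permute_list \<tau> zs) @ [z]) ?B)"
        using Suc p perm koszul_snoc_cyc[OF perm _ p(1), of "map fst zs" "fst z", where 'a = 'k]
        by (simp add: sgn[unfolded n_def] x[unfolded n_def] permute_list_snoc_cyc mult_ac n_def)
      then show "?F (\<tau> \<circ> cyc p n) = t (of_int (sign \<tau>) * koszul (map fst zs) \<tau>)
          ((\<lambda>A B. sg (xsg [z] B) (G (A @ [z]) B)) (take p (permute_list \<tau> zs)) ?B)"
        by (simp only: scale_psgn[symmetric] scale_scale)
    qed
    also have "\<dots> = split_sum zs (\<lambda>A B. if length A = p then sg (xsg [z] B) (G (A @ [z]) B) else 0)"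
      by (rule snoc.IH) (use p in \<open>simp add: n_def\<close>)
    also have "\<dots> = split_sum zs (\<lambda>A B. sg (xsg [z] B) (if Suc (length A) = j then G (A @ [z]) B else 0))"
      by (rule split_sum_cong) (simp add: Suc)
    finally show ?thesis .
  qed
  \<comment> \<open>The first family fixes the index \<open>n\<close>, whereas the second takes the
    value \<open>n\<close> at \<open>j - 1 < n\<close>.\<close>
  moreover have "?A \<inter> ?B = {}"
  proof (rule equals0I)
    fix \<sigma> assume "\<sigma> \<in> ?A \<inter> ?B"
    then obtain \<tau> where \<sigma>: "m > 0" "j > 0" "\<sigma> \<in> unshuffles j (m - 1)" "\<tau> \<in> unshuffles (j - 1) m"
      "\<sigma> = \<tau> \<circ> cyc (j - 1) n" by (auto split: if_splits)
    then have perm: "\<sigma> permutes {..<n}" "\<tau> permutes {..<n}" using jm by (auto simp: unshuffles_def)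
    have j: "j - 1 < n" using \<sigma> jm by simp
    moreover have "\<sigma> (j - 1) = n"
      using \<sigma> j permutes_not_in[OF perm(2), of n] by (simp add: cyc_def)
    ultimately show False using permutes_in_image[OF perm(1), of "j - 1"] by simp
  qed
  then have "sum ?F (?A \<union> ?B) = sum ?F ?A + sum ?F ?B"
    by (intro sum.union_disjoint) (simp_all add: finite_unshuffles)
  ultimately show ?case
    by (simp only: unshuffles_Suc[OF jm] split_sum_snoc length_append_singleton)
qed


section \<open>Graded alternating maps\<close>

type_synonym 'v tagged_list = "(bit \<times> 'v) list"

definition tagged :: "(bit \<Rightarrow> 'v set) \<Rightarrow> 'v tagged_list \<Rightarrow> bool" where
  "tagged V zs \<longleftrightarrow> (\<forall>(e, v)\<in>set zs. v \<in> V e)"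

lemma tagged_simps [simp]:
  "tagged V []" "tagged V (z # zs) \<longleftrightarrow> snd z \<in> V (fst z) \<and> tagged V zs"
  "tagged V (us @ ws) \<longleftrightarrow> tagged V us \<and> tagged V ws"
  by (auto simp: tagged_def case_prod_unfold)

lemma tagged_union:
  assumes "set A \<union> set B = set zs" "tagged V zs"
  shows "tagged V A" "tagged V B"
  using assms unfolding tagged_def by blast+

lemma homog_args_tagged: "homog_args V (map snd zs) (map fst zs) \<longleftrightarrow> tagged V zs"
  by (auto simp: homog_args_def tagged_def list_all2_conv_all_nth all_set_conv_all_nth case_prod_unfold)

lemma homog_args_obtain_tagged:
  assumes "homog_args V xs es"
  obtains zs where "xs = map snd zs" "es = map fst zs" "tagged V zs"
proof -
  have "length xs = length es" using assms by (auto simp: homog_args_def list_all2_lengthD)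
  then have "xs = map snd (zip es xs)" "es = map fst (zip es xs)" by simp_all
  then show ?thesis using assms homog_args_tagged by (metis that)
qed

text \<open>Arguments carry their parity, so that homogeneous maps need no projections.\<close>

definition graded_alt ::
  "('k::comm_ring_1 \<Rightarrow> 'v::ab_group_add \<Rightarrow> 'v) \<Rightarrow> (bit \<Rightarrow> 'v set) \<Rightarrow>
   ('k \<Rightarrow> 'w::ab_group_add \<Rightarrow> 'w) \<Rightarrow> ('v tagged_list \<Rightarrow> 'w) \<Rightarrow> bool" where
  "graded_alt s V t T \<longleftrightarrow>
     (\<forall>us ws e x y. tagged V us \<longrightarrow> tagged V ws \<longrightarrow> x \<in> V e \<longrightarrow> y \<in> V e \<longrightarrow>
        T (us @ (e, x + y) # ws) = T (us @ (e, x) # ws) + T (us @ (e, y) # ws)) \<and>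
     (\<forall>us ws e c x. tagged V us \<longrightarrow> tagged V ws \<longrightarrow> x \<in> V e \<longrightarrow>
        T (us @ (e, s c x) # ws) = t c (T (us @ (e, x) # ws))) \<and>
     (\<forall>us ws p q x y. tagged V us \<longrightarrow> tagged V ws \<longrightarrow> x \<in> V p \<longrightarrow> y \<in> V q \<longrightarrow>
        T (us @ (p, x) # (q, y) # ws) = sg (p * q + 1) (T (us @ (q, y) # (p, x) # ws)))"

lemma graded_altI:
  assumes "\<And>us ws e x y. tagged V us \<Longrightarrow> tagged V ws \<Longrightarrow> x \<in> V e \<Longrightarrow> y \<in> V e \<Longrightarrow>
        T (us @ (e, x + y) # ws) = T (us @ (e, x) # ws) + T (us @ (e, y) # ws)"
    and "\<And>us ws e c x. tagged V us \<Longrightarrow> tagged V ws \<Longrightarrow> x \<in> V e \<Longrightarrow>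
        T (us @ (e, s c x) # ws) = t c (T (us @ (e, x) # ws))"
    and "\<And>us ws p q x y. tagged V us \<Longrightarrow> tagged V ws \<Longrightarrow> x \<in> V p \<Longrightarrow> y \<in> V q \<Longrightarrow>
        T (us @ (p, x) # (q, y) # ws) = sg (p * q + 1) (T (us @ (q, y) # (p, x) # ws))"
  shows "graded_alt s V t T"
  using assms unfolding graded_alt_def by blast

lemma
  assumes "graded_alt s V t T" "tagged V us" "tagged V ws"
  shows graded_alt_add: "x \<in> V e \<Longrightarrow> y \<in> V e \<Longrightarrow>
        T (us @ (e, x + y) # ws) = T (us @ (e, x) # ws) + T (us @ (e, y) # ws)"
    and graded_alt_scale: "x \<in> V e \<Longrightarrow> T (us @ (e, s c x) # ws) = t c (T (us @ (e, x) # ws))"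
    and graded_alt_swap: "x \<in> V p \<Longrightarrow> y \<in> V q \<Longrightarrow>
        T (us @ (p, x) # (q, y) # ws) = sg (p * q + 1) (T (us @ (q, y) # (p, x) # ws))"
  using assms unfolding graded_alt_def by blast+

lemma graded_alt_zero_arg:
  assumes "graded_alt s V t T" "tagged V us" "tagged V ws" "0 \<in> V e"
  shows "T (us @ (e, 0) # ws) = 0"
  using graded_alt_add[OF assms(1-3) assms(4) assms(4)] by simp

lemma graded_alt_Cons:
  assumes "graded_alt s V t T" "x \<in> V e"
  shows "graded_alt s V t (\<lambda>A. T ((e, x) # A))"
proof (rule graded_altI, goal_cases)
  case (1 us ws e' y z)
  then show ?case using graded_alt_add[OF assms(1), of "(e, x) # us" ws] assms(2) by simp
next
  case (2 us ws e' c y)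
  then show ?case using graded_alt_scale[OF assms(1), of "(e, x) # us" ws] assms(2) by simp
next
  case (3 us ws p q y z)
  then show ?case using graded_alt_swap[OF assms(1), of "(e, x) # us" ws y p z q] assms(2) by simp
qed

text \<open>Length and total parity agree for all lists that occur in one of the three identities,
  so the sign is a common factor of each identity.\<close>

lemma graded_alt_sg:
  assumes "module t" "graded_alt s V t T"
  shows "graded_alt s V t (\<lambda>A. sg (f (length A) (par A)) (T A))"
proof -
  interpret W: module t by fact
  show ?thesis
  proof (rule graded_altI, goal_cases)
    case (1 us ws e x y)
    then show ?case by (simp add: graded_alt_add[OF assms(2)] sg_add)
  next
    case (2 us ws e c x)
    then show ?case by (simp add: graded_alt_scale[OF assms(2)] W.scale_sg)
  next
    case (3 us ws p q x y)
    have "par (us @ (p, x) # (q, y) # ws) = par (us @ (q, y) # (p, x) # ws)" by (simp add: add_ac)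
    then show ?case using graded_alt_swap[OF assms(2) 3] by (simp add: add_ac)
  qed
qed

text \<open>The entry passes the block one neighbour at a time, and the exponents
  \<open>e * p + 1\<close> of these swaps add up to \<open>xsg\<close>. In \<open>tilde_hbr\<close>
  this is the cyclic rotation of a form.\<close>

lemma graded_alt_rotate:
  assumes "graded_alt s V t T" "tagged V us" "tagged V ws" "tagged V B" "y \<in> V e"
  shows "T (us @ (e, y) # B @ ws) = sg (xsg [(e, y)] B) (T (us @ B @ (e, y) # ws))"
  using assms
proof (induction B arbitrary: us)
  case (Cons b B)
  obtain p x where b: "b = (p, x)" by (cases b)
  have "T (us @ (e, y) # b # (B @ ws)) = sg (e * p + 1) (T ((us @ [b]) @ (e, y) # B @ ws))"
    using Cons.prems graded_alt_swap[of s V t T us "B @ ws" y e x p] by (simp add: b)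
  also have "T ((us @ [b]) @ (e, y) # B @ ws) = sg (xsg [(e, y)] B) (T ((us @ [b]) @ B @ (e, y) # ws))"
    using Cons.prems by (intro Cons.IH) auto
  finally show ?case by (simp add: b xsg_def bit_ring)
qed (simp add: xsg_def)

definition graded_alt2 ::
  "('k::comm_ring_1 \<Rightarrow> 'v::ab_group_add \<Rightarrow> 'v) \<Rightarrow> (bit \<Rightarrow> 'v set) \<Rightarrow> ('k \<Rightarrow> 'w::ab_group_add \<Rightarrow> 'w) \<Rightarrow>
   ('v tagged_list \<Rightarrow> 'v tagged_list \<Rightarrow> 'w) \<Rightarrow> bool" where
  "graded_alt2 s V t G \<longleftrightarrow> (\<forall>R. tagged V R \<longrightarrow>
     graded_alt s V t (\<lambda>A. G A R) \<and> graded_alt s V t (\<lambda>B. G R B))"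

lemma graded_alt2_Cons1:
  assumes "graded_alt2 s V t G" "x \<in> V e"
  shows "graded_alt2 s V t (\<lambda>A B. G ((e, x) # A) B)"
  using assms graded_alt_Cons[of s V t "\<lambda>A. G A R" x e for R]
  unfolding graded_alt2_def by simp

lemma graded_alt2_Cons2:
  assumes "module t" "graded_alt2 s V t G" "x \<in> V e"
  shows "graded_alt2 s V t (\<lambda>A B. sg (xsg [(e, x)] A) (G A ((e, x) # B)))"
  unfolding graded_alt2_def
proof (intro allI impI conjI)
  fix R assume R: "tagged V R"
  have "graded_alt s V t (\<lambda>A. G A ((e, x) # R))"
    using assms R unfolding graded_alt2_def by simp
  from graded_alt_sg[OF assms(1) this, of "\<lambda>n p. of_nat n + e * p"]
  show "graded_alt s V t (\<lambda>A. sg (xsg [(e, x)] A) (G A ((e, x) # R)))"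
    by (simp add: xsg_def)
  have "graded_alt s V t (\<lambda>B. G R ((e, x) # B))"
    using assms R by (intro graded_alt_Cons) (auto simp: graded_alt2_def)
  from graded_alt_sg[OF assms(1) this, of "\<lambda>n p. xsg [(e, x)] R"]
  show "graded_alt s V t (\<lambda>B. sg (xsg [(e, x)] R) (G R ((e, x) # B)))"
    by simp
qed

lemma
  assumes "graded_alt2 s V t G" "tagged V R"
  shows graded_alt2_left: "graded_alt s V t (\<lambda>A. G A R)"
    and graded_alt2_right: "graded_alt s V t (\<lambda>B. G R B)"
  using assms unfolding graded_alt2_def by auto

lemma split_sum_cong_tagged:
  assumes "tagged V zs" "\<And>A B. tagged V A \<Longrightarrow> tagged V B \<Longrightarrow> G A B = H A B"
  shows "split_sum zs G = split_sum zs H"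
  by (rule split_sum_cong, rule assms(2)) (use assms(1) tagged_union in blast)+

text \<open>The reason why insertions are alternating. Entries in front of the changed place are
  distributed first and absorbed into \<open>G\<close>, so the changed entries become heads of the
  list. Two swapped heads in the same block are handled by \<open>G\<close>, two in different blocks
  by the sign of \<open>split_sum\<close>.\<close>

lemma graded_alt_split_sum:
  fixes G :: "(bit \<times> 'v::ab_group_add) list \<Rightarrow> 'v tagged_list \<Rightarrow> 'w::ab_group_add"
  assumes "module t" "graded_alt2 s V t G"
  shows "graded_alt s V t (\<lambda>zs. split_sum zs G)"
proof (rule graded_altI)
  interpret W: module t by fact
  note Cons12 = graded_alt2_Cons1 graded_alt2_Cons2[OF assms(1)]
  show "split_sum (us @ (e, x + y) # ws) G =
      split_sum (us @ (e, x) # ws) G + split_sum (us @ (e, y) # ws) G"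
    if "tagged V us" "tagged V ws" "x \<in> V e" "y \<in> V e" for us ws e x y
    using that assms(2)
  proof (induction us arbitrary: G)
    case Nil
    have "split_sum ws (\<lambda>A B. G ((e, x + y) # A) B) =
        split_sum ws (\<lambda>A B. G ((e, x) # A) B + G ((e, y) # A) B)"
    proof (rule split_sum_cong_tagged[OF Nil(2)])
      fix A B assume "tagged V A" "tagged V B"
      then show "G ((e, x + y) # A) B = G ((e, x) # A) B + G ((e, y) # A) B"
        using graded_alt_add[OF graded_alt2_left[OF Nil(5)], of B "[]" A x e y] Nil(3,4) by simp
    qed
    moreover have "split_sum ws (\<lambda>A B. sg (xsg [(e, x + y)] A) (G A ((e, x + y) # B))) =
        split_sum ws (\<lambda>A B. sg (xsg [(e, x)] A) (G A ((e, x) # B)) + sg (xsg [(e, y)] A) (G A ((e, y) # B)))"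
    proof (rule split_sum_cong_tagged[OF Nil(2)])
      fix A B assume "tagged V A" "tagged V B"
      then show "sg (xsg [(e, x + y)] A) (G A ((e, x + y) # B)) =
          sg (xsg [(e, x)] A) (G A ((e, x) # B)) + sg (xsg [(e, y)] A) (G A ((e, y) # B))"
        using graded_alt_add[OF graded_alt2_right[OF Nil(5)], of A "[]" B x e y] Nil(3,4)
        by (simp add: xsg_def flip: sg_add)
    qed
    ultimately show ?case by (simp add: split_sum_add add_ac)
  next
    case (Cons u us)
    then show ?case by (cases u) (simp add: Cons12 add_ac)
  qed
  show "split_sum (us @ (e, s c x) # ws) G = t c (split_sum (us @ (e, x) # ws) G)"
    if "tagged V us" "tagged V ws" "x \<in> V e" for us ws e c x
    using that assms(2)
  proof (induction us arbitrary: G)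
    case Nil
    have "split_sum ws (\<lambda>A B. G ((e, s c x) # A) B) = split_sum ws (\<lambda>A B. t c (G ((e, x) # A) B))"
    proof (rule split_sum_cong_tagged[OF Nil(2)])
      fix A B assume "tagged V A" "tagged V B"
      then show "G ((e, s c x) # A) B = t c (G ((e, x) # A) B)"
        using graded_alt_scale[OF graded_alt2_left[OF Nil(4)], of B "[]" A x e c] Nil(3,4) by simp
    qed
    moreover have "split_sum ws (\<lambda>A B. sg (xsg [(e, s c x)] A) (G A ((e, s c x) # B))) =
        split_sum ws (\<lambda>A B. t c (sg (xsg [(e, x)] A) (G A ((e, x) # B))))"
    proof (rule split_sum_cong_tagged[OF Nil(2)])
      fix A B assume "tagged V A" "tagged V B"
      then show "sg (xsg [(e, s c x)] A) (G A ((e, s c x) # B)) = t c (sg (xsg [(e, x)] A) (G A ((e, x) # B)))"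
        using graded_alt_scale[OF graded_alt2_right[OF Nil(4)], of A "[]" B x e c] Nil(3)
        by (simp add: xsg_def W.scale_sg)
    qed
    ultimately show ?case
      by (simp add: W.scale_right_distrib split_sum_hom[of "t c", OF W.scale_right_distrib])
  next
    case (Cons u us)
    then show ?case by (cases u) (simp add: Cons12 W.scale_right_distrib)
  qed
  show "split_sum (us @ (p, x) # (q, y) # ws) G = sg (p * q + 1) (split_sum (us @ (q, y) # (p, x) # ws) G)"
    if "tagged V us" "tagged V ws" "x \<in> V p" "y \<in> V q" for us ws p q x y
    using that assms(2)
  proof (induction us arbitrary: G)
    case Nil
    have "split_sum ws (\<lambda>A B. G ((p, x) # (q, y) # A) B) =
        split_sum ws (\<lambda>A B. sg (p * q + 1) (G ((q, y) # (p, x) # A) B))"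
    proof (rule split_sum_cong_tagged[OF Nil(2)])
      fix A B assume "tagged V A" "tagged V B"
      then show "G ((p, x) # (q, y) # A) B = sg (p * q + 1) (G ((q, y) # (p, x) # A) B)"
        using graded_alt_swap[OF graded_alt2_left[OF Nil(5)], of B "[]" A x p y q] Nil(3,4) by simp
    qed
    moreover have "split_sum ws (\<lambda>A B. sg (xsg [(q, y)] A + xsg [(p, x)] A) (G A ((p, x) # (q, y) # B))) =
        split_sum ws (\<lambda>A B. sg (p * q + 1) (sg (xsg [(p, x)] A + xsg [(q, y)] A) (G A ((q, y) # (p, x) # B))))"
    proof (rule split_sum_cong_tagged[OF Nil(2)])
      fix A B assume "tagged V A" "tagged V B"
      then show "sg (xsg [(q, y)] A + xsg [(p, x)] A) (G A ((p, x) # (q, y) # B)) =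
          sg (p * q + 1) (sg (xsg [(p, x)] A + xsg [(q, y)] A) (G A ((q, y) # (p, x) # B)))"
        using graded_alt_swap[OF graded_alt2_right[OF Nil(5)], of A "[]" B x p y q] Nil(3,4)
        by (simp add: add_ac)
    qed
    \<comment> \<open>Heads in different blocks: each such value of \<open>G\<close> occurs in both
      expansions, but only in one of them does the entry sent to \<open>B\<close> pass the other
      head. That passage costs the exponent \<open>p * q + 1\<close>.\<close>
    moreover have "split_sum ws (\<lambda>A B. sg (xsg [(q, y)] A) (G ((p, x) # A) ((q, y) # B))) =
        split_sum ws (\<lambda>A B. sg (p * q + 1) (sg (xsg [(q, y)] ((p, x) # A)) (G ((p, x) # A) ((q, y) # B))))"
      "split_sum ws (\<lambda>A B. sg (p * q + 1) (sg (xsg [(p, x)] A) (G ((q, y) # A) ((p, x) # B)))) =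
        split_sum ws (\<lambda>A B. sg (xsg [(p, x)] ((q, y) # A)) (G ((q, y) # A) ((p, x) # B)))"
      by (intro split_sum_cong; simp add: xsg_def bit_ring)+
    ultimately show ?case
      by (simp add: sg_add add_ac flip: split_sum_sg)
  next
    case (Cons u us)
    have "sg (xsg [u] A) (sg (p * q + 1) w) = sg (p * q + 1) (sg (xsg [u] A) w)" for A and w :: 'w
      by (simp add: add_ac)
    then show ?case using Cons by (cases u) (simp add: Cons12 sg_add)
  qed
qed


section \<open>Extension from homogeneous arguments\<close>

context super_module
begin

abbreviation "Coch \<equiv> hom_ext_alg s V s"

lemma zero_part [simp]: "0 \<in> V p"
  by (rule subspace_0[OF subspace_part])

lemma hproj_eqI:
  assumes "x \<in> V p" "v - x \<in> V (p + 1)"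
  shows "hproj V p v = x"
  unfolding hproj_def
proof (rule the_equality)
  show "x \<in> V p \<and> v - x \<in> V (p + 1)" using assms by simp
  fix z assume z: "z \<in> V p \<and> v - z \<in> V (p + 1)"
  have "z - x \<in> V p" using z assms subspace_diff[OF subspace_part] by blast
  moreover have "(v - x) - (v - z) \<in> V (p + 1)"
    using z assms subspace_diff[OF subspace_part] by blast
  ultimately have "z - x \<in> V 0 \<inter> V 1" by (cases p) auto
  then show "z = x" using parts_disjoint by simp
qed

lemma hproj_in_both: "hproj V p v \<in> V p \<and> v - hproj V p v \<in> V (p + 1)"
proof -
  obtain x y where xy: "x \<in> V 0" "y \<in> V 1" "v = x + y" using parts_span by blast
  have "hproj V 0 v = x" "hproj V 1 v = y" by (rule hproj_eqI; use xy in simp)+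
  then show ?thesis using xy by (cases p) auto
qed

lemma hproj_in [simp]: "hproj V p v \<in> V p"
  and hproj_compl: "v - hproj V p v \<in> V (p + 1)"
  using hproj_in_both by auto

lemma hproj_homog [simp]: "v \<in> V p \<Longrightarrow> hproj V p v = v"
  by (rule hproj_eqI) auto

lemma hproj_other:
  assumes "v \<in> V q" "q \<noteq> p" shows "hproj V p v = 0"
proof -
  have "p + 1 = q" using assms(2) by (cases p; cases q) auto
  then show ?thesis using assms(1) by (intro hproj_eqI) auto
qed

lemma hproj_add: "hproj V p (x + y) = hproj V p x + hproj V p y"
proof (rule hproj_eqI)
  show "hproj V p x + hproj V p y \<in> V p"
    by (intro subspace_add[OF subspace_part] hproj_in)
  have "x + y - (hproj V p x + hproj V p y) = (x - hproj V p x) + (y - hproj V p y)" by simp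
  also have "\<dots> \<in> V (p + 1)" by (intro subspace_add[OF subspace_part] hproj_compl)
  finally show "x + y - (hproj V p x + hproj V p y) \<in> V (p + 1)" .
qed

lemma hproj_scale: "hproj V p (s c x) = s c (hproj V p x)"
proof (rule hproj_eqI)
  show "s c (hproj V p x) \<in> V p"
    by (intro subspace_scale[OF subspace_part] hproj_in)
  have "s c x - s c (hproj V p x) = s c (x - hproj V p x)" by (simp add: scale_right_diff_distrib)
  also have "\<dots> \<in> V (p + 1)" by (intro subspace_scale[OF subspace_part] hproj_compl)
  finally show "s c x - s c (hproj V p x) \<in> V (p + 1)" .
qed

lemma hproj_zero [simp]: "hproj V p 0 = 0"
  by (rule hproj_homog) simp

lemma hproj_sum: "hproj V 0 v + hproj V 1 v = v"
proof -
  have "hproj V 1 v = v - hproj V 0 v"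
    using hproj_in_both[of 0 v] by (intro hproj_eqI) auto
  then show ?thesis by simp
qed

end

text \<open>\<open>homog_extend\<close> as a recursion on the list, for functions of tagged lists:
  the arguments are split in turn, so that identities follow by induction and not by rearranging
  sums over parity lists.\<close>

primrec hext ::
  "(bit \<Rightarrow> 'v::ab_group_add set) \<Rightarrow> ('v tagged_list \<Rightarrow> 'w::comm_monoid_add) \<Rightarrow> 'v list \<Rightarrow> 'w" where
  "hext V T [] = T []"
| "hext V T (x # xs) = hext V (\<lambda>A. T ((0, hproj V 0 x) # A)) xs + hext V (\<lambda>A. T ((1, hproj V 1 x) # A)) xs"

lemma homog_extend_eq_hext: "homog_extend V F xs = hext V (\<lambda>zs. F (map fst zs) (map snd zs)) xs"
proof (induction xs arbitrary: F)
  case (Cons x xs)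
  have fin: "finite {es :: bit list. length es = n}" for n
    using finite_lists_length_eq[of "UNIV :: bit set" n] by simp
  have "{es :: bit list. length es = Suc n} = (#) 0 ` {es. length es = n} \<union> (#) 1 ` {es. length es = n}" for n
  proof (intro equalityI subsetI)
    fix es :: "bit list" assume "es \<in> {es. length es = Suc n}"
    then obtain e es' where "es = e # es'" "length es' = n" by (cases es) auto
    then show "es \<in> (#) 0 ` {es. length es = n} \<union> (#) 1 ` {es. length es = n}" by (cases e) auto
  qed auto
  then have "homog_extend V F (x # xs) =
      (\<Sum>es\<in>(#) 0 ` {es. length es = length xs} \<union> (#) 1 ` {es. length es = length xs}.
        F es (map2 (hproj V) es (x # xs)))"
    by (simp add: homog_extend_def)
  also have "\<dots> = homog_extend V (\<lambda>es ys. F (0 # es) (hproj V 0 x # ys)) xs +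
      homog_extend V (\<lambda>es ys. F (1 # es) (hproj V 1 x # ys)) xs"
    unfolding homog_extend_def
    by (subst sum.union_disjoint) (auto simp: fin sum.reindex inj_on_def)
  finally show ?case by (simp add: Cons)
qed (simp add: homog_extend_def)

lemma hext_add: "hext V (\<lambda>zs. T zs + U zs) xs = hext V T xs + hext V U xs"
  by (induction xs arbitrary: T U) (simp_all add: add_ac)

lemma hext_0 [simp]: "hext V (\<lambda>zs. 0) xs = 0"
  by (induction xs) simp_all

lemma hext_hom:
  assumes "\<And>x y. f (x + y) = f x + f y"
  shows "f (hext V T xs) = hext V (\<lambda>zs. f (T zs)) xs"
  by (induction xs arbitrary: T) (simp_all add: assms)

context super_module
begin

lemma hext_cong:
  assumes "\<And>zs. tagged V zs \<Longrightarrow> length zs = length xs \<Longrightarrow> T zs = U zs"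
  shows "hext V T xs = hext V U xs"
  using assms
proof (induction xs arbitrary: T U)
  case (Cons x xs)
  have "hext V (\<lambda>A. T ((e, hproj V e x) # A)) xs = hext V (\<lambda>A. U ((e, hproj V e x) # A)) xs" for e
    by (intro Cons) auto
  then show ?case by simp
qed simp

end

locale graded_maps = super_module s V + W: module t
  for s :: "'k::comm_ring_1 \<Rightarrow> 'v::ab_group_add \<Rightarrow> 'v" and V
    and t :: "'k \<Rightarrow> 'w::ab_group_add \<Rightarrow> 'w"
begin

abbreviation "galt \<equiv> graded_alt s V t"
abbreviation "Hom \<equiv> hom_ext_alg s V t"

lemma
  assumes "galt T" "tagged V ws"
  shows galt_add_Cons: "x \<in> V e \<Longrightarrow> y \<in> V e \<Longrightarrow> T ((e, x + y) # ws) = T ((e, x) # ws) + T ((e, y) # ws)"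
    and galt_scale_Cons: "x \<in> V e \<Longrightarrow> T ((e, s c x) # ws) = t c (T ((e, x) # ws))"
    and galt_swap_Cons: "x \<in> V p \<Longrightarrow> y \<in> V q \<Longrightarrow>
      T ((p, x) # (q, y) # ws) = sg (p * q + 1) (T ((q, y) # (p, x) # ws))"
  using graded_alt_add[OF assms(1), of "[]" ws x e y] graded_alt_scale[OF assms(1), of "[]" ws x e c]
    graded_alt_swap[OF assms(1), of "[]" ws x p y q] assms(2) by simp_all

lemma hext_Cons_homog:
  assumes "galt T" "x \<in> V p"
  shows "hext V T (x # xs) = hext V (\<lambda>A. T ((p, x) # A)) xs"
proof -
  have "hext V (\<lambda>A. T ((p + 1, hproj V (p + 1) x) # A)) xs = hext V (\<lambda>A. 0) xs"
  proof (rule hext_cong)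
    fix zs assume "tagged V zs"
    then show "T ((p + 1, hproj V (p + 1) x) # zs) = 0"
      using graded_alt_zero_arg[OF assms(1), of "[]" zs "p + 1"] hproj_other[OF assms(2), of "p + 1"]
      by (cases p) simp_all
  qed
  then show ?thesis using assms(2) by (cases p) simp_all
qed

text \<open>Only the branch with the given parities survives. In every other branch some argument is
  projected to 0, and the additivity of \<open>T\<close> annihilates it.\<close>

lemma hext_tagged:
  assumes "galt T" "tagged V zs"
  shows "hext V T (map snd zs) = T zs"
  using assms
proof (induction zs arbitrary: T)
  case (Cons z zs)
  then show ?case
    by (cases z) (simp add: hext_Cons_homog[of T _ "fst z"] graded_alt_Cons del: hext.simps(2))
qed simp

lemma hext_add_arg:
  assumes "galt T"
  shows "hext V T (us @ (x + y) # ws) = hext V T (us @ x # ws) + hext V T (us @ y # ws)"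
  using assms
proof (induction us arbitrary: T)
  case Nil
  have "hext V (\<lambda>A. T ((e, hproj V e (x + y)) # A)) ws =
      hext V (\<lambda>A. T ((e, hproj V e x) # A)) ws + hext V (\<lambda>A. T ((e, hproj V e y) # A)) ws" for e
    unfolding hext_add[symmetric] hproj_add
    by (rule hext_cong) (simp add: galt_add_Cons[OF Nil])
  then show ?case by (simp add: add_ac)
next
  case (Cons u us)
  then show ?case by (simp add: graded_alt_Cons add_ac)
qed

lemma hext_scale_arg:
  assumes "galt T"
  shows "hext V T (us @ s c x # ws) = t c (hext V T (us @ x # ws))"
  using assms
proof (induction us arbitrary: T)
  case Nil
  have "hext V (\<lambda>A. T ((e, hproj V e (s c x)) # A)) ws = t c (hext V (\<lambda>A. T ((e, hproj V e x) # A)) ws)" for e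
    unfolding hproj_scale hext_hom[of "t c", OF W.scale_right_distrib]
    by (rule hext_cong) (simp add: galt_scale_Cons[OF Nil])
  then show ?case by (simp add: W.scale_right_distrib)
next
  case (Cons u us)
  then show ?case by (simp add: graded_alt_Cons W.scale_right_distrib)
qed

lemma hext_swap:
  assumes "galt T" "x \<in> V p" "y \<in> V q"
  shows "hext V T (us @ x # y # ws) = sg (p * q + 1) (hext V T (us @ y # x # ws))"
  using assms(1)
proof (induction us arbitrary: T)
  case Nil
  have "hext V (\<lambda>A. T ((p, x) # (q, y) # A)) ws = sg (p * q + 1) (hext V (\<lambda>A. T ((q, y) # (p, x) # A)) ws)"
    unfolding hext_hom[of "sg (p * q + 1)", OF sg_add]
    by (rule hext_cong) (rule galt_swap_Cons[OF Nil _ assms(2,3)])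
  then show ?case
    using Nil assms
    by (simp add: hext_Cons_homog[where p = p] hext_Cons_homog[where p = q] graded_alt_Cons del: hext.simps(2))
next
  case (Cons u us)
  then show ?case by (simp add: graded_alt_Cons sg_add)
qed

definition "multilin f \<longleftrightarrow> (\<forall>us ws. module_hom s t (\<lambda>x. f (us @ x # ws)))"

lemma multilin_iff: "multilin f \<longleftrightarrow>
     (\<forall>us ws x y. f (us @ (x + y) # ws) = f (us @ x # ws) + f (us @ y # ws)) \<and>
    (\<forall>us ws c x. f (us @ s c x # ws) = t c (f (us @ x # ws)))"
  using module_axioms W.module_axioms by (auto simp: multilin_def module_hom_iff)

text \<open>Every argument is the sum of its projections, so additivity in each slot reproduces the
  recursion of \<open>hext\<close>. Hence multilinear maps are determined by their values on
  homogeneous arguments.\<close>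

lemma multilin_eq_hext:
  assumes "multilin f"
  shows "f xs = hext V (\<lambda>zs. f (map snd zs)) xs"
  using assms
proof (induction xs arbitrary: f)
  case (Cons x xs)
  have ml: "multilin (\<lambda>A. f (y # A))" for y
    using Cons.prems unfolding multilin_iff by (metis append_Cons)
  have "f (x # xs) = f (hproj V 0 x # xs) + f (hproj V 1 x # xs)"
    using Cons.prems[unfolded multilin_iff, THEN conjunct1, rule_format, of "[]" "hproj V 0 x" "hproj V 1 x" xs]
    by (simp add: hproj_sum)
  also have "\<dots> = hext V (\<lambda>zs. f (map snd zs)) (x # xs)"
    using Cons.IH[OF ml] by simp
  finally show ?case .
qed simp

lemma hom_ext_alg_iff: "\<phi> \<in> Hom \<longleftrightarrow> \<phi> [] = 0 \<and> multilin \<phi> \<and>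
    (\<forall>us ws p q. \<forall>x\<in>V p. \<forall>y\<in>V q. \<phi> (us @ x # y # ws) = sg (p * q + 1) (\<phi> (us @ y # x # ws)))"
proof -
  have "a + sg e b = 0 \<longleftrightarrow> a = sg (e + 1) b" for a b :: 'w and e
    by (cases e) (simp_all add: eq_neg_iff_add_eq_0)
  then show ?thesis unfolding hom_ext_alg_def multilin_def W.scale_psgn by simp
qed

lemma hom_ext_alg_nil [simp]: "\<phi> \<in> Hom \<Longrightarrow> \<phi> [] = 0"
  unfolding hom_ext_alg_iff by blast

lemma
  assumes "\<phi> \<in> Hom"
  shows hom_ext_alg_add: "\<phi> (us @ (x + y) # ws) = \<phi> (us @ x # ws) + \<phi> (us @ y # ws)"
    and hom_ext_alg_scale: "\<phi> (us @ s c x # ws) = t c (\<phi> (us @ x # ws))"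
    and hom_ext_alg_swap: "x \<in> V p \<Longrightarrow> y \<in> V q \<Longrightarrow> \<phi> (us @ x # y # ws) = sg (p * q + 1) (\<phi> (us @ y # x # ws))"
    and hom_ext_alg_multilin: "multilin \<phi>"
  using assms unfolding hom_ext_alg_iff multilin_iff by blast+

lemma hom_ext_alg_zero_arg: "\<phi> \<in> Hom \<Longrightarrow> \<phi> (us @ 0 # ws) = 0"
  using hom_ext_alg_add[of \<phi> us 0 0 ws] by simp

lemma hom_ext_alg_sg: "\<phi> \<in> Hom \<Longrightarrow> \<phi> (us @ sg e x # ws) = sg e (\<phi> (us @ x # ws))"
  using hom_ext_alg_scale[of \<phi> us "psgn e" x ws] by (simp add: scale_psgn W.scale_psgn)

text \<open>Together with \<open>galt_hom_ext_alg\<close> this is the dictionary between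
  homomorphisms on the exterior algebra and alternating maps on tagged lists: \<open>hext\<close> in
  one direction, composition with \<open>map snd\<close> in the other.\<close>

lemma hext_in_hom_ext_alg:
  assumes "galt T" "T [] = 0"
  shows "hext V T \<in> Hom"
  unfolding hom_ext_alg_iff multilin_iff
  by (intro conjI allI ballI hext_swap hext_add_arg hext_scale_arg assms(1)) (simp_all add: assms(2))

lemma galt_hom_ext_alg:
  assumes "\<phi> \<in> Hom"
  shows "galt (\<lambda>zs. \<phi> (map snd zs))"
proof (rule graded_altI, goal_cases)
  case (3 us ws p q x y)
  then show ?case using hom_ext_alg_swap[OF assms 3(3,4), of "map snd us" "map snd ws"] by simp
qed (simp_all add: hom_ext_alg_add[OF assms] hom_ext_alg_scale[OF assms])

lemma hom_ext_alg_eqI: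
  assumes "\<phi> \<in> Hom" "\<psi> \<in> Hom"
    and "\<And>zs. tagged V zs \<Longrightarrow> \<phi> (map snd zs) = \<psi> (map snd zs)"
  shows "\<phi> = \<psi>"
proof
  fix xs
  show "\<phi> xs = \<psi> xs"
    unfolding multilin_eq_hext[OF hom_ext_alg_multilin[OF assms(1)], of xs]
      multilin_eq_hext[OF hom_ext_alg_multilin[OF assms(2)], of xs]
    by (intro hext_cong assms(3))
qed

lemma hom_ext_algI:
  assumes "multilin \<phi>" "\<phi> [] = 0" "galt T" "\<And>zs. tagged V zs \<Longrightarrow> \<phi> (map snd zs) = T zs"
  shows "\<phi> \<in> Hom"
proof -
  have "\<phi> = hext V T"
  proof
    fix xs show "\<phi> xs = hext V T xs"
      unfolding multilin_eq_hext[OF assms(1), of xs] by (intro hext_cong assms(4))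
  qed
  moreover have "T [] = 0" using assms(2) assms(4)[of "[]"] by simp
  ultimately show ?thesis using hext_in_hom_ext_alg[OF assms(3)] by simp
qed

lemma module_pointwise: "module (pointwise_scale t :: 'k \<Rightarrow> ('a \<Rightarrow> 'w) \<Rightarrow> 'a \<Rightarrow> 'w)"
  by unfold_locales
    (auto simp: pointwise_scale_def fun_eq_iff W.scale_right_distrib W.scale_left_distrib)

lemma subspace_hom_ext_alg: "module.subspace (pointwise_scale t) (Hom)"
  unfolding module.subspace_def[OF module_pointwise]
proof (intro conjI ballI allI)
  show "0 \<in> Hom" unfolding hom_ext_alg_iff multilin_iff by simp
  fix \<phi> \<psi> assume h: "\<phi> \<in> Hom" "\<psi> \<in> Hom"
  show "\<phi> + \<psi> \<in> Hom"
    unfolding hom_ext_alg_iff multilin_iff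
  proof (intro conjI allI ballI)
    fix us ws p q x y assume "x \<in> V p" "y \<in> V q"
    then show "(\<phi> + \<psi>) (us @ x # y # ws) = sg (p * q + 1) ((\<phi> + \<psi>) (us @ y # x # ws))"
      using hom_ext_alg_swap[OF h(1), of x p y q us ws] hom_ext_alg_swap[OF h(2), of x p y q us ws]
      by (simp add: sg_add)
  qed (simp_all add: h hom_ext_alg_add hom_ext_alg_scale W.scale_right_distrib add_ac)
next
  fix c \<phi> assume h: "\<phi> \<in> Hom"
  show "pointwise_scale t c \<phi> \<in> Hom"
    unfolding hom_ext_alg_iff multilin_iff pointwise_scale_def
  proof (intro conjI allI ballI)
    fix us ws p q x y assume "x \<in> V p" "y \<in> V q"
    then show "t c (\<phi> (us @ x # y # ws)) = sg (p * q + 1) (t c (\<phi> (us @ y # x # ws)))"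
      using hom_ext_alg_swap[OF h, of x p y q us ws] by (simp add: W.scale_sg)
  qed (simp_all add: h hom_ext_alg_add hom_ext_alg_scale W.scale_right_distrib mult.commute)
qed

lemmas Hom_0 = module.subspace_0[OF module_pointwise subspace_hom_ext_alg]
lemmas Hom_add = module.subspace_add[OF module_pointwise subspace_hom_ext_alg]
lemmas Hom_scale = module.subspace_scale[OF module_pointwise subspace_hom_ext_alg]
lemmas Hom_diff = module.subspace_diff[OF module_pointwise subspace_hom_ext_alg]

text \<open>Each defining identity relates values on lists of a single length, so it can be tested
  on every arity separately.\<close>

lemma hom_ext_alg_iff_arity_parts:
  "\<phi> \<in> Hom \<longleftrightarrow> (\<forall>n. arity_part n \<phi> \<in> Hom)"
proof
  show "\<forall>n. arity_part n \<phi> \<in> Hom" if "\<phi> \<in> Hom"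
  proof
    fix n
    show "arity_part n \<phi> \<in> Hom"
      unfolding hom_ext_alg_iff multilin_iff
    proof (intro conjI allI ballI)
      fix us ws p q x y assume "x \<in> V p" "y \<in> V q"
      then show "arity_part n \<phi> (us @ x # y # ws) = sg (p * q + 1) (arity_part n \<phi> (us @ y # x # ws))"
        using hom_ext_alg_swap[OF that, of x p y q us ws] by (simp add: arity_part_def)
    qed (simp_all add: that arity_part_def hom_ext_alg_add hom_ext_alg_scale)
  qed
next
  assume *: "\<forall>n. arity_part n \<phi> \<in> Hom"
  show "\<phi> \<in> Hom"
    unfolding hom_ext_alg_iff multilin_iff
  proof (intro conjI allI ballI)
    show "\<phi> [] = 0" using hom_ext_alg_nil[of "arity_part 0 \<phi>"] * by (simp add: arity_part_def)
    fix us ws :: "'v list"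
    let ?n = "Suc (length us + length ws)"
    have h: "arity_part ?n \<phi> \<in> Hom" using * by blast
    show "\<phi> (us @ (x + y) # ws) = \<phi> (us @ x # ws) + \<phi> (us @ y # ws)" for x y
      using hom_ext_alg_add[OF h, of us x y ws] by (simp add: arity_part_def)
    show "\<phi> (us @ s c x # ws) = t c (\<phi> (us @ x # ws))" for c x
      using hom_ext_alg_scale[OF h, of us c x ws] by (simp add: arity_part_def)
    fix p q x y assume "x \<in> V p" "y \<in> V q"
    then show "\<phi> (us @ x # y # ws) = sg (p * q + 1) (\<phi> (us @ y # x # ws))"
      using hom_ext_alg_swap[of "arity_part (Suc ?n) \<phi>" x p y q us ws] * by (simp add: arity_part_def)
  qed
qed

end


section \<open>Insertion of one map into another\<close>

sublocale super_module \<subseteq> C: graded_maps s V s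
  by unfold_locales

text \<open>Coassociativity joins the first two of three blocks into one, and
  \<open>split_sum_comm\<close> exchanges the two halves of its splitting.\<close>

lemma split_sum_swap12:
  "split_sum zs (\<lambda>A R. split_sum R (\<lambda>P Q. G A P Q)) =
    split_sum zs (\<lambda>A R. split_sum R (\<lambda>P Q. sg (xsg A P) (G P A Q)))"
  unfolding split_sum_assoc[symmetric] by (rule arg_cong[where f = "split_sum zs"], intro ext, rule split_sum_comm)

lemma split_sum_arity:
  assumes "finite J"
  shows "(\<Sum>j\<in>J. split_sum zs (\<lambda>A B. if length A = j then G j A B else 0)) =
    split_sum zs (\<lambda>A B. if length A \<in> J then G (length A) A B else 0)"
  unfolding split_sum_sum[symmetric] using assms by (simp add: sum.delta)

lemma sum_arity_pairs: "(\<Sum>(k, j)\<in>arity_pairs m. f k j) = (\<Sum>j\<in>{1..<m}. f (m - j) j)"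
proof -
  have "arity_pairs m = (\<lambda>j. (m - j, j)) ` {1..<m}"
    by (auto simp: arity_pairs_def image_iff)
  moreover have "inj_on (\<lambda>j. (m - j, j)) {1..<m}" by (auto simp: inj_on_def)
  ultimately show ?thesis by (simp add: sum.reindex)
qed

text \<open>The weight \<open>w\<close> sees only the lengths of the two blocks. Weight 0 gives the
  composition, the product of the lengths the L_infinity relation, and \<open>diff_sign\<close> the
  differential, so iterated insertions are expanded only once for all of them.\<close>

definition ins_tagged ::
  "(nat \<Rightarrow> nat \<Rightarrow> bit) \<Rightarrow> ('v list \<Rightarrow> 'w::ab_group_add) \<Rightarrow> ('v list \<Rightarrow> 'v) \<Rightarrow> 'v tagged_list \<Rightarrow> 'w" where
  "ins_tagged w \<phi> \<psi> zs = split_sum zs (\<lambda>A B.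
     sg (w (length A) (length B)) (\<phi> (\<psi> (map snd A) # map snd B)))"

definition ins ::
  "(bit \<Rightarrow> 'v::ab_group_add set) \<Rightarrow> (nat \<Rightarrow> nat \<Rightarrow> bit) \<Rightarrow> ('v list \<Rightarrow> 'w::ab_group_add) \<Rightarrow>
    ('v list \<Rightarrow> 'v) \<Rightarrow> 'v list \<Rightarrow> 'w" where
  "ins V w \<phi> \<psi> = hext V (ins_tagged w \<phi> \<psi>)"

lemma (in module) insertion_eq_split_sum:
  assumes "length zs = j + m"
  shows "insertion scale (map fst zs) j m \<phi> \<psi> (map snd zs) =
    split_sum zs (\<lambda>A B. if length A = j then \<phi> (\<psi> (map snd A) # map snd B) else 0)"
proof -
  have "insertion scale (map fst zs) j m \<phi> \<psi> (map snd zs) =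
    (\<Sum>\<sigma>\<in>unshuffles j m. scale (of_int (sign \<sigma>) * koszul (map fst zs) \<sigma>)
      ((\<lambda>A B. \<phi> (\<psi> (map snd A) # map snd B)) (take j (permute_list \<sigma> zs)) (drop j (permute_list \<sigma> zs))))"
    unfolding insertion_def
  proof (rule sum.cong[OF refl])
    fix \<sigma> assume "\<sigma> \<in> unshuffles j m"
    then have "\<sigma> permutes {..<length zs}" using assms by (simp add: unshuffles_def)
    then show "scale (of_int (sign \<sigma>) * koszul (map fst zs) \<sigma>)
         (\<phi> (\<psi> (take j (permute_list \<sigma> (map snd zs))) # drop j (permute_list \<sigma> (map snd zs)))) =
        scale (of_int (sign \<sigma>) * koszul (map fst zs) \<sigma>)
      ((\<lambda>A B. \<phi> (\<psi> (map snd A) # map snd B)) (take j (permute_list \<sigma> zs)) (drop j (permute_list \<sigma> zs)))"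
      by (simp add: permute_list_map take_map drop_map)
  qed
  also have "\<dots> = split_sum zs (\<lambda>A B. if length A = j then \<phi> (\<psi> (map snd A) # map snd B) else 0)"
    by (rule sum_unshuffles_eq_split_sum[OF module_axioms assms])
  finally show ?thesis .
qed

definition has_arity :: "nat \<Rightarrow> ('v list \<Rightarrow> 'w::zero) \<Rightarrow> bool" where
  "has_arity k \<phi> \<longleftrightarrow> (\<forall>xs. length xs \<noteq> k \<longrightarrow> \<phi> xs = 0)"

lemma has_arityD: "has_arity k \<phi> \<Longrightarrow> length xs \<noteq> k \<Longrightarrow> \<phi> xs = 0"
  by (simp add: has_arity_def)

text \<open>The parity of a cochain may depend on its arity, as for an \<open>L\<^sub>\<infinity>\<close> structure.\<close>

definition parities :: "(bit \<Rightarrow> 'v set) \<Rightarrow> (nat \<Rightarrow> bit) \<Rightarrow> ('v list \<Rightarrow> 'v) \<Rightarrow> bool" where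
  "parities V c \<chi> \<longleftrightarrow> (\<forall>zs. tagged V zs \<longrightarrow> \<chi> (map snd zs) \<in> V (c (length zs) + par zs))"

definition circle ::
  "(bit \<Rightarrow> 'v::ab_group_add set) \<Rightarrow> ('v list \<Rightarrow> 'w::ab_group_add) \<Rightarrow> ('v list \<Rightarrow> 'v) \<Rightarrow> 'v list \<Rightarrow> 'w" where
  "circle V = ins V (\<lambda>_ _. 0)"

context graded_maps
begin

context
  fixes \<phi> :: "'v list \<Rightarrow> 'w" and \<psi> :: "'v list \<Rightarrow> 'v"
  assumes \<phi>: "\<phi> \<in> Hom" and \<psi>: "\<psi> \<in> Coch"
begin

lemma galt_ins_tagged: "galt (ins_tagged w \<phi> \<psi>)"
  unfolding ins_tagged_def
proof (rule graded_alt_split_sum[OF W.module_axioms], unfold graded_alt2_def, intro allI impI conjI)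
  fix R assume R: "tagged V R"
  have "galt (\<lambda>A. \<phi> (\<psi> (map snd A) # map snd R))"
  proof (rule graded_altI, goal_cases)
    case (1 us ws e x y)
    then show ?case
      using hom_ext_alg_add[OF \<phi>, of "[]"] by (simp add: C.hom_ext_alg_add[OF \<psi>])
  next
    case (2 us ws e c x)
    then show ?case
      using hom_ext_alg_scale[OF \<phi>, of "[]"] by (simp add: C.hom_ext_alg_scale[OF \<psi>])
  next
    case (3 us ws p q x y)
    then show ?case
      using hom_ext_alg_sg[OF \<phi>, of "[]"] C.hom_ext_alg_swap[OF \<psi> 3(3,4), of "map snd us" "map snd ws"]
      by simp
  qed
  from graded_alt_sg[OF W.module_axioms this, of "\<lambda>n p. w n (length R)"]
  show "galt (\<lambda>A. sg (w (length A) (length R)) (\<phi> (\<psi> (map snd A) # map snd R)))" by simp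
  have "galt (\<lambda>B. \<phi> (v # map snd B))" for v
  proof (rule graded_altI, goal_cases)
    case (1 us ws e x y)
    then show ?case using hom_ext_alg_add[OF \<phi>, of "v # map snd us"] by simp
  next
    case (2 us ws e c x)
    then show ?case using hom_ext_alg_scale[OF \<phi>, of "v # map snd us"] by simp
  next
    case (3 us ws p q x y)
    then show ?case using hom_ext_alg_swap[OF \<phi> 3(3,4), of "v # map snd us" "map snd ws"] by simp
  qed
  from graded_alt_sg[OF W.module_axioms this, of "\<lambda>n p. w (length R) n"]
  show "galt (\<lambda>B. sg (w (length R) (length B)) (\<phi> (\<psi> (map snd R) # map snd B)))" by simp
qed

lemma ins_in: "ins V w \<phi> \<psi> \<in> Hom"
  unfolding ins_def
  by (rule hext_in_hom_ext_alg[OF galt_ins_tagged])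
    (use hom_ext_alg_zero_arg[OF \<phi>, of "[]"] \<psi> in \<open>simp add: ins_tagged_def\<close>)

lemma ins_eq: "tagged V zs \<Longrightarrow> ins V w \<phi> \<psi> (map snd zs) = ins_tagged w \<phi> \<psi> zs"
  unfolding ins_def by (rule hext_tagged[OF galt_ins_tagged])

end

lemma circle_in:
  "\<phi> \<in> Hom \<Longrightarrow> \<psi> \<in> Coch \<Longrightarrow> circle V \<phi> \<psi> \<in> Hom"
  unfolding circle_def by (rule ins_in)

lemma circle_eq:
  "\<phi> \<in> Hom \<Longrightarrow> \<psi> \<in> Coch \<Longrightarrow> tagged V zs \<Longrightarrow>
    circle V \<phi> \<psi> (map snd zs) = ins_tagged (\<lambda>_ _. 0) \<phi> \<psi> zs"
  unfolding circle_def by (rule ins_eq)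

end

context graded_maps
begin

context
  fixes \<phi> :: "'v list \<Rightarrow> 'w" and \<psi> :: "'v list \<Rightarrow> 'v"
  assumes \<phi>: "\<phi> \<in> Hom" and \<psi>: "\<psi> \<in> Coch"
begin

text \<open>The block passed to the inner insertion is split again. Additivity of
  \<open>\<phi>\<close> in its first slot pulls the inner sum and its sign out, and coassociativity
  regroups the three blocks.\<close>

lemma ins_tagged_ins_right:
  assumes "\<chi> \<in> Coch" "tagged V zs"
  shows "ins_tagged w \<phi> (ins V w' \<psi> \<chi>) zs = split_sum zs (\<lambda>A R. split_sum R (\<lambda>P Q.
    sg (w (length A + length P) (length Q) + w' (length A) (length P))
      (\<phi> (\<psi> (\<chi> (map snd A) # map snd P) # map snd Q))))"
proof -
  have "ins_tagged w \<phi> (ins V w' \<psi> \<chi>) zs = split_sum zs (\<lambda>Z Q. split_sum Z (\<lambda>A P.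
    sg (w (length A + length P) (length Q) + w' (length A) (length P))
      (\<phi> (\<psi> (\<chi> (map snd A) # map snd P) # map snd Q))))"
    unfolding ins_tagged_def
  proof (rule split_sum_cong_tagged[OF assms(2)])
    fix Z Q :: "'v tagged_list" assume Z: "tagged V Z"
    have "sg (w (length Z) (length Q)) (\<phi> (ins V w' \<psi> \<chi> (map snd Z) # map snd Q)) =
      split_sum Z (\<lambda>A P. sg (w (length Z) (length Q))
        (\<phi> (sg (w' (length A) (length P)) (\<psi> (\<chi> (map snd A) # map snd P)) # map snd Q)))"
      unfolding C.ins_eq[OF \<psi> assms(1) Z] ins_tagged_def
      using hom_ext_alg_add[OF \<phi>, of "[]"]
      by (intro split_sum_hom[where f = "\<lambda>v. sg (w (length Z) (length Q)) (\<phi> (v # map snd Q))"])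
        (simp add: sg_add)
    also have "\<dots> = split_sum Z (\<lambda>A P. sg (w (length A + length P) (length Q) + w' (length A) (length P))
        (\<phi> (\<psi> (\<chi> (map snd A) # map snd P) # map snd Q)))"
      using hom_ext_alg_sg[OF \<phi>, of "[]"] by (intro split_sum_cong) simp
    finally show "sg (w (length Z) (length Q)) (\<phi> (ins V w' \<psi> \<chi> (map snd Z) # map snd Q)) = \<dots>" .
  qed
  then show ?thesis unfolding split_sum_assoc .
qed

text \<open>The value of \<open>\<chi>\<close> becomes the first argument of the inner insertion,
  and the recursion of \<open>split_sum\<close> decides where it goes: into \<open>\<psi>\<close>,
  which gives the nested term, or beside \<open>\<psi>\<close>, which gives the disjoint term with
  the sign of passing \<open>P\<close>.\<close>

lemma ins_tagged_ins_left:
  assumes "\<chi> \<in> Coch" "parities V c \<chi>" "tagged V zs"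
  shows "ins_tagged w (ins V w' \<phi> \<psi>) \<chi> zs =
    split_sum zs (\<lambda>A R. split_sum R (\<lambda>P Q.
      sg (w (length A) (length P + length Q) + w' (Suc (length P)) (length Q))
        (\<phi> (\<psi> (\<chi> (map snd A) # map snd P) # map snd Q)))) +
    split_sum zs (\<lambda>A R. split_sum R (\<lambda>P Q.
      sg (w (length A) (length P + length Q) + w' (length P) (Suc (length Q))
          + (lb P + (c (length A) + par A) * par P))
        (\<phi> (\<psi> (map snd P) # \<chi> (map snd A) # map snd Q))))"
    (is "_ = split_sum zs (\<lambda>A R. split_sum R (?F1 A)) + split_sum zs (\<lambda>A R. split_sum R (?F2 A))")
proof -
  have "ins_tagged w (ins V w' \<phi> \<psi>) \<chi> zs =
    split_sum zs (\<lambda>A R. split_sum R (?F1 A) + split_sum R (?F2 A))"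
    unfolding ins_tagged_def[of w]
  proof (rule split_sum_cong_tagged[OF assms(3)])
  fix A R :: "'v tagged_list" assume A: "tagged V A" and R: "tagged V R"
  \<comment> \<open>The value of \<open>\<chi>\<close> as a single homogeneous entry. It counts for
    the length of the block that it joins, whence the \<open>Suc\<close> in one place or the
    other.\<close>
  define z where "z = (c (length A) + par A, \<chi> (map snd A))"
  have z: "tagged V (z # R)" using A R assms(2) by (simp add: z_def parities_def)
  have "\<chi> (map snd A) # map snd R = map snd (z # R)" by (simp add: z_def)
  then have "ins V w' \<phi> \<psi> (\<chi> (map snd A) # map snd R) = ins_tagged w' \<phi> \<psi> (z # R)"
    using ins_eq[OF \<phi> \<psi> z] by simp
  then have "sg (w (length A) (length R)) (ins V w' \<phi> \<psi> (\<chi> (map snd A) # map snd R)) =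
    split_sum R (\<lambda>P Q. sg (w (length A) (length R)) (sg (w' (Suc (length P)) (length Q))
        (\<phi> (\<psi> (\<chi> (map snd A) # map snd P) # map snd Q)))) +
    split_sum R (\<lambda>P Q. sg (w (length A) (length R)) (sg (xsg [z] P) (sg (w' (length P) (Suc (length Q)))
        (\<phi> (\<psi> (map snd P) # \<chi> (map snd A) # map snd Q)))))"
    unfolding split_sum_sg by (simp add: ins_tagged_def sg_add z_def)
  also have "\<dots> = split_sum R (?F1 A) +
    split_sum R (?F2 A)"
    by (intro arg_cong2[where f = "(+)"] split_sum_cong) (simp_all add: xsg_def z_def add_ac)
  finally show "sg (w (length A) (length R)) (ins V w' \<phi> \<psi> (\<chi> (map snd A) # map snd R)) = \<dots>" .
  qed
  then show ?thesis by (simp only: split_sum_add)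
qed

end

text \<open>What is left of an associator is compared with its mirror image by exchanging the two
  blocks with \<open>split_sum_swap12\<close> and then the first two arguments of
  \<open>\<phi>\<close>. The arities are fixed so that the resulting sign is the same for all
  splittings.\<close>

lemma pre_Lie:
  assumes \<phi>: "\<phi> \<in> Hom"
    and \<psi>: "\<psi> \<in> Coch" "parities V (\<lambda>_. b) \<psi>" "has_arity (Suc j) \<psi>"
    and \<chi>: "\<chi> \<in> Coch" "parities V (\<lambda>_. c) \<chi>" "has_arity (Suc i) \<chi>"
  shows "circle V (circle V \<phi> \<psi>) \<chi> xs - circle V \<phi> (circle V \<psi> \<chi>) xs =
    sg (b * c + of_nat j * of_nat i) (circle V (circle V \<phi> \<chi>) \<psi> xs - circle V \<phi> (circle V \<chi> \<psi>) xs)"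
proof -
  define S where "S \<psi> \<chi> c zs = split_sum zs (\<lambda>A R. split_sum R (\<lambda>P Q.
      sg (lb P + (c + par A) * par P) (\<phi> (\<psi> (map snd P) # \<chi> (map snd A) # map snd Q))))"
    for \<psi> \<chi> and c and zs :: "'v tagged_list"
  have assoc: "ins_tagged (\<lambda>_ _. 0) (circle V \<phi> \<psi>) \<chi> zs - ins_tagged (\<lambda>_ _. 0) \<phi> (circle V \<psi> \<chi>) zs = S \<psi> \<chi> c zs"
    if "\<psi> \<in> Coch" "\<chi> \<in> Coch" "parities V (\<lambda>_. c) \<chi>" "tagged V zs" for \<psi> \<chi> c zs
    using ins_tagged_ins_left[OF \<phi> that(1,2,3,4), of "\<lambda>_ _. 0" "\<lambda>_ _. 0"]
      ins_tagged_ins_right[OF \<phi> that(1,2,4), of "\<lambda>_ _. 0" "\<lambda>_ _. 0"]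
    by (simp add: circle_def S_def)
  have symm: "S \<psi> \<chi> c zs = sg (b * c + of_nat j * of_nat i) (S \<chi> \<psi> b zs)" if zs: "tagged V zs" for zs
  proof -
    have "S \<psi> \<chi> c zs = split_sum zs (\<lambda>A R. split_sum R (\<lambda>P Q. sg (xsg A P)
        (sg (lb A + (c + par P) * par A) (\<phi> (\<psi> (map snd A) # \<chi> (map snd P) # map snd Q)))))"
      unfolding S_def by (rule split_sum_swap12)
    also have "\<dots> = split_sum zs (\<lambda>A R. split_sum R (\<lambda>P Q. sg (b * c + of_nat j * of_nat i)
        (sg (lb P + (b + par A) * par P) (\<phi> (\<chi> (map snd P) # \<psi> (map snd A) # map snd Q)))))"
    proof (intro split_sum_cong_tagged[OF zs] split_sum_cong_tagged)
      fix A R P Q :: "'v tagged_list"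
      assume A: "tagged V A" and P: "tagged V P"
      show "sg (xsg A P) (sg (lb A + (c + par P) * par A) (\<phi> (\<psi> (map snd A) # \<chi> (map snd P) # map snd Q))) =
        sg (b * c + of_nat j * of_nat i)
          (sg (lb P + (b + par A) * par P) (\<phi> (\<chi> (map snd P) # \<psi> (map snd A) # map snd Q)))"
      \<comment> \<open>For other block lengths one of the two inserted values is 0, so the signs
        need to agree only for the lengths \<open>Suc j\<close> and \<open>Suc i\<close>.\<close>
      proof (cases "length A = Suc j \<and> length P = Suc i")
        case True
        have "\<phi> ([] @ \<psi> (map snd A) # \<chi> (map snd P) # map snd Q) =
            sg ((b + par A) * (c + par P) + 1) (\<phi> ([] @ \<chi> (map snd P) # \<psi> (map snd A) # map snd Q))"
          using A P \<psi>(2) \<chi>(2) by (intro hom_ext_alg_swap[OF \<phi>]) (auto simp: parities_def)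
        then show ?thesis using True by (simp add: xsg_def bit_ring)
      next
        case False
        then have "\<psi> (map snd A) = 0 \<or> \<chi> (map snd P) = 0"
          using has_arityD[OF \<psi>(3)] has_arityD[OF \<chi>(3)] by (metis length_map)
        moreover have "\<phi> (0 # v # vs) = 0" "\<phi> (v # 0 # vs) = 0" for v vs
          using hom_ext_alg_zero_arg[OF \<phi>, of "[]"] hom_ext_alg_zero_arg[OF \<phi>, of "[v]"] by simp_all
        ultimately show ?thesis by auto
      qed
    qed
    also have "\<dots> = sg (b * c + of_nat j * of_nat i) (S \<chi> \<psi> b zs)"
      by (simp only: S_def split_sum_sg)
    finally show ?thesis .
  qed
  let ?l = "circle V (circle V \<phi> \<psi>) \<chi> - circle V \<phi> (circle V \<psi> \<chi>)"
  let ?r = "circle V (circle V \<phi> \<chi>) \<psi> - circle V \<phi> (circle V \<chi> \<psi>)"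
  let ?e = "b * c + of_nat j * of_nat i"
  have "?l \<in> Hom" "?r \<in> Hom"
    by (intro Hom_diff circle_in C.circle_in assms)+
  then have "?l = pointwise_scale t (psgn ?e) ?r"
  proof (rule hom_ext_alg_eqI[OF _ Hom_scale])
    fix zs assume zs: "tagged V zs"
    note eqs = circle_eq[OF circle_in[OF \<phi> \<psi>(1)] \<chi>(1) zs] circle_eq[OF \<phi> C.circle_in[OF \<psi>(1) \<chi>(1)] zs]
      circle_eq[OF circle_in[OF \<phi> \<chi>(1)] \<psi>(1) zs] circle_eq[OF \<phi> C.circle_in[OF \<chi>(1) \<psi>(1)] zs]
    show "?l (map snd zs) = pointwise_scale t (psgn ?e) ?r (map snd zs)"
      using assoc[OF \<psi>(1) \<chi>(1) \<chi>(2) zs] assoc[OF \<chi>(1) \<psi>(1) \<psi>(2) zs] symm[OF zs]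
      by (simp add: pointwise_scale_def W.scale_psgn eqs)
  qed
  then show ?thesis by (simp add: fun_eq_iff pointwise_scale_def W.scale_psgn)
qed

end


section \<open>The differential of an \<open>L\<^sub>\<infinity>\<close> structure\<close>

lemma ins_tagged_add_left: "ins_tagged w (\<phi> + \<phi>') \<psi> zs = ins_tagged w \<phi> \<psi> zs + ins_tagged w \<phi>' \<psi> zs"
  by (simp add: ins_tagged_def sg_add split_sum_add)

lemma ins_add_left: "ins V w (\<phi> + \<phi>') \<psi> = ins V w \<phi> \<psi> + ins V w \<phi>' \<psi>"
  by (simp add: fun_eq_iff ins_def ins_tagged_add_left[abs_def] hext_add)

lemma (in module) ins_scale_left:
  "ins V w (pointwise_scale scale c \<phi>) \<psi> = pointwise_scale scale c (ins V w \<phi> \<psi>)"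
proof -
  have eq: "ins_tagged w (pointwise_scale scale c \<phi>) \<psi> = (\<lambda>zs. scale c (ins_tagged w \<phi> \<psi> zs))"
    by (auto simp: ins_tagged_def pointwise_scale_def scale_sg split_sum_hom[where f = "scale c", OF scale_right_distrib])
  show ?thesis
    unfolding ins_def eq
    by (simp add: fun_eq_iff pointwise_scale_def hext_hom[where f = "scale c", OF scale_right_distrib])
qed

lemma has_parity_iff_tagged:
  "has_parity V W p \<phi> \<longleftrightarrow> (\<forall>zs. tagged V zs \<longrightarrow> \<phi> (map snd zs) \<in> W (p + par zs))"
proof
  assume h: "\<forall>zs. tagged V zs \<longrightarrow> \<phi> (map snd zs) \<in> W (p + par zs)"
  show "has_parity V W p \<phi>"
    unfolding has_parity_def
  proof (intro allI impI)
    fix xs es assume "homog_args V xs es"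
    then obtain zs where "xs = map snd zs" "es = map fst zs" "tagged V zs"
      by (rule homog_args_obtain_tagged)
    then show "\<phi> xs \<in> W (p + sum_list es)" using h by (simp add: par_def)
  qed
qed (auto simp: has_parity_def par_def homog_args_tagged[symmetric])

lemma parities_iff_has_parity: "parities V (\<lambda>_. p) \<phi> \<longleftrightarrow> has_parity V V p \<phi>"
  by (simp add: parities_def has_parity_iff_tagged)

context super_module
begin

lemma parities_arity_part:
  assumes "\<phi> [] = 0" "\<And>k. k \<ge> 1 \<Longrightarrow> has_parity V V (c k) (arity_part k \<phi>)"
  shows "parities V c \<phi>"
  unfolding parities_def
proof (intro allI impI)
  fix zs assume zs: "tagged V zs"
  show "\<phi> (map snd zs) \<in> V (c (length zs) + par zs)"
  proof (cases "zs = []")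
    case False
    then have "parities V (\<lambda>_. c (length zs)) (arity_part (length zs) \<phi>)"
      using assms(2)[of "length zs"] by (simp add: parities_iff_has_parity Suc_leI)
    then show ?thesis using zs by (auto simp: parities_def arity_part_def)
  qed (simp add: assms)
qed

text \<open>For \<open>k + j = n + 1\<close> the number \<open>k - 1 = n - j\<close> is the length
  of the second block, so the exponent \<open>(k - 1) * j\<close> is the product of the block
  lengths. Splittings with an empty first block have no counterpart in the relation and contribute
  0, because \<open>l [] = 0\<close>.\<close>

lemma L_infinity_relation:
  assumes l: "L_infinity s V l" and zs: "tagged V zs"
  shows "ins_tagged (\<lambda>a b. of_nat a * of_nat b) l l zs = 0"
proof (cases "zs = []")
  case True
  then show ?thesis
    using l C.hom_ext_alg_zero_arg[of l "[]"]
    by (simp add: ins_tagged_def L_infinity_def cochains_def)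
next
  case False
  define n where "n = length zs"
  have n: "n \<ge> 1" using False by (simp add: n_def Suc_leI)
  have l0: "l \<in> Coch" using l by (simp add: L_infinity_def cochains_def)
  have "0 = (\<Sum>(k, j)\<in>arity_pairs (n + 1). s (psgn (of_nat (k - 1) * of_nat j))
      (insertion s (map fst zs) j (n - j) l l (map snd zs)))"
    using l n zs unfolding L_infinity_def by (simp add: n_def homog_args_tagged)
  also have "\<dots> = (\<Sum>j\<in>{1..<n + 1}. split_sum zs (\<lambda>A B. if length A = j then
      sg (of_nat (n - j) * of_nat j) (l (l (map snd A) # map snd B)) else 0))"
    unfolding sum_arity_pairs
  proof (rule sum.cong[OF refl])
    fix j assume "j \<in> {1..<n + 1}"
    then have "length zs = j + (n - j)" by (simp add: n_def)
    from insertion_eq_split_sum[OF this, of l l]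
    show "s (psgn (of_nat (n + 1 - j - 1) * of_nat j)) (insertion s (map fst zs) j (n - j) l l (map snd zs)) =
      split_sum zs (\<lambda>A B. if length A = j then sg (of_nat (n - j) * of_nat j) (l (l (map snd A) # map snd B)) else 0)"
      unfolding scale_psgn by (auto simp flip: split_sum_sg intro!: split_sum_cong)
  qed
  also have "\<dots> = split_sum zs (\<lambda>A B. if length A \<in> {1..<n + 1} then
      sg (of_nat (n - length A) * of_nat (length A)) (l (l (map snd A) # map snd B)) else 0)"
    by (rule split_sum_arity) simp
  also have "\<dots> = ins_tagged (\<lambda>a b. of_nat a * of_nat b) l l zs"
    unfolding ins_tagged_def
  proof (rule split_sum_cong)
    fix A B :: "'v tagged_list" assume len: "length A + length B = length zs"
    then have nB: "n - length A = length B" by (simp add: n_def)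
    show "(if length A \<in> {1..<n + 1} then
      sg (of_nat (n - length A) * of_nat (length A)) (l (l (map snd A) # map snd B)) else 0) =
      sg (lb A * lb B) (l (l (map snd A) # map snd B))"
      using C.hom_ext_alg_nil[OF l0] C.hom_ext_alg_zero_arg[OF l0, of "[]"] len
      unfolding nB by (cases A) (auto simp: n_def mult.commute)
  qed
  finally show ?thesis by simp
qed

end

text \<open>The sign \<open>(-1)\<^bsup>(k-1)j\<^esup>\<close> in terms of the lengths \<open>j\<close> and \<open>k\<close> of the two blocks.\<close>

abbreviation diff_sign :: "nat \<Rightarrow> nat \<Rightarrow> bit" where
  "diff_sign a b \<equiv> (of_nat b + 1) * of_nat a"

context graded_maps
begin

text \<open>Here the second block has length \<open>k\<close>, so \<open>k - 1\<close> becomes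
  \<open>b + 1\<close> in \<open>bit\<close>. Splittings with an empty block are missing on the left
  and vanish on the right: by \<open>\<psi> [] = 0\<close> if \<open>A\<close> is empty, and by
  \<open>\<Phi> [v] = 0\<close> if \<open>B\<close> is.\<close>

lemma sum_insertion_eq_ins_tagged:
  assumes \<Phi>: "\<Phi> \<in> Hom" "\<And>v. \<Phi> [v] = 0" and \<psi>: "\<psi> [] = 0"
  shows "(\<Sum>(k, j)\<in>arity_pairs (length zs). sg (of_nat (k - 1) * c j)
      (insertion t (map fst zs) j k \<Phi> \<psi> (map snd zs))) =
    ins_tagged (\<lambda>a b. (of_nat b + 1) * c a) \<Phi> \<psi> zs"
proof -
  define n where "n = length zs"
  have "(\<Sum>(k, j)\<in>arity_pairs n. sg (of_nat (k - 1) * c j)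
      (insertion t (map fst zs) j k \<Phi> \<psi> (map snd zs))) =
    (\<Sum>j\<in>{1..<n}. split_sum zs (\<lambda>A B. if length A = j then
      sg (of_nat (n - j - 1) * c j) (\<Phi> (\<psi> (map snd A) # map snd B)) else 0))"
    unfolding sum_arity_pairs
  proof (rule sum.cong[OF refl])
    fix j assume "j \<in> {1..<n}"
    then have "length zs = j + (n - j)" by (simp add: n_def)
    from W.insertion_eq_split_sum[OF this, of \<Phi> \<psi>]
    show "sg (of_nat (n - j - 1) * c j) (insertion t (map fst zs) j (n - j) \<Phi> \<psi> (map snd zs)) =
      split_sum zs (\<lambda>A B. if length A = j then sg (of_nat (n - j - 1) * c j) (\<Phi> (\<psi> (map snd A) # map snd B)) else 0)"
      by (auto simp flip: split_sum_sg intro!: split_sum_cong)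
  qed
  also have "\<dots> = split_sum zs (\<lambda>A B. if length A \<in> {1..<n} then
      sg (of_nat (n - length A - 1) * c (length A)) (\<Phi> (\<psi> (map snd A) # map snd B)) else 0)"
    by (rule split_sum_arity) simp
  also have "\<dots> = ins_tagged (\<lambda>a b. (of_nat b + 1) * c a) \<Phi> \<psi> zs"
    unfolding ins_tagged_def
  proof (rule split_sum_cong)
    fix A B :: "'v tagged_list" assume len: "length A + length B = length zs"
    consider "A = []" | "B = []" | b B' where "A \<noteq> []" "B = b # B'" by (cases B) auto
    then show "(if length A \<in> {1..<n} then
      sg (of_nat (n - length A - 1) * c (length A)) (\<Phi> (\<psi> (map snd A) # map snd B)) else 0) =
      sg ((lb B + 1) * c (length A)) (\<Phi> (\<psi> (map snd A) # map snd B))"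
    proof cases
      case 1
      then show ?thesis using hom_ext_alg_zero_arg[OF \<Phi>(1), of "[]"] \<psi> by simp
    next
      case 2
      then show ?thesis using \<Phi>(2) len by (simp add: n_def)
    next
      case 3
      then have "length A \<in> {1..<n}" "n - length A - 1 = length B'"
        using len by (auto simp: n_def Suc_leI)
      then show ?thesis using 3 by (simp add: add_ac)
    qed
  qed
  finally show ?thesis by (simp add: n_def)
qed

end

locale k_valued_maps = super_module s V
  for s :: "'k::comm_ring_1 \<Rightarrow> 'v::ab_group_add \<Rightarrow> 'v" and V
begin

sublocale K: graded_maps s V "(*) :: 'k \<Rightarrow> 'k \<Rightarrow> 'k"
  by unfold_locales (simp_all add: algebra_simps)

lemma CC_formD: "\<Phi> \<in> CC_form s V \<Longrightarrow> \<Phi> \<in> hom_ext_alg s V (*)" "\<Phi> \<in> CC_form s V \<Longrightarrow> \<Phi> [v] = 0"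
  by (simp_all add: CC_form_def)

lemma form_diff_eq_ins:
  assumes "\<Phi> \<in> CC_form s V" "l \<in> Coch"
  shows "form_diff V l \<Phi> = ins V diff_sign \<Phi> l"
proof
  fix xs
  show "form_diff V l \<Phi> xs = ins V diff_sign \<Phi> l xs"
    unfolding form_diff_def homog_extend_eq_hext ins_def
  proof (rule hext_cong)
    fix zs :: "'v tagged_list"
    show "(\<Sum>(k, j)\<in>arity_pairs (length (map snd zs)). psgn (of_nat (k - 1) * of_nat j) *
        insertion (*) (map fst zs) j k \<Phi> l (map snd zs)) = ins_tagged diff_sign \<Phi> l zs"
      using K.sum_insertion_eq_ins_tagged[of \<Phi> l of_nat zs] CC_formD[OF assms(1)] C.hom_ext_alg_nil[OF assms(2)]
      by (simp add: psgn_mult)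
  qed
qed

lemma form_diff_in_CC_form:
  assumes "\<Phi> \<in> CC_form s V" "l \<in> Coch"
  shows "form_diff V l \<Phi> \<in> CC_form s V"
proof -
  have "ins V diff_sign \<Phi> l [v] = 0" for v
    using C.hom_ext_alg_nil[OF assms(2)] CC_formD[OF assms(1)]
      K.hom_ext_alg_zero_arg[OF CC_formD(1)[OF assms(1)], of "[]"]
    by (simp add: ins_def ins_tagged_def)
  then show ?thesis
    using K.ins_in[OF CC_formD(1)[OF assms(1)] assms(2)]
    by (simp add: form_diff_eq_ins[OF assms] CC_form_def)
qed

lemma subspace_CC_form: "module.subspace (pointwise_scale (*)) (CC_form s V)"
  using K.subspace_hom_ext_alg
  unfolding module.subspace_def[OF K.module_pointwise] CC_form_def
  by (auto simp: pointwise_scale_def)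

lemma form_diff_form_diff:
  assumes l: "L_infinity s V l" and \<Phi>: "\<Phi> \<in> CC_form s V"
  shows "form_diff V l (form_diff V l \<Phi>) = 0"
proof -
  have l0: "l \<in> Coch" using l by (simp add: L_infinity_def cochains_def)
  have par_l: "parities V of_nat l"
    by (rule parities_arity_part) (use l C.hom_ext_alg_nil[OF l0] in \<open>auto simp: L_infinity_def\<close>)
  note \<Phi>0 = CC_formD(1)[OF \<Phi>]
  let ?D = "ins V diff_sign \<Phi> l"
  have D: "form_diff V l \<Phi> = ?D" "?D \<in> CC_form s V"
    using form_diff_eq_ins[OF \<Phi> l0] form_diff_in_CC_form[OF \<Phi> l0] by simp_all
  have "ins V diff_sign ?D l = 0"
  proof (rule K.hom_ext_alg_eqI)
    show "ins V diff_sign ?D l \<in> hom_ext_alg s V (*)" by (rule K.ins_in[OF CC_formD(1)[OF D(2)] l0])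
    show "0 \<in> hom_ext_alg s V ((*) :: 'k \<Rightarrow> _)"
      by (rule K.Hom_0)
    fix zs assume zs: "tagged V zs"
    define F where "F A P Q = sg (diff_sign (length A) (length P + length Q) +
      diff_sign (Suc (length P)) (length Q))
        (\<Phi> (l (l (map snd A) # map snd P) # map snd Q))" for A P Q :: "'v tagged_list"
    define G where "G A P Q = sg (diff_sign (length A) (length P + length Q) +
      diff_sign (length P) (Suc (length Q)) + (lb P + (lb A + par A) * par P))
        (\<Phi> (l (map snd P) # l (map snd A) # map snd Q))" for A P Q :: "'v tagged_list"
    have "split_sum zs (\<lambda>A R. split_sum R (\<lambda>P Q. F A P Q)) =
      split_sum zs (\<lambda>Z Q. split_sum Z (\<lambda>A P. F A P Q))"
      by (rule split_sum_assoc[symmetric])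
    also have "\<dots> = split_sum zs (\<lambda>Z Q. 0)"
    proof (rule split_sum_cong_tagged[OF zs])
      fix Z Q :: "'v tagged_list" assume Z: "tagged V Z"
      \<comment> \<open>The two weights add up to \<open>lb A * lb P\<close>, the exponent of the
        L_infinity relation on \<open>Z\<close>, plus an exponent that depends only on the lengths
        of \<open>Z\<close> and \<open>Q\<close> and can be pulled out.\<close>
      have "split_sum Z (\<lambda>A P. F A P Q) =
        split_sum Z (\<lambda>A P. sg ((lb Q + 1) * (lb Z + 1))
          (\<Phi> (sg (lb A * lb P) (l (l (map snd A) # map snd P)) # map snd Q)))"
      proof (rule split_sum_cong)
        fix A P :: "'v tagged_list" assume "length A + length P = length Z"
        then have len: "lb Z = lb A + lb P" by (metis of_nat_add)
        show "F A P Q =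
          sg ((lb Q + 1) * (lb Z + 1)) (\<Phi> (sg (lb A * lb P) (l (l (map snd A) # map snd P)) # map snd Q))"
          using K.hom_ext_alg_sg[OF \<Phi>0, of "[]"] by (simp add: F_def len bit_ring)
      qed
      also have "\<dots> = sg ((lb Q + 1) * (lb Z + 1))
          (\<Phi> (ins_tagged (\<lambda>a b. of_nat a * of_nat b) l l Z # map snd Q))"
        unfolding ins_tagged_def using K.hom_ext_alg_add[OF \<Phi>0, of "[]"]
        by (intro split_sum_hom[symmetric,
              where f = "\<lambda>v. sg ((lb Q + 1) * (lb Z + 1)) (\<Phi> (v # map snd Q))"]) (simp add: sg_add)
      also have "\<dots> = 0"
        using L_infinity_relation[OF l Z] K.hom_ext_alg_zero_arg[OF \<Phi>0, of "[]"] by simp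
      finally show "split_sum Z (\<lambda>A P. F A P Q) = 0" .
    qed
    finally have nested: "split_sum zs (\<lambda>A R. split_sum R (\<lambda>P Q. F A P Q)) = 0" by simp
    have "split_sum zs (\<lambda>A R. split_sum R (\<lambda>P Q. G A P Q)) =
        split_sum zs (\<lambda>Z Q. split_sum Z (\<lambda>A P. G A P Q))"
      by (rule split_sum_assoc[symmetric])
    also have "\<dots> = split_sum zs (\<lambda>Z Q. 0)"
    proof (rule split_sum_cong_tagged[OF zs])
      fix Z Q :: "'v tagged_list" assume Z: "tagged V Z" and Q: "tagged V Q"
      show "split_sum Z (\<lambda>A P. G A P Q) = 0"
      \<comment> \<open>Exchanging \<open>A\<close> and \<open>P\<close> exchanges the first two
        arguments of \<open>\<Phi>\<close>. The weights, the passing signs and the swap combine to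
        -1, since \<open>l\<close> has parity equal to the arity on each block.\<close>
      proof (rule split_sum_cancel)
        fix A P assume "set A \<union> set P = set Z"
        then have "tagged V A" "tagged V P" using Z tagged_union by blast+
        then have "\<Phi> ([] @ l (map snd P) # l (map snd A) # map snd Q) =
            sg ((lb P + par P) * (lb A + par A) + 1) (\<Phi> ([] @ l (map snd A) # l (map snd P) # map snd Q))"
          using par_l by (intro K.hom_ext_alg_swap[OF \<Phi>0]) (auto simp: parities_def)
        then show "sg (xsg A P) (G P A Q) = - G A P Q"
          by (simp add: G_def xsg_def minus_sg bit_ring)
      next
        show "G [] [] Q = 0"
          using K.hom_ext_alg_zero_arg[OF \<Phi>0, of "[]"] C.hom_ext_alg_nil[OF l0] by (simp add: G_def)
      qed
    qed
    finally have disjoint: "split_sum zs (\<lambda>A R. split_sum R (\<lambda>P Q. G A P Q)) = 0" by simp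
    have "ins V diff_sign ?D l (map snd zs) = ins_tagged diff_sign ?D l zs"
      by (rule K.ins_eq[OF CC_formD(1)[OF D(2)] l0 zs])
    also have "\<dots> = 0"
      unfolding K.ins_tagged_ins_left[OF \<Phi>0 l0 l0 par_l zs]
      using nested disjoint by (simp only: F_def G_def add_0_right)
    finally show "ins V diff_sign ?D l (map snd zs) = 0 (map snd zs)" by simp
  qed
  then show ?thesis using form_diff_eq_ins[OF D(2) l0] D(1) by simp
qed

end


section \<open>Homogeneous components\<close>

lemma arity_part_add: "arity_part k (\<phi> + \<psi>) = arity_part k \<phi> + arity_part k (\<psi> :: 'v list \<Rightarrow> 'w::ab_group_add)"
  by (auto simp: arity_part_def fun_eq_iff)

lemma has_arity_arity_part: "has_arity k (arity_part k \<phi>)"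
  by (simp add: has_arity_def arity_part_def)

lemma arity_part_has_arity: "has_arity k \<phi> \<Longrightarrow> arity_part k' \<phi> = (if k' = k then \<phi> else (\<lambda>_. 0))"
  by (auto simp: has_arity_def arity_part_def fun_eq_iff)

lemma sum_fun_apply: "sum f A x = (\<Sum>i\<in>A. f i x)" for f :: "'i \<Rightarrow> 'a \<Rightarrow> 'b::comm_monoid_add"
  by (induction A rule: infinite_finite_induct) simp_all

context super_module
begin

lemma parity_part_eq: "parity_part V p \<phi> = hext V (\<lambda>zs. hproj V (p + par zs) (\<phi> (map snd zs)))"
  by (simp add: fun_eq_iff parity_part_def homog_extend_eq_hext par_def)

lemma parity_part_add: "parity_part V p (\<phi> + \<psi>) = parity_part V p \<phi> + parity_part V p \<psi>"
  by (simp add: fun_eq_iff parity_part_eq hproj_add hext_add)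

lemma parity_part_scale:
  "parity_part V p (pointwise_scale s c \<phi>) = pointwise_scale s c (parity_part V p \<phi>)"
  by (simp add: fun_eq_iff parity_part_eq pointwise_scale_def hproj_scale
      hext_hom[where f = "s c", OF scale_right_distrib])

lemma has_arity_parity_part:
  assumes "has_arity k \<phi>" shows "has_arity k (parity_part V p \<phi>)"
  unfolding has_arity_def
proof (intro allI impI)
  fix xs :: "'v list" assume "length xs \<noteq> k"
  then have "parity_part V p \<phi> xs = hext V (\<lambda>zs. 0 :: 'v) xs"
    unfolding parity_part_eq by (intro hext_cong) (simp add: has_arityD[OF assms])
  then show "parity_part V p \<phi> xs = 0" by simp
qed

lemma galt_parity_part:
  assumes "\<phi> \<in> Coch"
  shows "C.galt (\<lambda>zs. hproj V (p + par zs) (\<phi> (map snd zs)))"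
proof (rule graded_altI, goal_cases)
  case (3 us ws p' q x y)
  have hproj_sg: "hproj V e (sg a v) = sg a (hproj V e v)" for e a v
    using hproj_scale[of e "psgn a" v] by (simp add: scale_psgn)
  have "par (us @ (p', x) # (q, y) # ws) = par (us @ (q, y) # (p', x) # ws)" by (simp add: add_ac)
  then show ?case
    using C.hom_ext_alg_swap[OF assms 3(3,4), of "map snd us" "map snd ws"] by (simp add: hproj_sg add_ac)
qed (simp_all add: C.hom_ext_alg_add[OF assms] C.hom_ext_alg_scale[OF assms] hproj_add hproj_scale)

lemma parity_part_in:
  assumes "\<phi> \<in> Coch"
  shows "parity_part V p \<phi> \<in> Coch"
  unfolding parity_part_eq
  by (rule C.hext_in_hom_ext_alg[OF galt_parity_part[OF assms]]) (simp add: C.hom_ext_alg_nil[OF assms])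

lemma parity_part_tagged:
  assumes "\<phi> \<in> Coch" "tagged V zs"
  shows "parity_part V p \<phi> (map snd zs) = hproj V (p + par zs) (\<phi> (map snd zs))"
  unfolding parity_part_eq by (rule C.hext_tagged[OF galt_parity_part[OF assms(1)] assms(2)])

lemma parities_parity_part:
  assumes "\<phi> \<in> Coch"
  shows "parities V (\<lambda>_. p) (parity_part V p \<phi>)"
  by (simp add: parities_def parity_part_tagged[OF assms])

lemma parity_part_parities:
  assumes "\<phi> \<in> Coch" "parities V (\<lambda>_. a) \<phi>"
  shows "parity_part V p \<phi> = (if p = a then \<phi> else 0)"
proof (rule C.hom_ext_alg_eqI[OF parity_part_in[OF assms(1)]])
  show "(if p = a then \<phi> else 0) \<in> Coch"
    using assms(1) C.Hom_0 by simp
  fix zs assume zs: "tagged V zs"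
  have "\<phi> (map snd zs) \<in> V (a + par zs)" using assms(2) zs by (simp add: parities_def)
  then show "parity_part V p \<phi> (map snd zs) = (if p = a then \<phi> else 0) (map snd zs)"
    by (simp add: parity_part_tagged[OF assms(1) zs] hproj_other)
qed

lemma parity_part_sum:
  assumes "\<phi> \<in> Coch"
  shows "parity_part V 0 \<phi> + parity_part V 1 \<phi> = \<phi>"
proof (rule C.hom_ext_alg_eqI[OF _ assms])
  show "parity_part V 0 \<phi> + parity_part V 1 \<phi> \<in> Coch"
    by (intro C.Hom_add parity_part_in assms)
  fix zs assume zs: "tagged V zs"
  have "hproj V e v + hproj V (1 + e) v = v" for e v
    using hproj_sum[of v] by (cases e) (simp_all add: add.commute)
  then show "(parity_part V 0 \<phi> + parity_part V 1 \<phi>) (map snd zs) = \<phi> (map snd zs)"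
    by (simp add: parity_part_tagged[OF assms zs])
qed

text \<open>For \<open>k \<ge> 1\<close> the homogeneous component of bidegree
  \<open>(a, k - 1)\<close>.\<close>

definition component :: "nat \<Rightarrow> bit \<Rightarrow> ('v list \<Rightarrow> 'v) \<Rightarrow> 'v list \<Rightarrow> 'v" where
  "component k a \<phi> = parity_part V a (arity_part k \<phi>)"

lemma arity_part_in: "\<phi> \<in> Coch \<Longrightarrow> arity_part k \<phi> \<in> Coch"
  using C.hom_ext_alg_iff_arity_parts by blast

lemma component_in: "\<phi> \<in> Coch \<Longrightarrow> component k a \<phi> \<in> Coch"
  unfolding component_def by (intro parity_part_in arity_part_in)

lemma has_arity_component: "has_arity k (component k a \<phi>)"
  unfolding component_def by (intro has_arity_parity_part has_arity_arity_part)

lemma parities_component: "\<phi> \<in> Coch \<Longrightarrow> parities V (\<lambda>_. a) (component k a \<phi>)"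
  unfolding component_def by (intro parities_parity_part arity_part_in)

lemma component_add: "component k a (\<phi> + \<psi>) = component k a \<phi> + component k a \<psi>"
  by (simp add: component_def arity_part_add parity_part_add)

lemma component_scale: "component k a (pointwise_scale s c \<phi>) = pointwise_scale s c (component k a \<phi>)"
proof -
  have "arity_part k (pointwise_scale s c \<phi>) = pointwise_scale s c (arity_part k \<phi>)"
    by (auto simp: arity_part_def pointwise_scale_def fun_eq_iff)
  then show ?thesis by (simp add: component_def parity_part_scale)
qed

lemma component_sum:
  "\<phi> \<in> Coch \<Longrightarrow> component k 0 \<phi> + component k 1 \<phi> = arity_part k \<phi>"
  unfolding component_def by (intro parity_part_sum arity_part_in)

lemma component_homog:
  assumes "\<phi> \<in> Coch" "has_arity k \<phi>" "parities V (\<lambda>_. a) \<phi>"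
  shows "component k' a' \<phi> = (if k' = k \<and> a' = a then \<phi> else 0)"
proof -
  have "parity_part V a' (\<lambda>_. 0) = 0" by (simp add: fun_eq_iff parity_part_eq)
  then show ?thesis
    using parity_part_parities[OF assms(1,3)]
    by (auto simp: component_def arity_part_has_arity[OF assms(2)] zero_fun_def)
qed


section \<open>The bracket\<close>

lemma circle_has_arity:
  assumes "\<phi> \<in> Coch" "has_arity (Suc r) \<phi>" "has_arity j \<psi>"
  shows "has_arity (r + j) (circle V \<phi> \<psi>)"
  unfolding has_arity_def
proof (intro allI impI)
  fix xs :: "'v list" assume len: "length xs \<noteq> r + j"
  have "circle V \<phi> \<psi> xs = hext V (\<lambda>zs. 0 :: 'v) xs"
    unfolding circle_def ins_def
  proof (rule hext_cong)
    fix zs :: "'v tagged_list" assume "length zs = length xs"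
    then have "ins_tagged (\<lambda>_ _. 0) \<phi> \<psi> zs = split_sum zs (\<lambda>A B. 0)"
      unfolding ins_tagged_def
    proof (intro split_sum_cong, goal_cases)
      case (1 A B)
      then have "length A \<noteq> j \<or> length B \<noteq> r" using len by auto
      then show ?case
        using has_arityD[OF assms(3), of "map snd A"] has_arityD[OF assms(2), of "_ # map snd B"]
          C.hom_ext_alg_zero_arg[OF assms(1), of "[]"] by auto
    qed
    then show "ins_tagged (\<lambda>_ _. 0) \<phi> \<psi> zs = 0" by simp
  qed
  then show "circle V \<phi> \<psi> xs = 0" by simp
qed

text \<open>\<open>circ\<close> prescribes the block lengths and \<open>circle\<close> sums over all
  of them. For maps of fixed arity the additional terms vanish, and on lists of the wrong length
  both sides are 0.\<close>

lemma circ_eq_circle: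
  assumes "\<phi> \<in> Coch" "has_arity (Suc r) \<phi>" "has_arity (Suc q) \<psi>"
  shows "circ s V (Suc r) (Suc q) \<phi> \<psi> = circle V \<phi> \<psi>"
proof
  fix xs
  show "circ s V (Suc r) (Suc q) \<phi> \<psi> xs = circle V \<phi> \<psi> xs"
  proof (cases "length xs = Suc (r + q)")
    case False
    then show ?thesis
      using has_arityD[OF circle_has_arity[OF assms]] by (simp add: circ_def)
  next
    case True
    have "hext V (\<lambda>zs. insertion s (map fst zs) (Suc q) r \<phi> \<psi> (map snd zs)) xs =
        hext V (ins_tagged (\<lambda>_ _. 0) \<phi> \<psi>) xs"
    proof (rule hext_cong)
      fix zs :: "'v tagged_list" assume "length zs = length xs"
      then have len: "length zs = Suc q + r" using True by simp
      show "insertion s (map fst zs) (Suc q) r \<phi> \<psi> (map snd zs) = ins_tagged (\<lambda>_ _. 0) \<phi> \<psi> zs"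
        unfolding insertion_eq_split_sum[OF len] ins_tagged_def
        using has_arityD[OF assms(3)] C.hom_ext_alg_zero_arg[OF assms(1), of "[]"]
        by (intro split_sum_cong) simp
    qed
    then show ?thesis
      using True by (simp add: circ_def homog_extend_eq_hext circle_def ins_def)
  qed
qed

text \<open>The indices \<open>r\<close>, \<open>q\<close> are degrees, so the arities are \<open>Suc r\<close>, \<open>Suc q\<close>.\<close>

definition hbr :: "nat \<Rightarrow> nat \<Rightarrow> bit \<Rightarrow> bit \<Rightarrow> ('v list \<Rightarrow> 'v) \<Rightarrow> ('v list \<Rightarrow> 'v) \<Rightarrow> 'v list \<Rightarrow> 'v" where
  "hbr r q a b \<phi> \<psi> xs = sg (of_nat r * b)
     (circle V \<phi> \<psi> xs - sg (a * b + of_nat r * of_nat q) (circle V \<psi> \<phi> xs))"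

lemma homog_bracket_eq_hbr:
  assumes "\<phi> \<in> Coch" "has_arity (Suc r) \<phi>" "\<psi> \<in> Coch" "has_arity (Suc q) \<psi>"
  shows "homog_bracket s V (Suc r) (Suc q) a b \<phi> \<psi> = hbr r q a b \<phi> \<psi>"
  by (simp add: fun_eq_iff homog_bracket_def homog_commutator_def hbr_def scale_psgn
      circ_eq_circle[OF assms(1,2,4)] circ_eq_circle[OF assms(3,4,2)])

lemma hbr_has_arity:
  assumes "\<phi> \<in> Coch" "has_arity (Suc r) \<phi>" "\<psi> \<in> Coch" "has_arity (Suc q) \<psi>"
  shows "has_arity (Suc (r + q)) (hbr r q a b \<phi> \<psi>)"
  using circle_has_arity[OF assms(1,2,4)] circle_has_arity[OF assms(3,4,2)]
  by (simp add: has_arity_def hbr_def add.commute)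

lemma hbr_in:
  assumes "\<phi> \<in> Coch" "\<psi> \<in> Coch"
  shows "hbr r q a b \<phi> \<psi> \<in> Coch"
proof -
  have "hbr r q a b \<phi> \<psi> = pointwise_scale s (psgn (of_nat r * b)) (circle V \<phi> \<psi> -
      pointwise_scale s (psgn (a * b + of_nat r * of_nat q)) (circle V \<psi> \<phi>))"
    by (simp add: fun_eq_iff hbr_def pointwise_scale_def scale_psgn)
  also have "\<dots> \<in> Coch"
    by (intro C.Hom_scale C.Hom_diff C.circle_in assms)
  finally show ?thesis .
qed

lemma bracket_eq_sum:
  assumes "\<phi> \<in> Coch" "\<psi> \<in> Coch"
  shows "bracket s V \<phi> \<psi> xs = (\<Sum>(k, j)\<in>arity_pairs (length xs + 1). \<Sum>a\<in>{0, 1}. \<Sum>b\<in>{0, 1}.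
    hbr (k - 1) (j - 1) a b (component k a \<phi>) (component j b \<psi>) xs)"
  unfolding bracket_def
proof (rule sum.cong[OF refl], clarify, intro sum.cong[OF refl])
  fix k j a b assume "(k, j) \<in> arity_pairs (length xs + 1)"
  then have kj: "k = Suc (k - 1)" "j = Suc (j - 1)" by (auto simp: arity_pairs_def)
  show "homog_bracket s V k j a b (parity_part V a (arity_part k \<phi>)) (parity_part V b (arity_part j \<psi>)) xs =
      hbr (k - 1) (j - 1) a b (component k a \<phi>) (component j b \<psi>) xs"
    using homog_bracket_eq_hbr[of "component k a \<phi>" "k - 1" "component j b \<psi>" "j - 1" a b]
      component_in assms has_arity_component kj by (simp add: component_def)
qed

text \<open>A component of the bracket as a finite sum of functions, not only of values: in this
  form the closure of \<open>CC\<close> under sums applies to it.\<close>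

lemma arity_part_bracket:
  assumes "\<phi> \<in> Coch" "\<psi> \<in> Coch"
  shows "arity_part n (bracket s V \<phi> \<psi>) = (\<Sum>(k, j)\<in>arity_pairs (n + 1). \<Sum>a\<in>{0, 1}. \<Sum>b\<in>{0, 1}.
    hbr (k - 1) (j - 1) a b (component k a \<phi>) (component j b \<psi>))"
proof
  fix xs
  show "arity_part n (bracket s V \<phi> \<psi>) xs = (\<Sum>(k, j)\<in>arity_pairs (n + 1). \<Sum>a\<in>{0, 1}. \<Sum>b\<in>{0, 1}.
    hbr (k - 1) (j - 1) a b (component k a \<phi>) (component j b \<psi>)) xs"
  proof (cases "length xs = n")
    case True
    then show ?thesis
      by (simp add: arity_part_def bracket_eq_sum[OF assms] sum_fun_apply case_prod_unfold del: sum.insert)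
  next
    case False
    have "hbr (k - 1) (j - 1) a b (component k a \<phi>) (component j b \<psi>) xs = 0"
      if "(k, j) \<in> arity_pairs (n + 1)" for k j a b
    proof -
      obtain r q where rq: "k = Suc r" "j = Suc q"
        using \<open>(k, j) \<in> arity_pairs (n + 1)\<close> by (cases k; cases j) (auto simp: arity_pairs_def)
      then have "length xs \<noteq> Suc (r + q)" using False that by (simp add: arity_pairs_def)
      then show ?thesis
        using has_arityD[OF hbr_has_arity[OF component_in[OF assms(1)] has_arity_component
              component_in[OF assms(2)] has_arity_component]] rq by simp
    qed
    then show ?thesis
      using False by (auto simp: arity_part_def sum_fun_apply case_prod_unfold intro!: sum.neutral[symmetric])
  qed
qed

lemma hbr_zero [simp]:
  assumes "\<phi> \<in> Coch"
  shows "hbr r q a b \<phi> 0 = 0" "hbr r q a b 0 \<phi> = 0"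
proof -
  have "circle V \<phi> 0 xs = 0" "circle V (0 :: 'v list \<Rightarrow> 'v) \<phi> xs = 0" for xs
    using C.hom_ext_alg_zero_arg[OF assms, of "[]"]
    by (simp_all add: circle_def ins_def ins_tagged_def[abs_def])
  then show "hbr r q a b \<phi> 0 = 0" "hbr r q a b 0 \<phi> = 0"
    by (simp_all add: fun_eq_iff hbr_def)
qed

lemma bracket_homog:
  assumes \<phi>: "\<phi> \<in> Coch" "has_arity (Suc r) \<phi>" "parities V (\<lambda>_. a) \<phi>"
    and \<psi>: "\<psi> \<in> Coch" "has_arity (Suc q) \<psi>" "parities V (\<lambda>_. b) \<psi>"
  shows "bracket s V \<phi> \<psi> = hbr r q a b \<phi> \<psi>"
proof
  fix xs
  have "bracket s V \<phi> \<psi> xs = (\<Sum>(k, j)\<in>arity_pairs (length xs + 1). \<Sum>a'\<in>{0, 1}. \<Sum>b'\<in>{0, 1}.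
    if (k, j) = (Suc r, Suc q) then if a' = a then if b' = b then hbr r q a b \<phi> \<psi> xs else 0 else 0 else 0)"
    unfolding bracket_eq_sum[OF \<phi>(1) \<psi>(1)] component_homog[OF \<phi>] component_homog[OF \<psi>]
    by (intro sum.cong refl, clarify, intro sum.cong refl)
      (auto simp: hbr_zero \<phi>(1) \<psi>(1) C.Hom_0)
  also have "\<dots> = (\<Sum>(k, j)\<in>arity_pairs (length xs + 1).
    if (k, j) = (Suc r, Suc q) then hbr r q a b \<phi> \<psi> xs else 0)"
  proof (intro sum.cong refl, clarify)
    fix k j
    have "(\<Sum>a'\<in>{0, 1}. if a' = a then \<Sum>b'\<in>{0, 1}. if b' = b then h else 0 else 0) = h" for h :: 'v
      by (cases a; cases b) simp_all
    then show "(\<Sum>a'\<in>{0, 1}. \<Sum>b'\<in>{0, 1}. if (k, j) = (Suc r, Suc q) then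
        if a' = a then if b' = b then hbr r q a b \<phi> \<psi> xs else 0 else 0 else 0) =
      (if (k, j) = (Suc r, Suc q) then hbr r q a b \<phi> \<psi> xs else 0)"
      by (cases a; cases b) simp_all
  qed
  also have "\<dots> = (if (Suc r, Suc q) \<in> arity_pairs (length xs + 1) then hbr r q a b \<phi> \<psi> xs else 0)"
  proof -
    have "finite (arity_pairs m)" for m
      by (rule finite_subset[of _ "{..m} \<times> {..m}"]) (auto simp: arity_pairs_def)
    moreover have "(\<lambda>(k, j). if (k, j) = (Suc r, Suc q) then h else 0) =
        (\<lambda>x. if x = (Suc r, Suc q) then h else 0)" for h :: 'v by auto
    ultimately show ?thesis by (simp only: sum.delta)
  qed
  \<comment> \<open>If the pair of arities is not an index of the sum, the list has the wrong length
    for \<open>hbr\<close>, whose value is then 0 as well.\<close>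
  also have "\<dots> = hbr r q a b \<phi> \<psi> xs"
    using has_arityD[OF hbr_has_arity[OF \<phi>(1,2) \<psi>(1,2)], of xs] by (auto simp: arity_pairs_def)
  finally show "bracket s V \<phi> \<psi> xs = hbr r q a b \<phi> \<psi> xs" .
qed

end


section \<open>Cyclic maps\<close>

lemma tilde_snoc [simp]: "tilde ip \<phi> (xs @ [v]) = ip (\<phi> xs) v"
  by (simp add: tilde_def)

locale inner_product_maps = k_valued_maps s V
  for s :: "'k::comm_ring_1 \<Rightarrow> 'v::ab_group_add \<Rightarrow> 'v" and V +
  fixes ip :: "'v \<Rightarrow> 'v \<Rightarrow> 'k"
  assumes inner_product: "inner_product s V ip"
begin

lemma module_hom_ip: "module_hom s (*) (\<lambda>v. ip v w)" "module_hom s (*) (ip v)"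
  using inner_product by (simp_all add: inner_product_def)

lemma ip_add: "ip (x + y) w = ip x w + ip y w" "ip v (x + y) = ip v x + ip v y"
  using module_hom.add[OF module_hom_ip(1)] module_hom.add[OF module_hom_ip(2)] by simp_all

lemma ip_scale: "ip (s c x) w = c * ip x w" "ip v (s c x) = c * ip v x"
  using module_hom.scale[OF module_hom_ip(1)] module_hom.scale[OF module_hom_ip(2)] by simp_all

lemma ip_zero [simp]: "ip 0 w = 0" "ip v 0 = 0"
  using ip_add(1)[of 0 0] ip_add(2)[of _ 0 0] by simp_all

lemma ip_sg: "ip (sg e x) w = sg e (ip x w)"
  using ip_scale(1)[of "psgn e" x w] by (simp add: scale_psgn psgn_mult)

lemma ip_diff: "ip (x - y) w = ip x w - ip y w"
  using ip_add(1)[of "x - y" y w] by simp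

lemma ip_even: "v \<in> V p \<Longrightarrow> w \<in> V q \<Longrightarrow> p \<noteq> q \<Longrightarrow> ip v w = 0"
  using inner_product[unfolded inner_product_def, THEN conjunct2, THEN conjunct2, THEN conjunct1] by blast

lemma ip_sym: "v \<in> V p \<Longrightarrow> w \<in> V q \<Longrightarrow> ip v w = sg (p * q) (ip w v)"
  using inner_product[unfolded inner_product_def psgn_mult, THEN conjunct2, THEN conjunct2, THEN conjunct2,
      THEN conjunct1, rule_format] .

lemma bij_ip: "bij_betw ip UNIV {f. module_hom s (*) f}"
  using inner_product by (simp add: inner_product_def)

lemma ip_inj: "(\<And>w. ip v w = ip v' w) \<Longrightarrow> v = v'"
  using bij_betw_imp_inj_on[OF bij_ip] by (metis ext injD)

lemma ip_represent:
  assumes "module_hom s (*) f" shows "\<exists>v. \<forall>w. ip v w = f w"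
  using bij_betw_imp_surj_on[OF bij_ip] assms by (metis (mono_tags) imageE mem_Collect_eq)

lemma ip_hproj: "w \<in> V q \<Longrightarrow> ip (hproj V p v) w = (if p = q then ip v w else 0)"
proof -
  assume w: "w \<in> V q"
  have other: "ip (hproj V p v) w = 0" if "p \<noteq> q" for p
    by (rule ip_even[OF hproj_in w that])
  have "hproj V q v + hproj V (q + 1) v = v"
    using hproj_sum[of v] by (cases q) (simp_all add: add.commute)
  then have "ip v w = ip (hproj V q v) w + ip (hproj V (q + 1) v) w"
    by (simp flip: ip_add)
  moreover have "q + 1 \<noteq> q" by (cases q) auto
  ultimately show ?thesis using other by auto
qed

text \<open>Evenness gives one direction. Conversely \<open>v\<close> and \<open>hproj V p v\<close>
  have the same products with both parts, hence are equal by nondegeneracy. This recovers the parity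
  of a map from that of its form.\<close>

lemma in_part_iff: "v \<in> V p \<longleftrightarrow> (\<forall>q. \<forall>w\<in>V q. q \<noteq> p \<longrightarrow> ip v w = 0)"
proof
  assume *: "\<forall>q. \<forall>w\<in>V q. q \<noteq> p \<longrightarrow> ip v w = 0"
  have "v = hproj V p v"
  proof (rule ip_inj)
    fix w
    have *: "ip v (hproj V q w) = ip (hproj V p v) (hproj V q w)" for q
      using *[rule_format, OF hproj_in[of q w]] by (auto simp: ip_hproj[OF hproj_in])
    show "ip v w = ip (hproj V p v) w"
      using *[of 0] *[of 1] hproj_sum[of w] by (metis ip_add(2))
  qed
  then show "v \<in> V p" by (metis hproj_in)
qed (blast intro: ip_even)

lemma tilde_inj: "tilde ip \<phi> = tilde ip \<psi> \<Longrightarrow> \<phi> = \<psi>"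
proof
  fix xs assume *: "tilde ip \<phi> = tilde ip \<psi>"
  show "\<phi> xs = \<psi> xs"
    using fun_cong[OF *, of "xs @ [_]"] by (intro ip_inj) simp
qed

lemma multilin_tilde:
  assumes "\<phi> \<in> Coch"
  shows "K.multilin (tilde ip \<phi>)"
  unfolding K.multilin_iff
proof (intro conjI allI)
  fix us ws x y c
  show "tilde ip \<phi> (us @ (x + y) # ws) = tilde ip \<phi> (us @ x # ws) + tilde ip \<phi> (us @ y # ws)"
  proof (cases ws rule: rev_cases)
    case (snoc ws' w)
    then show ?thesis
      using tilde_snoc[of ip \<phi> "us @ _ # ws'" w] by (simp add: C.hom_ext_alg_add[OF assms] ip_add)
  qed (simp add: ip_add)
  show "tilde ip \<phi> (us @ s c x # ws) = c * tilde ip \<phi> (us @ x # ws)"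
  proof (cases ws rule: rev_cases)
    case (snoc ws' w)
    then show ?thesis
      using tilde_snoc[of ip \<phi> "us @ _ # ws'" w] by (simp add: C.hom_ext_alg_scale[OF assms] ip_scale)
  qed (simp add: ip_scale)
qed

lemma tilde_short:
  assumes "\<phi> [] = 0" shows "tilde ip \<phi> [] = 0" "tilde ip \<phi> [v] = 0"
  using assms by (simp_all add: tilde_def)

lemma CC_D:
  assumes "\<phi> \<in> CC s V ip"
  shows "\<phi> \<in> Coch" "tilde ip \<phi> \<in> CC_form s V" "tilde ip \<phi> \<in> hom_ext_alg s V (*)"
  using assms CC_formD(1) by (simp_all add: CC_def cochains_def)

text \<open>The form of a cochain is always multilinear, so it is enough to exhibit its values on
  homogeneous arguments as those of an alternating map.\<close>

lemma CC_I:
  assumes "\<phi> \<in> Coch" "K.galt T" "\<And>zs. tagged V zs \<Longrightarrow> tilde ip \<phi> (map snd zs) = T zs"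
  shows "\<phi> \<in> CC s V ip"
  using K.hom_ext_algI[OF multilin_tilde[OF assms(1)] _ assms(2,3)] tilde_short[of \<phi>]
    C.hom_ext_alg_nil[OF assms(1)] assms(1) by (simp add: CC_def CC_form_def cochains_def)

lemma tilde_add: "tilde ip (\<phi> + \<psi>) = tilde ip \<phi> + tilde ip \<psi>"
  by (simp add: fun_eq_iff tilde_def ip_add)

lemma tilde_scale: "tilde ip (pointwise_scale s c \<phi>) = pointwise_scale (*) c (tilde ip \<phi>)"
  by (simp add: fun_eq_iff tilde_def ip_scale pointwise_scale_def)

lemma linear_tilde:
  "linear_map_on (pointwise_scale s) (pointwise_scale (*)) L (tilde ip)"
  by (simp add: linear_map_on_def tilde_add tilde_scale)

lemma subspace_CC: "module.subspace (pointwise_scale s) (CC s V ip)"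
proof -
  have "tilde ip 0 = 0" by (simp add: fun_eq_iff tilde_def)
  then show ?thesis
    using C.subspace_hom_ext_alg subspace_CC_form
    unfolding module.subspace_def[OF C.module_pointwise] module.subspace_def[OF K.module_pointwise]
    by (auto simp: CC_def cochains_def tilde_add tilde_scale)
qed

lemmas CC_0 = module.subspace_0[OF C.module_pointwise subspace_CC]
lemmas CC_add = module.subspace_add[OF C.module_pointwise subspace_CC]
lemmas CC_scale = module.subspace_scale[OF C.module_pointwise subspace_CC]
lemmas CC_sum = module.subspace_sum[OF C.module_pointwise subspace_CC]

text \<open>Surjectivity is nondegeneracy: for fixed \<open>xs\<close> the functional sending
  \<open>w\<close> to \<open>\<Phi> (xs @ [w])\<close> is represented by a vector, which is taken as
  the value of \<open>\<phi>\<close> at \<open>xs\<close>. The identities for \<open>\<phi>\<close>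
  are those of \<open>\<Phi>\<close>, tested against every last argument.\<close>

lemma bij_tilde: "bij_betw (tilde ip) (CC s V ip) (CC_form s V)"
  unfolding bij_betw_def
proof (intro conjI equalityI subsetI)
  show "inj_on (tilde ip) (CC s V ip)" by (auto intro: inj_onI tilde_inj)
  show "\<Phi> \<in> CC_form s V" if "\<Phi> \<in> tilde ip ` CC s V ip" for \<Phi> using that CC_D by blast
  fix \<Phi> assume \<Phi>: "\<Phi> \<in> CC_form s V"
  note h = CC_formD(1)[OF \<Phi>]
  have "\<exists>v. \<forall>w. ip v w = \<Phi> (xs @ [w])" for xs
  proof (rule ip_represent)
    show "module_hom s (*) (\<lambda>w. \<Phi> (xs @ [w]))"
      using K.hom_ext_alg_multilin[OF h] unfolding K.multilin_def by blast
  qed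
  then obtain \<phi> where \<phi>: "ip (\<phi> xs) w = \<Phi> (xs @ [w])" for xs w by metis
  have tilde: "tilde ip \<phi> = \<Phi>"
  proof
    fix xs show "tilde ip \<phi> xs = \<Phi> xs"
    proof (cases xs rule: rev_cases)
      case Nil
      then show ?thesis
        using \<phi>[of "[]"] CC_formD(2)[OF \<Phi>] K.hom_ext_alg_nil[OF h] by (simp add: tilde_def)
    qed (simp add: \<phi>)
  qed
  have "\<phi> \<in> Coch"
    unfolding C.hom_ext_alg_iff C.multilin_iff
  proof (intro conjI allI ballI)
    show "\<phi> [] = 0" by (rule ip_inj) (simp add: \<phi> CC_formD(2)[OF \<Phi>])
    show "\<phi> (us @ (x + y) # ws) = \<phi> (us @ x # ws) + \<phi> (us @ y # ws)" for us ws x y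
      using K.hom_ext_alg_add[OF h] by (intro ip_inj) (simp add: \<phi> ip_add)
    show "\<phi> (us @ s c x # ws) = s c (\<phi> (us @ x # ws))" for us ws c x
      using K.hom_ext_alg_scale[OF h] by (intro ip_inj) (simp add: \<phi> ip_scale)
    fix us ws p q x y assume "x \<in> V p" "y \<in> V q"
    then show "\<phi> (us @ x # y # ws) = sg (p * q + 1) (\<phi> (us @ y # x # ws))"
      using K.hom_ext_alg_swap[OF h, of x p y q us "ws @ [_]"] by (intro ip_inj) (simp add: \<phi> ip_sg)
  qed
  then have "\<phi> \<in> CC s V ip" using \<Phi> tilde by (simp add: CC_def cochains_def)
  then show "\<Phi> \<in> tilde ip ` CC s V ip" using tilde by blast
qed

text \<open>The additional argument shifts the length from \<open>r + 1\<close> to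
  \<open>r + 2\<close>. The parity passes to the form because the inner product is even, and back to
  the map by \<open>in_part_iff\<close>.\<close>

lemma tilde_part: "tilde ip ` CC_part s V ip g = CC_form_part s V g"
proof -
  obtain a r where g: "g = (a, r)" by (cases g)
  have iff: "\<phi> \<in> CC_part s V ip g \<longleftrightarrow> tilde ip \<phi> \<in> CC_form_part s V g" if \<phi>: "\<phi> \<in> CC s V ip" for \<phi>
  proof -
    have "has_parity V V a \<phi> \<longleftrightarrow> has_parity V ground_grading a (tilde ip \<phi>)"
    proof
      assume h: "has_parity V V a \<phi>"
      show "has_parity V ground_grading a (tilde ip \<phi>)"
        unfolding has_parity_iff_tagged
      proof (intro allI impI)
        fix zs assume zs: "tagged V zs"
        show "tilde ip \<phi> (map snd zs) \<in> ground_grading (a + par zs)"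
        proof (cases zs rule: rev_cases)
          case Nil
          then show ?thesis
            using tilde_short C.hom_ext_alg_nil[OF CC_D(1)[OF \<phi>]] by (simp add: ground_grading_def)
        next
          case (snoc ys z)
          then have "\<phi> (map snd ys) \<in> V (a + par ys)" "snd z \<in> V (fst z)"
            using zs h by (auto simp: has_parity_iff_tagged)
          from ip_even[OF this] show ?thesis
            by (cases "a + par ys = fst z") (auto simp: snoc ground_grading_def bit_self simp flip: add.assoc)
        qed
      qed
    next
      assume h: "has_parity V ground_grading a (tilde ip \<phi>)"
      show "has_parity V V a \<phi>"
        unfolding has_parity_iff_tagged
      proof (intro allI impI)
        fix zs assume zs: "tagged V zs"
        show "\<phi> (map snd zs) \<in> V (a + par zs)"
          unfolding in_part_iff
        proof (intro allI ballI impI)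
          fix q w assume w: "w \<in> V q" "q \<noteq> a + par zs"
          then have "tilde ip \<phi> (map snd (zs @ [(q, w)])) \<in> ground_grading (a + par (zs @ [(q, w)]))"
            using h[unfolded has_parity_iff_tagged, rule_format, of "zs @ [(q, w)]"] zs by simp
          moreover have "a + (par zs + q) \<noteq> 0" using w(2) by (cases q; cases "par zs"; cases a) auto
          ultimately show "ip (\<phi> (map snd zs)) w = 0" by (simp add: ground_grading_def)
        qed
      qed
    qed
    moreover have "(\<forall>xs. int (length xs) \<noteq> r + 1 \<longrightarrow> \<phi> xs = 0) \<longleftrightarrow>
        (\<forall>xs. int (length xs) \<noteq> r + 2 \<longrightarrow> tilde ip \<phi> xs = 0)"
    proof
      assume h: "\<forall>xs. int (length xs) \<noteq> r + 1 \<longrightarrow> \<phi> xs = 0"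
      show "\<forall>xs. int (length xs) \<noteq> r + 2 \<longrightarrow> tilde ip \<phi> xs = 0"
      proof (intro allI impI)
        fix xs :: "'v list" assume xs: "int (length xs) \<noteq> r + 2"
        show "tilde ip \<phi> xs = 0"
        proof (cases xs rule: rev_cases)
          case Nil
          then show ?thesis using tilde_short C.hom_ext_alg_nil[OF CC_D(1)[OF \<phi>]] by simp
        next
          case (snoc ys z)
          then show ?thesis using h xs by simp
        qed
      qed
    next
      assume h: "\<forall>xs. int (length xs) \<noteq> r + 2 \<longrightarrow> tilde ip \<phi> xs = 0"
      show "\<forall>xs. int (length xs) \<noteq> r + 1 \<longrightarrow> \<phi> xs = 0"
      proof (intro allI impI)
        fix xs :: "'v list" assume "int (length xs) \<noteq> r + 1"
        then have "ip (\<phi> xs) w = ip 0 w" for w using h[rule_format, of "xs @ [w]"] by simp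
        then show "\<phi> xs = 0" by (rule ip_inj)
      qed
    qed
    ultimately show ?thesis
      using \<phi> CC_D(2)[OF \<phi>] by (simp add: g CC_part_def CC_form_part_def)
  qed
  have sub: "CC_part s V ip g \<subseteq> CC s V ip" "CC_form_part s V g \<subseteq> CC_form s V"
    by (auto simp: g CC_part_def CC_form_part_def)
  have image: "tilde ip ` CC s V ip = CC_form s V" using bij_tilde by (simp add: bij_betw_def)
  show ?thesis
  proof (intro equalityI subsetI)
    show "\<Phi> \<in> CC_form_part s V g" if "\<Phi> \<in> tilde ip ` CC_part s V ip g" for \<Phi>
      using that iff sub(1) by auto
    fix \<Phi> assume \<Phi>: "\<Phi> \<in> CC_form_part s V g"
    then obtain \<phi> where "\<phi> \<in> CC s V ip" "\<Phi> = tilde ip \<phi>" using sub(2) image by blast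
    then show "\<Phi> \<in> tilde ip ` CC_part s V ip g" using iff \<Phi> by simp
  qed
qed

lemma tilde_arity_part:
  assumes "\<phi> [] = 0"
  shows "tilde ip (arity_part k \<phi>) = arity_part (Suc k) (tilde ip \<phi>)"
proof
  fix xs show "tilde ip (arity_part k \<phi>) xs = arity_part (Suc k) (tilde ip \<phi>) xs"
    using assms by (cases xs rule: rev_cases) (auto simp: tilde_def arity_part_def)
qed

lemma CC_iff: "\<phi> \<in> CC s V ip \<longleftrightarrow> \<phi> \<in> Coch \<and> tilde ip \<phi> \<in> hom_ext_alg s V (*)"
  using CC_D(1,3) CC_I K.galt_hom_ext_alg by blast

lemma CC_iff_arity_parts: "\<phi> \<in> CC s V ip \<longleftrightarrow> (\<forall>k. arity_part k \<phi> \<in> CC s V ip)"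
proof -
  have "tilde ip \<phi> \<in> hom_ext_alg s V (*) \<longleftrightarrow>
      (\<forall>k. tilde ip (arity_part k \<phi>) \<in> hom_ext_alg s V (*))" if \<phi>: "\<phi> \<in> Coch"
  proof -
    note \<phi>0 = C.hom_ext_alg_nil[OF \<phi>]
    have "arity_part 0 (tilde ip \<phi>) = 0"
      using tilde_short \<phi>0 by (auto simp: arity_part_def fun_eq_iff)
    then have "arity_part 0 (tilde ip \<phi>) \<in> hom_ext_alg s V (*)"
      using K.Hom_0 by simp
    then show ?thesis
      unfolding K.hom_ext_alg_iff_arity_parts[of "tilde ip \<phi>"] tilde_arity_part[of \<phi>, OF \<phi>0]
      by (metis not0_implies_Suc)
  qed
  then show ?thesis
    unfolding CC_iff using C.hom_ext_alg_iff_arity_parts[of \<phi>] by blast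
qed

lemma arity_part_CC: "\<phi> \<in> CC s V ip \<Longrightarrow> arity_part k \<phi> \<in> CC s V ip"
  using CC_iff_arity_parts by blast

text \<open>By evenness, the form of the part of parity \<open>p\<close> is the form of
  \<open>\<phi>\<close> restricted to arguments of total parity \<open>p\<close>. Total parity does
  not depend on the order, so the restriction is still alternating.\<close>

lemma parity_part_CC:
  assumes \<phi>: "\<phi> \<in> CC s V ip"
  shows "parity_part V p \<phi> \<in> CC s V ip"
proof (rule CC_I[OF parity_part_in[OF CC_D(1)[OF \<phi>]]])
  let ?T = "\<lambda>zs. if par zs = p then tilde ip \<phi> (map snd zs) else 0"
  note alt = K.galt_hom_ext_alg[OF CC_D(3)[OF \<phi>]]
  show "K.galt ?T"
  proof (rule graded_altI, goal_cases)
    case (3 us ws p' q x y)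
    have "par (us @ (p', x) # (q, y) # ws) = par (us @ (q, y) # (p', x) # ws)" by (simp add: add_ac)
    then show ?case using graded_alt_swap[OF alt 3] by (simp add: add_ac)
  qed (use graded_alt_add[OF alt] graded_alt_scale[OF alt] in simp_all)
  fix zs assume zs: "tagged V zs"
  show "tilde ip (parity_part V p \<phi>) (map snd zs) = ?T zs"
  proof (cases zs rule: rev_cases)
    case Nil
    then show ?thesis
      using tilde_short C.hom_ext_alg_nil[OF CC_D(1)[OF \<phi>]]
        C.hom_ext_alg_nil[OF parity_part_in[OF CC_D(1)[OF \<phi>]]] by simp
  next
    case (snoc ys z)
    then have ys: "tagged V ys" "snd z \<in> V (fst z)" using zs by auto
    have "p + par ys = fst z \<longleftrightarrow> par ys + fst z = p"
      by (cases p; cases "par ys"; cases "fst z") auto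
    then show ?thesis
      by (simp add: snoc parity_part_tagged[OF CC_D(1)[OF \<phi>] ys(1)] ip_hproj[OF ys(2)])
  qed
qed

lemma component_CC: "\<phi> \<in> CC s V ip \<Longrightarrow> component k a \<phi> \<in> CC s V ip"
  unfolding component_def by (intro parity_part_CC arity_part_CC)

text \<open>If the last argument lies in the second block, it stays last in the form of
  \<open>\<phi>\<close>. If it lies in the first, the value \<open>y\<close> of
  \<open>\<psi>\<close> is rotated to the end of the form of \<open>\<phi>\<close>, the inner
  product is turned around by symmetry, and the value \<open>u\<close> of \<open>\<phi>\<close> is
  rotated from the end to the front in the form of \<open>\<psi>\<close>. The last argument is then
  last again.\<close>

lemma tilde_hbr:
  assumes \<phi>: "\<phi> \<in> CC s V ip" "has_arity (Suc r) \<phi>" "parities V (\<lambda>_. a) \<phi>"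
    and \<psi>: "\<psi> \<in> CC s V ip" "has_arity (Suc q) \<psi>" "parities V (\<lambda>_. b) \<psi>"
    and zs: "tagged V zs"
  shows "tilde ip (hbr r q a b \<phi> \<psi>) (map snd zs) =
    sg (of_nat r * b) (ins_tagged (\<lambda>_ _. 0) (tilde ip \<phi>) \<psi> zs)"
proof (cases zs rule: rev_cases)
  case Nil
  have "hbr r q a b \<phi> \<psi> [] = 0" by (rule C.hom_ext_alg_nil[OF hbr_in[OF CC_D(1)[OF \<phi>(1)] CC_D(1)[OF \<psi>(1)]]])
  then show ?thesis
    using tilde_short C.hom_ext_alg_nil[OF CC_D(1)[OF \<psi>(1)]] by (simp add: Nil ins_tagged_def tilde_def)
next
  case (snoc ys z)
  note \<phi>0 = CC_D(1)[OF \<phi>(1)] and \<psi>0 = CC_D(1)[OF \<psi>(1)]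
  obtain x v where z: "z = (x, v)" by (cases z)
  have ys: "tagged V ys" and v: "v \<in> V x" using zs by (auto simp: snoc z)
  have ip_circle: "ip (circle V \<alpha> \<beta> (map snd ys)) v = split_sum ys (\<lambda>A B. ip (\<alpha> (\<beta> (map snd A) # map snd B)) v)"
    if "\<alpha> \<in> Coch" "\<beta> \<in> Coch" for \<alpha> \<beta>
    unfolding C.circle_eq[OF that ys] ins_tagged_def sg_0
    by (rule split_sum_hom[where f = "\<lambda>u. ip u v"]) (rule ip_add)
  have "split_sum ys (\<lambda>A B. sg (xsg [z] B) (tilde ip \<phi> (\<psi> (map snd (A @ [z])) # map snd B))) =
    split_sum ys (\<lambda>A B. sg (a * b + of_nat r * of_nat q + 1) (sg (xsg A B) (ip (\<psi> (\<phi> (map snd B) # map snd A)) v)))"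
  proof (rule split_sum_cong_tagged[OF ys])
    fix A B :: "'v tagged_list" assume A: "tagged V A" and B: "tagged V B"
    show "sg (xsg [z] B) (tilde ip \<phi> (\<psi> (map snd (A @ [z])) # map snd B)) =
      sg (a * b + of_nat r * of_nat q + 1) (sg (xsg A B) (ip (\<psi> (\<phi> (map snd B) # map snd A)) v))"
    proof (cases "length A = q \<and> length B = Suc r")
      case len: True
      define y where "y = \<psi> (map snd A @ [v])"
      define u where "u = \<phi> (map snd B)"
      let ?ey = "b + par A + x" and ?eu = "a + par B"
      have y: "y \<in> V ?ey"
        using \<psi>(3)[unfolded parities_def, rule_format, of "A @ [z]"] A v
        by (simp add: y_def z add.assoc)
      have u: "u \<in> V ?eu"
        using \<phi>(3)[unfolded parities_def, rule_format, OF B] by (simp add: u_def)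
      note rot\<phi> = graded_alt_rotate[OF K.galt_hom_ext_alg[OF CC_D(3)[OF \<phi>(1)]], of "[]" "[]" B y ?ey]
      note rot\<psi> = graded_alt_rotate[OF K.galt_hom_ext_alg[OF CC_D(3)[OF \<psi>(1)]], of "[]" "[]" "A @ [z]" u ?eu]
      have "tilde ip \<phi> (y # map snd B) = sg (xsg [(?ey, y)] B) (ip u y)"
        using rot\<phi> B y by (simp add: u_def)
      also have "ip u y = sg (?eu * ?ey) (ip y u)" by (rule ip_sym[OF u y])
      also have "ip y u = sg (xsg [(?eu, u)] (A @ [z])) (ip (\<psi> (u # map snd A)) v)"
      proof -
        have "tilde ip \<psi> (u # map snd A @ [v]) = sg (xsg [(?eu, u)] (A @ [z])) (ip y u)"
          using rot\<psi> A u v tilde_snoc[of ip \<psi> "map snd A @ [v]" u] by (simp add: z y_def)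
        moreover have "tilde ip \<psi> (u # map snd A @ [v]) = ip (\<psi> (u # map snd A)) v"
          using tilde_snoc[of ip \<psi> "u # map snd A" v] by simp
        ultimately show ?thesis by (simp add: bit_self)
      qed
      finally have "tilde ip \<phi> (y # map snd B) = sg (xsg [(?ey, y)] B)
        (sg (?eu * ?ey) (sg (xsg [(?eu, u)] (A @ [z])) (ip (\<psi> (u # map snd A)) v)))" .
      then show ?thesis using len
        by (simp add: z xsg_def bit_ring flip: y_def u_def)
    next
      case False
      then have "length A \<noteq> q \<or> length B \<noteq> Suc r" by simp
      then have "tilde ip \<phi> (\<psi> (map snd (A @ [z])) # map snd B) = 0"
      proof
        assume "length A \<noteq> q"
        then show ?thesis
          using has_arityD[OF \<psi>(2), of "map snd (A @ [z])"] K.hom_ext_alg_zero_arg[OF CC_D(3)[OF \<phi>(1)], of "[]"]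
          by simp
      next
        assume "length B \<noteq> Suc r"
        then show ?thesis
          using has_arityD[OF \<phi>(2)] by (simp add: tilde_def)
      qed
      moreover have "\<psi> (\<phi> (map snd B) # map snd A) = 0"
        using \<open>length A \<noteq> q \<or> length B \<noteq> Suc r\<close> has_arityD[OF \<psi>(2)] has_arityD[OF \<phi>(2)]
          C.hom_ext_alg_zero_arg[OF \<psi>0, of "[]"] by auto
      ultimately show ?thesis by simp
    qed
  qed
  \<comment> \<open>The remaining sign \<open>xsg A B\<close> is that of cocommutativity, so
    renaming the blocks gives the composition of \<open>\<psi>\<close> with
    \<open>\<phi>\<close>.\<close>
  also have "\<dots> = sg (a * b + of_nat r * of_nat q + 1) (ip (circle V \<psi> \<phi> (map snd ys)) v)"
    unfolding split_sum_sg ip_circle[OF \<psi>0 \<phi>0]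
    by (subst (2) split_sum_comm) (rule refl)
  finally have second: "split_sum ys (\<lambda>A B. sg (xsg [z] B) (tilde ip \<phi> (\<psi> (map snd (A @ [z])) # map snd B))) = \<dots>" .
  have first: "split_sum ys (\<lambda>A B. tilde ip \<phi> (\<psi> (map snd A) # map snd (B @ [z]))) = ip (circle V \<phi> \<psi> (map snd ys)) v"
    unfolding ip_circle[OF \<phi>0 \<psi>0]
    using tilde_snoc[of ip \<phi> "_ # map snd _" v] by (intro split_sum_cong) (simp add: z)
  have "ins_tagged (\<lambda>_ _. 0) (tilde ip \<phi>) \<psi> zs = ip (circle V \<phi> \<psi> (map snd ys)) v -
      sg (a * b + of_nat r * of_nat q) (ip (circle V \<psi> \<phi> (map snd ys)) v)"
    unfolding snoc ins_tagged_def sg_0 split_sum_snoc first second by (simp add: minus_sg[symmetric])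
  then show ?thesis
    by (simp add: snoc z hbr_def ip_sg ip_diff)
qed

lemma hbr_CC:
  assumes \<phi>: "\<phi> \<in> CC s V ip" "has_arity (Suc r) \<phi>" "parities V (\<lambda>_. a) \<phi>"
    and \<psi>: "\<psi> \<in> CC s V ip" "has_arity (Suc q) \<psi>" "parities V (\<lambda>_. b) \<psi>"
  shows "hbr r q a b \<phi> \<psi> \<in> CC s V ip"
proof (rule CC_I[OF hbr_in[OF CC_D(1)[OF \<phi>(1)] CC_D(1)[OF \<psi>(1)]] _ tilde_hbr[OF \<phi> \<psi>]])
  show "K.galt (\<lambda>zs. sg (of_nat r * b) (ins_tagged (\<lambda>_ _. 0) (tilde ip \<phi>) \<psi> zs))"
    using graded_alt_sg[OF K.W.module_axioms K.galt_ins_tagged[OF CC_D(3)[OF \<phi>(1)] CC_D(1)[OF \<psi>(1)]],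
        of "\<lambda>_ _. of_nat r * b"] .
qed

lemma hbr_component_CC:
  assumes "\<phi> \<in> CC s V ip" "\<psi> \<in> CC s V ip" "k \<ge> 1" "j \<ge> 1"
  shows "hbr (k - 1) (j - 1) a b (component k a \<phi>) (component j b \<psi>) \<in> CC s V ip"
proof -
  have "k = Suc (k - 1)" "j = Suc (j - 1)" using assms(3,4) by simp_all
  then have "has_arity (Suc (k - 1)) (component k a \<phi>)" "has_arity (Suc (j - 1)) (component j b \<psi>)"
    using has_arity_component by metis+
  then show ?thesis
    by (rule hbr_CC[OF component_CC[OF assms(1)] _ parities_component[OF CC_D(1)[OF assms(1)]]
          component_CC[OF assms(2)] _ parities_component[OF CC_D(1)[OF assms(2)]]])
qed

text \<open>Tested arity by arity, because there the bracket is a finite sum of homogeneous brackets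
  of components, and the components of cyclic elements are cyclic.\<close>

lemma bracket_CC:
  assumes "\<phi> \<in> CC s V ip" "\<psi> \<in> CC s V ip"
  shows "bracket s V \<phi> \<psi> \<in> CC s V ip"
proof -
  have "(case kj of (k, j) \<Rightarrow> \<Sum>a\<in>{0, 1}. \<Sum>b\<in>{0, 1}.
      hbr (k - 1) (j - 1) a b (component k a \<phi>) (component j b \<psi>)) \<in> CC s V ip"
    if "kj \<in> arity_pairs m" for kj m
    using that hbr_component_CC[OF assms] by (auto simp only: arity_pairs_def intro!: CC_sum)
  then have "arity_part n (bracket s V \<phi> \<psi>) \<in> CC s V ip" for n
    unfolding arity_part_bracket[OF assms[THEN CC_D(1)]] by (rule CC_sum)
  then show ?thesis using CC_iff_arity_parts by blast
qed

text \<open>The parity \<open>c j\<close> of \<open>\<psi>\<close> may vary with the arity, as it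
  does for an L_infinity structure. \<open>\<phi>\<close> may be inhomogeneous because the sign
  involves only its arity and the parity of \<open>\<psi>\<close>.\<close>

lemma tilde_bracket:
  assumes \<phi>: "\<phi> \<in> CC s V ip" and \<psi>: "\<psi> \<in> CC s V ip"
    and c: "\<And>j. j \<ge> 1 \<Longrightarrow> has_parity V V (c j) (arity_part j \<psi>)" and zs: "tagged V zs"
  shows "tilde ip (bracket s V \<phi> \<psi>) (map snd zs) = (\<Sum>(k, j)\<in>arity_pairs (length zs).
    psgn (of_nat (k - 1) * c j) * insertion (*) (map fst zs) j k (tilde ip \<phi>) \<psi> (map snd zs))"
proof (cases "zs = []")
  case True
  have "arity_pairs 0 = {}" by (auto simp: arity_pairs_def)
  then show ?thesis
    using True tilde_short C.hom_ext_alg_nil[OF CC_D(1)[OF bracket_CC[OF \<phi> \<psi>]]] by simp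
next
  case False
  note \<phi>0 = CC_D(1)[OF \<phi>] and \<psi>0 = CC_D(1)[OF \<psi>]
  let ?xs = "map snd zs" and ?n = "length zs"
  have n: "?n - 1 + 1 = ?n" using False by (simp add: Suc_leI)
  have tilde_sum: "tilde ip (sum f I) ys = (\<Sum>i\<in>I. tilde ip (f i) ys)" for f :: "'i \<Rightarrow> 'v list \<Rightarrow> 'v" and I ys
    unfolding tilde_def sum_fun_apply
    by (induction I rule: infinite_finite_induct) (simp_all add: ip_add)
  have "tilde ip (bracket s V \<phi> \<psi>) ?xs = tilde ip (arity_part (?n - 1) (bracket s V \<phi> \<psi>)) ?xs"
    using False by (simp add: tilde_def arity_part_def)
  also have "\<dots> = (\<Sum>(k, j)\<in>arity_pairs ?n. \<Sum>a\<in>{0, 1}. \<Sum>b\<in>{0, 1}.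
    tilde ip (hbr (k - 1) (j - 1) a b (component k a \<phi>) (component j b \<psi>)) ?xs)"
    unfolding arity_part_bracket[OF \<phi>0 \<psi>0] n
    by (simp only: tilde_sum case_prod_unfold)
  also have "\<dots> = (\<Sum>(k, j)\<in>arity_pairs ?n.
    psgn (of_nat (k - 1) * c j) * insertion (*) (map fst zs) j k (tilde ip \<phi>) \<psi> ?xs)"
  proof (intro sum.cong refl, clarify)
    fix k j assume "(k, j) \<in> arity_pairs ?n"
    then have kj: "k \<ge> 1" "j \<ge> 1" "?n = j + k" by (auto simp: arity_pairs_def)
    \<comment> \<open>Only the component of parity \<open>c j\<close> survives, and it is the whole
      arity part.\<close>
    have comp_j: "component j b \<psi> = (if b = c j then arity_part j \<psi> else 0)" for b
      unfolding component_def using c[OF kj(2)]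
      by (intro parity_part_parities arity_part_in \<psi>0) (simp add: parities_iff_has_parity)
    have "tilde ip (hbr (k - 1) (j - 1) a b (component k a \<phi>) (component j b \<psi>)) ?xs =
      sg (of_nat (k - 1) * b) (ins_tagged (\<lambda>_ _. 0) (tilde ip (component k a \<phi>)) (component j b \<psi>) zs)" for a b
    proof (rule tilde_hbr[OF component_CC[OF \<phi>] _ parities_component[OF \<phi>0]
          component_CC[OF \<psi>] _ parities_component[OF \<psi>0] zs])
      show "has_arity (Suc (k - 1)) (component k a \<phi>)" "has_arity (Suc (j - 1)) (component j b \<psi>)"
        using kj has_arity_component[of k a \<phi>] has_arity_component[of j b \<psi>] by simp_all
    qed
    moreover have "ins_tagged (\<lambda>_ _. 0) (tilde ip (component k a \<phi>)) 0 zs = 0" for a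
      using K.hom_ext_alg_zero_arg[OF CC_D(3)[OF component_CC[OF \<phi>]], where us = "[]"] by (simp add: ins_tagged_def)
    ultimately have "(\<Sum>a\<in>{0, 1}. \<Sum>b\<in>{0, 1}.
        tilde ip (hbr (k - 1) (j - 1) a b (component k a \<phi>) (component j b \<psi>)) ?xs) =
      (\<Sum>a\<in>{0, 1}. sg (of_nat (k - 1) * c j) (ins_tagged (\<lambda>_ _. 0) (tilde ip (component k a \<phi>)) (arity_part j \<psi>) zs))"
      by (cases "c j") (simp_all add: comp_j)
    \<comment> \<open>The sign is independent of \<open>a\<close>, so the even and the odd part of
      \<open>\<phi>\<close> recombine.\<close>
    also have "\<dots> = sg (of_nat (k - 1) * c j) (ins_tagged (\<lambda>_ _. 0) (tilde ip (arity_part k \<phi>)) (arity_part j \<psi>) zs)"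
      by (simp add: component_sum[OF \<phi>0, symmetric] tilde_add ins_tagged_add_left sg_add)
    also have "ins_tagged (\<lambda>_ _. 0) (tilde ip (arity_part k \<phi>)) (arity_part j \<psi>) zs =
        split_sum zs (\<lambda>A B. if length A = j then tilde ip \<phi> (\<psi> (map snd A) # map snd B) else 0)"
      unfolding ins_tagged_def
    proof (rule split_sum_cong)
      fix A B :: "'v tagged_list" assume "length A + length B = length zs"
      then have "length A = j \<Longrightarrow> length B = k" using kj by simp
      then show "sg 0 (tilde ip (arity_part k \<phi>) (arity_part j \<psi> (map snd A) # map snd B)) =
          (if length A = j then tilde ip \<phi> (\<psi> (map snd A) # map snd B) else 0)"
      proof (cases "length A = j")
        case True
        then show ?thesis
          using \<open>length A = j \<Longrightarrow> length B = k\<close> kj by (auto simp: tilde_def arity_part_def)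
      next
        case False
        then have "arity_part j \<psi> (map snd A) = 0" by (simp add: arity_part_def)
        then show ?thesis
          using K.hom_ext_alg_zero_arg[OF CC_D(3)[OF arity_part_CC[OF \<phi>]], where us = "[]"] False by simp
      qed
    qed
    also have "\<dots> = insertion (*) (map fst zs) j k (tilde ip \<phi>) \<psi> ?xs"
      by (rule K.W.insertion_eq_split_sum[OF kj(3), symmetric])
    finally show "(\<Sum>a\<in>{0, 1}. \<Sum>b\<in>{0, 1}.
        tilde ip (hbr (k - 1) (j - 1) a b (component k a \<phi>) (component j b \<psi>)) ?xs) =
      psgn (of_nat (k - 1) * c j) * insertion (*) (map fst zs) j k (tilde ip \<phi>) \<psi> ?xs"
      by (simp only: psgn_mult)
  qed
  finally show ?thesis .
qed

end


section \<open>Graded Lie algebra structure\<close>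

lemma split_sum_in:
  assumes "\<And>x y. x \<in> S \<Longrightarrow> y \<in> S \<Longrightarrow> x + y \<in> S" "\<And>e x. x \<in> S \<Longrightarrow> sg e x \<in> S"
    and "\<And>A B. tagged V A \<Longrightarrow> tagged V B \<Longrightarrow> par A + par B = par zs \<Longrightarrow> G A B \<in> S" "tagged V zs"
  shows "split_sum zs G \<in> S"
  using assms(3,4)
proof (induction zs arbitrary: G)
  case (Cons z zs)
  have "split_sum zs (\<lambda>A B. G (z # A) B) \<in> S"
    using Cons.prems by (intro Cons.IH Cons.prems(1)) (auto simp: add_ac)
  moreover have "split_sum zs (\<lambda>A B. sg (xsg [z] A) (G A (z # B))) \<in> S"
    using Cons.prems by (intro Cons.IH assms(2) Cons.prems(1)) (auto simp: add_ac)
  ultimately show ?case by (simp add: assms(1))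
qed simp

lemma circle_add_left: "circle V (\<phi> + \<phi>') \<psi> = circle V \<phi> \<psi> + circle V \<phi>' \<psi>"
  by (simp add: circle_def ins_add_left)

text \<open>The \<open>l\<close> are the triple compositions nested to the left and the
  \<open>p\<close> those nested to the right, starting with \<open>l1 = (\<phi>\<psi>)\<chi>\<close>
  and \<open>p1 = \<phi>(\<psi>\<chi>)\<close>; \<open>a\<close>, \<open>b\<close>, \<open>c\<close>
  are parities and \<open>r\<close>, \<open>q\<close>, \<open>t\<close> degrees. The premises are
  the pre-Lie identities with each of the three maps outermost. They eliminate \<open>l1\<close>,
  \<open>l3\<close>, \<open>l5\<close>, and the remaining terms match for each of the 64 choices of
  exponents.\<close>

lemma jacobi_signs:
  fixes l1 :: "'a::ab_group_add" and a b c r q t :: bit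
  assumes "l1 - p1 = sg (b * c + q * t) (l2 - p2)"
    and "l3 - p3 = sg (a * c + r * t) (l4 - p4)"
    and "l5 - p5 = sg (a * b + r * q) (l6 - p6)"
  shows "sg (r * (b + c)) (sg (q * c) (p1 - sg (b * c + q * t) p2) -
        sg (a * (b + c) + r * (q + t)) (sg (q * c) (l4 - sg (b * c + q * t) l6))) =
      sg ((r + q) * c) (sg (r * b) (l1 - sg (a * b + r * q) l3) -
        sg ((a + b) * c + (r + q) * t) (sg (r * b) (p5 - sg (a * b + r * q) p6))) +
      sg ((a + r) * (b + q)) (sg (q * (a + c)) (sg (r * c) (p3 - sg (a * c + r * t) p4) -
        sg (b * (a + c) + q * (r + t)) (sg (r * c) (l2 - sg (a * c + r * t) l5))))"
proof -
  have l: "l1 = p1 + sg (b * c + q * t) (l2 - p2)" "l3 = p3 + sg (a * c + r * t) (l4 - p4)"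
    "l5 = p5 + sg (a * b + r * q) (l6 - p6)"
    using assms by (simp_all add: diff_eq_eq add.commute)
  show ?thesis
    unfolding l by (cases a; cases b; cases c; cases r; cases q; cases t) (simp_all add: algebra_simps)
qed

section \<open>Bilinearity and homogeneous identities of the bracket\<close>

context super_module
begin

lemma circle_scale_left: "circle V (pointwise_scale s c \<phi>) \<psi> = pointwise_scale s c (circle V \<phi> \<psi>)"
  by (simp add: circle_def ins_scale_left)

lemma circle_add_right:
  assumes "\<phi> \<in> Coch"
  shows "circle V \<phi> (\<psi> + \<psi>') = circle V \<phi> \<psi> + circle V \<phi> \<psi>'"
proof -
  have eq: "ins_tagged (\<lambda>_ _. 0) \<phi> (\<psi> + \<psi>') = (\<lambda>zs. ins_tagged (\<lambda>_ _. 0) \<phi> \<psi> zs + ins_tagged (\<lambda>_ _. 0) \<phi> \<psi>' zs)"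
    using C.hom_ext_alg_add[OF assms, of "[]"] by (simp add: fun_eq_iff ins_tagged_def split_sum_add)
  show ?thesis unfolding circle_def ins_def eq by (simp add: fun_eq_iff hext_add)
qed

lemma circle_scale_right:
  assumes "\<phi> \<in> Coch"
  shows "circle V \<phi> (pointwise_scale s c \<psi>) = pointwise_scale s c (circle V \<phi> \<psi>)"
proof -
  have eq: "ins_tagged (\<lambda>_ _. 0) \<phi> (pointwise_scale s c \<psi>) = (\<lambda>zs. s c (ins_tagged (\<lambda>_ _. 0) \<phi> \<psi> zs))"
    using C.hom_ext_alg_scale[OF assms, of "[]"]
    by (simp add: fun_eq_iff ins_tagged_def pointwise_scale_def split_sum_hom[where f = "s c", OF scale_right_distrib])
  show ?thesis
    unfolding circle_def ins_def eq
    by (simp add: fun_eq_iff pointwise_scale_def hext_hom[where f = "s c", OF scale_right_distrib])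
qed

lemma hbr_eq: "hbr r q a b \<phi> \<psi> = pointwise_scale s (psgn (of_nat r * b)) (circle V \<phi> \<psi> -
    pointwise_scale s (psgn (a * b + of_nat r * of_nat q)) (circle V \<psi> \<phi>))"
  by (simp add: fun_eq_iff hbr_def pointwise_scale_def scale_psgn)

lemma circle_diff_left: "circle V (\<phi> - \<phi>') \<psi> = circle V \<phi> \<psi> - circle V \<phi>' (\<psi> :: 'v list \<Rightarrow> 'v)"
  using circle_add_left[of V "\<phi> - \<phi>'" \<phi>' \<psi>] by (simp add: eq_diff_eq)

lemma circle_diff_right:
  "\<phi> \<in> Coch \<Longrightarrow> circle V \<phi> (\<psi> - \<psi>') = circle V \<phi> \<psi> - circle V \<phi> \<psi>'"
  using circle_add_right[of \<phi> "\<psi> - \<psi>'" \<psi>'] by (simp add: eq_diff_eq)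

lemma circle_hbr_right:
  "\<phi> \<in> Coch \<Longrightarrow> circle V \<phi> (hbr r q a b \<psi> \<chi>) xs = sg (of_nat r * b)
    (circle V \<phi> (circle V \<psi> \<chi>) xs - sg (a * b + of_nat r * of_nat q) (circle V \<phi> (circle V \<chi> \<psi>) xs))"
  by (simp add: hbr_eq circle_scale_right circle_diff_right) (simp add: pointwise_scale_def scale_psgn)

lemma circle_hbr_left:
  "circle V (hbr r q a b \<psi> \<chi>) \<phi> xs = sg (of_nat r * b)
    (circle V (circle V \<psi> \<chi>) \<phi> xs - sg (a * b + of_nat r * of_nat q) (circle V (circle V \<chi> \<psi>) \<phi> xs))"
  by (simp add: hbr_eq circle_scale_left circle_diff_left) (simp add: pointwise_scale_def scale_psgn)

lemma hbr_add_right: "\<phi> \<in> Coch \<Longrightarrow> hbr r q a b \<phi> (\<psi> + \<psi>') = hbr r q a b \<phi> \<psi> + hbr r q a b \<phi> \<psi>'"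
  by (simp add: fun_eq_iff hbr_def circle_add_right circle_add_left sg_add sg_diff)

lemma hbr_add_left: "\<phi> \<in> Coch \<Longrightarrow> hbr r q a b (\<psi> + \<psi>') \<phi> = hbr r q a b \<psi> \<phi> + hbr r q a b \<psi>' \<phi>"
  by (simp add: fun_eq_iff hbr_def circle_add_right circle_add_left sg_add sg_diff)

lemma hbr_scale_right: "\<phi> \<in> Coch \<Longrightarrow>
    hbr r q a b \<phi> (pointwise_scale s c \<psi>) = pointwise_scale s c (hbr r q a b \<phi> \<psi>)"
  by (simp add: fun_eq_iff hbr_def circle_scale_right circle_scale_left)
    (simp add: pointwise_scale_def scale_sg scale_right_diff_distrib hbr_def)

lemma hbr_scale_left: "\<phi> \<in> Coch \<Longrightarrow>
    hbr r q a b (pointwise_scale s c \<psi>) \<phi> = pointwise_scale s c (hbr r q a b \<psi> \<phi>)"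
  by (simp add: fun_eq_iff hbr_def circle_scale_right circle_scale_left)
    (simp add: pointwise_scale_def scale_sg scale_right_diff_distrib hbr_def)

lemma bracket_add_right:
  assumes "\<phi> \<in> Coch" "\<psi> \<in> Coch" "\<psi>' \<in> Coch"
  shows "bracket s V \<phi> (\<psi> + \<psi>') = bracket s V \<phi> \<psi> + bracket s V \<phi> \<psi>'"
  by (simp only: fun_eq_iff plus_fun_apply bracket_eq_sum assms C.Hom_add C.Hom_scale component_add hbr_add_right
      component_in sum.distrib case_prod_unfold simp_thms)

lemma bracket_add_left:
  assumes "\<phi> \<in> Coch" "\<psi> \<in> Coch" "\<psi>' \<in> Coch"
  shows "bracket s V (\<psi> + \<psi>') \<phi> = bracket s V \<psi> \<phi> + bracket s V \<psi>' \<phi>"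
  by (simp only: fun_eq_iff plus_fun_apply bracket_eq_sum assms C.Hom_add C.Hom_scale component_add hbr_add_left
      component_in sum.distrib case_prod_unfold simp_thms)

lemma bracket_scale_right:
  assumes "\<phi> \<in> Coch" "\<psi> \<in> Coch"
  shows "bracket s V \<phi> (pointwise_scale s c \<psi>) = pointwise_scale s c (bracket s V \<phi> \<psi>)"
  by (simp only: fun_eq_iff bracket_eq_sum assms C.Hom_add C.Hom_scale component_scale hbr_scale_right
      component_in simp_thms)
    (simp only: pointwise_scale_def scale_sum_right case_prod_unfold bracket_eq_sum assms simp_thms)

lemma bracket_scale_left:
  assumes "\<phi> \<in> Coch" "\<psi> \<in> Coch"
  shows "bracket s V (pointwise_scale s c \<psi>) \<phi> = pointwise_scale s c (bracket s V \<psi> \<phi>)"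
  by (simp only: fun_eq_iff bracket_eq_sum assms C.Hom_add C.Hom_scale component_scale hbr_scale_left
      component_in simp_thms)
    (simp only: pointwise_scale_def scale_sum_right case_prod_unfold bracket_eq_sum assms simp_thms)

lemma bracket_zero:
  assumes "\<phi> \<in> Coch"
  shows "bracket s V \<phi> 0 = 0" "bracket s V 0 \<phi> = 0"
  using bracket_scale_right[OF assms assms, of 0] bracket_scale_left[OF assms assms, of 0]
  by (simp_all add: pointwise_scale_def zero_fun_def)

text \<open>As \<open>k + j = length xs + 1\<close> with both summands positive, only components of
  arity at most \<open>length xs\<close> enter. This is what permits truncation in
  \<open>bracket_derivation\<close>.\<close>

lemma bracket_cong:
  assumes "\<And>xs. length xs \<le> N \<Longrightarrow> \<phi> xs = \<phi>' xs" "\<And>xs. length xs \<le> N \<Longrightarrow> \<psi> xs = \<psi>' xs" "length xs \<le> N"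
  shows "bracket s V \<phi> \<psi> xs = bracket s V \<phi>' \<psi>' xs"
  unfolding bracket_def
proof (rule sum.cong[OF refl], clarify)
  fix k j assume "(k, j) \<in> arity_pairs (length xs + 1)"
  then have "k \<le> N" "j \<le> N" using assms(3) by (auto simp: arity_pairs_def)
  then have "arity_part k \<phi> = arity_part k \<phi>'" "arity_part j \<psi> = arity_part j \<psi>'"
    using assms(1,2) by (auto simp: arity_part_def fun_eq_iff)
  then show "(\<Sum>a\<in>{0, 1}. \<Sum>b\<in>{0, 1}. homog_bracket s V k j a b
      (parity_part V a (arity_part k \<phi>)) (parity_part V b (arity_part j \<psi>)) xs) =
    (\<Sum>a\<in>{0, 1}. \<Sum>b\<in>{0, 1}. homog_bracket s V k j a b
      (parity_part V a (arity_part k \<phi>')) (parity_part V b (arity_part j \<psi>')) xs)" by simp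
qed

lemma parities_circle:
  assumes "\<phi> \<in> Coch" "parities V (\<lambda>_. a) \<phi>" "\<psi> \<in> Coch" "parities V (\<lambda>_. b) \<psi>"
  shows "parities V (\<lambda>_. a + b) (circle V \<phi> \<psi>)"
  unfolding parities_def
proof (intro allI impI)
  fix zs assume zs: "tagged V zs"
  have sg_in: "sg e x \<in> V p" if "x \<in> V p" for e x p
    using subspace_scale[OF subspace_part that, of "psgn e"] by (simp add: scale_psgn)
  have "split_sum zs (\<lambda>A B. \<phi> (\<psi> (map snd A) # map snd B)) \<in> V (a + b + par zs)"
  proof (rule split_sum_in[OF subspace_add[OF subspace_part] sg_in _ zs])
    fix A B :: "'v tagged_list" assume h: "tagged V A" "tagged V B" "par A + par B = par zs"
    then have "tagged V ((b + par A, \<psi> (map snd A)) # B)" using assms(4) by (simp add: parities_def)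
    then have "\<phi> (map snd ((b + par A, \<psi> (map snd A)) # B)) \<in> V (a + par ((b + par A, \<psi> (map snd A)) # B))"
      using assms(2) unfolding parities_def by blast
    then show "\<phi> (\<psi> (map snd A) # map snd B) \<in> V (a + b + par zs)"
      by (simp add: h(3)[symmetric] add_ac)
  qed
  then show "circle V \<phi> \<psi> (map snd zs) \<in> V (a + b + par zs)"
    by (simp add: C.circle_eq[OF assms(1,3) zs] ins_tagged_def)
qed

lemma parities_hbr:
  assumes "\<phi> \<in> Coch" "parities V (\<lambda>_. a) \<phi>" "\<psi> \<in> Coch" "parities V (\<lambda>_. b) \<psi>"
  shows "parities V (\<lambda>_. a + b) (hbr r q a b \<phi> \<psi>)"
proof -
  have "circle V \<phi> \<psi> (map snd zs) \<in> V (a + b + par zs)" "circle V \<psi> \<phi> (map snd zs) \<in> V (a + b + par zs)"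
    if "tagged V zs" for zs
    using that parities_circle[OF assms] parities_circle[OF assms(3,4,1,2)]
    by (simp_all add: parities_def add.commute)
  then show ?thesis
    unfolding parities_def hbr_def
    by (simp add: subspace_diff[OF subspace_part] subspace_scale[OF subspace_part] flip: scale_psgn)
qed

text \<open>The prefactors of the two brackets contribute \<open>r * b\<close> and
  \<open>q * a\<close>. With the exponent \<open>a * b + r * q\<close> of the commutator they add up
  to \<open>(a + r) * (b + q)\<close>, the form on the bidegrees.\<close>

lemma hbr_antisym:
  "hbr r q a b \<phi> \<psi> = - pointwise_scale s (psgn ((a + of_nat r) * (b + of_nat q))) (hbr q r b a \<psi> \<phi>)"
proof -
  have "sg (r' * b) (x - sg (a * b + r' * q') y) =
      - sg ((a + r') * (b + q')) (sg (q' * a) (y - sg (b * a + q' * r') x))" for x y :: 'v and r' q'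
    by (cases a; cases b; cases r'; cases q') simp_all
  then show ?thesis by (simp add: fun_eq_iff hbr_def pointwise_scale_def scale_psgn)
qed

lemma hbr_jacobi:
  assumes \<phi>: "\<phi> \<in> Coch" "parities V (\<lambda>_. a) \<phi>" "has_arity (Suc r) \<phi>"
    and \<psi>: "\<psi> \<in> Coch" "parities V (\<lambda>_. b) \<psi>" "has_arity (Suc q) \<psi>"
    and \<chi>: "\<chi> \<in> Coch" "parities V (\<lambda>_. c) \<chi>" "has_arity (Suc t) \<chi>"
  shows "hbr r (q + t) a (b + c) \<phi> (hbr q t b c \<psi> \<chi>) = hbr (r + q) t (a + b) c (hbr r q a b \<phi> \<psi>) \<chi> +
    pointwise_scale s (psgn ((a + of_nat r) * (b + of_nat q)))
      (hbr q (r + t) b (a + c) \<psi> (hbr r t a c \<phi> \<chi>))"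
proof
  fix xs
  show "hbr r (q + t) a (b + c) \<phi> (hbr q t b c \<psi> \<chi>) xs = (hbr (r + q) t (a + b) c (hbr r q a b \<phi> \<psi>) \<chi> +
    pointwise_scale s (psgn ((a + of_nat r) * (b + of_nat q)))
      (hbr q (r + t) b (a + c) \<psi> (hbr r t a c \<phi> \<chi>))) xs"
    unfolding plus_fun_apply pointwise_scale_def scale_psgn hbr_def[of _ _ _ _ _ "hbr _ _ _ _ _ _"]
      hbr_def[of _ _ _ _ "hbr _ _ _ _ _ _"] circle_hbr_left
      circle_hbr_right[OF \<phi>(1)] circle_hbr_right[OF \<psi>(1)] circle_hbr_right[OF \<chi>(1)] of_nat_add
  proof (rule jacobi_signs)
    show "circle V (circle V \<phi> \<psi>) \<chi> xs - circle V \<phi> (circle V \<psi> \<chi>) xs =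
      sg (b * c + of_nat q * of_nat t) (circle V (circle V \<phi> \<chi>) \<psi> xs - circle V \<phi> (circle V \<chi> \<psi>) xs)"
      by (rule C.pre_Lie[OF \<phi>(1) \<psi> \<chi>])
    show "circle V (circle V \<psi> \<phi>) \<chi> xs - circle V \<psi> (circle V \<phi> \<chi>) xs =
      sg (a * c + of_nat r * of_nat t) (circle V (circle V \<psi> \<chi>) \<phi> xs - circle V \<psi> (circle V \<chi> \<phi>) xs)"
      by (rule C.pre_Lie[OF \<psi>(1) \<phi> \<chi>])
    show "circle V (circle V \<chi> \<phi>) \<psi> xs - circle V \<chi> (circle V \<phi> \<psi>) xs =
      sg (a * b + of_nat r * of_nat q) (circle V (circle V \<chi> \<psi>) \<phi> xs - circle V \<chi> (circle V \<psi> \<phi>) xs)"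
      by (rule C.pre_Lie[OF \<chi>(1) \<phi> \<psi>])
  qed
qed

end


section \<open>The graded Lie algebra of cyclic elements and its derivations\<close>

context inner_product_maps
begin

text \<open>Degrees are integers while arities are natural numbers. In negative degree at most the
  empty list is left, on which a cochain is 0; every other degree is \<open>int n\<close> with arity
  \<open>Suc n\<close>.\<close>

lemma CC_part_cases:
  assumes "\<phi> \<in> CC_part s V ip g"
  obtains "\<phi> = 0" | a n where "g = (a, int n)" "\<phi> \<in> CC s V ip" "has_arity (Suc n) \<phi>" "parities V (\<lambda>_. a) \<phi>"
proof -
  obtain a r where g: "g = (a, r)" by (cases g)
  have \<phi>: "\<phi> \<in> CC s V ip" "parities V (\<lambda>_. a) \<phi>" "\<And>xs. int (length xs) \<noteq> r + 1 \<Longrightarrow> \<phi> xs = 0"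
    using assms by (auto simp: CC_part_def g parities_iff_has_parity)
  show ?thesis
  proof (cases "r < 0")
    case True
    have "\<phi> xs = 0" for xs
      using \<phi>(3)[of xs] C.hom_ext_alg_nil[OF CC_D(1)[OF \<phi>(1)]] True by (cases xs) auto
    then show ?thesis by (intro that(1)) (simp add: fun_eq_iff)
  next
    case False
    then have "g = (a, int (nat r))" by (simp add: g)
    moreover have "has_arity (Suc (nat r)) \<phi>" using \<phi>(3) False by (auto simp: has_arity_def)
    ultimately show ?thesis using \<phi>(1,2) by (intro that(2))
  qed
qed

lemma CC_part_I:
  "\<phi> \<in> CC s V ip \<Longrightarrow> has_arity (Suc n) \<phi> \<Longrightarrow> parities V (\<lambda>_. a) \<phi> \<Longrightarrow> \<phi> \<in> CC_part s V ip (a, int n)"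
  by (auto simp: CC_part_def has_arity_def parities_iff_has_parity)

lemma CC_part_subset: "CC_part s V ip g \<subseteq> CC s V ip"
  by (auto simp: CC_part_def split: prod.splits)

lemma subspace_CC_part: "module.subspace (pointwise_scale s) (CC_part s V ip g)"
proof -
  obtain a r where g: "g = (a, r)" by (cases g)
  have add: "x + y \<in> V p" if "x \<in> V p" "y \<in> V p" for x y p
    using that by (rule subspace_add[OF subspace_part])
  have scale: "s c x \<in> V p" if "x \<in> V p" for c x p
    using that by (rule subspace_scale[OF subspace_part])
  show ?thesis
    using CC_0 CC_add CC_scale
    unfolding module.subspace_def[OF C.module_pointwise] g CC_part_def has_parity_iff_tagged
    by (auto simp: pointwise_scale_def add scale)
qed

lemma CC_part_0 [simp]: "0 \<in> CC_part s V ip g"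
  by (rule module.subspace_0[OF C.module_pointwise subspace_CC_part])

lemma component_CC_part: "\<phi> \<in> CC s V ip \<Longrightarrow> component (Suc n) a \<phi> \<in> CC_part s V ip (a, int n)"
  by (intro CC_part_I component_CC has_arity_component parities_component CC_D(1))

lemma eq_componentsI:
  assumes "\<phi> \<in> CC s V ip" "\<psi> \<in> CC s V ip" "\<And>n a. component (Suc n) a \<phi> = component (Suc n) a \<psi>"
  shows "\<phi> = \<psi>"
proof
  fix xs
  show "\<phi> xs = \<psi> xs"
  proof (cases xs)
    case Nil
    then show ?thesis using assms(1,2)[THEN CC_D(1), THEN C.hom_ext_alg_nil] by simp
  next
    case (Cons x ys)
    have "arity_part (length xs) \<phi> = arity_part (length xs) \<psi>"
      using component_sum[OF CC_D(1)[OF assms(1)], of "length xs"]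
        component_sum[OF CC_D(1)[OF assms(2)], of "length xs"] assms(3) Cons by simp
    then show ?thesis by (metis arity_part_def)
  qed
qed

lemma product_graded_CC: "product_graded (pointwise_scale s) (CC s V ip) (CC_part s V ip)"
proof -
  define \<pi> where "\<pi> g \<phi> = (if snd g \<ge> 0 then component (Suc (nat (snd g))) (fst g) \<phi> else 0)"
    for g :: "bit \<times> int" and \<phi>
  have \<pi>_nat: "\<pi> (a, int n) \<phi> = component (Suc n) a \<phi>" for a n \<phi> by (simp add: \<pi>_def)
  have \<pi>_in: "\<pi> g \<phi> \<in> CC_part s V ip g" if "\<phi> \<in> CC s V ip" for g \<phi>
    using component_CC_part[OF that, of "nat (snd g)" "fst g"] by (cases g) (auto simp: \<pi>_def)
  have neg: "\<phi> = 0" if "\<phi> \<in> CC_part s V ip g" "snd g < 0" for \<phi> g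
    using that by (cases rule: CC_part_cases) auto
  have homog: "\<pi> h x = (if h = g then x else 0)" if x: "x \<in> CC_part s V ip g" for g h x
    using x
  proof (cases rule: CC_part_cases)
    case 1
    have "component k a 0 = 0" for k a using component_add[of k a 0 0] by simp
    then show ?thesis using 1 by (simp add: \<pi>_def)
  next
    case (2 a n)
    show ?thesis
    proof (cases "snd h \<ge> 0")
      case True
      then show ?thesis
        using component_homog[OF CC_D(1)[OF 2(2)] 2(3,4)] 2(1) by (cases h) (auto simp: \<pi>_def)
    qed (use 2(1) in \<open>auto simp: \<pi>_def\<close>)
  qed
  have "bij_betw (\<lambda>x g. \<pi> g x) (CC s V ip) {f. \<forall>g. f g \<in> CC_part s V ip g}"
    unfolding bij_betw_def
  proof (intro conjI equalityI subsetI)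
    show "inj_on (\<lambda>x g. \<pi> g x) (CC s V ip)"
    proof (rule inj_onI)
      fix \<phi> \<psi> assume h: "\<phi> \<in> CC s V ip" "\<psi> \<in> CC s V ip" "(\<lambda>g. \<pi> g \<phi>) = (\<lambda>g. \<pi> g \<psi>)"
      show "\<phi> = \<psi>" by (rule eq_componentsI[OF h(1,2)]) (metis h(3) \<pi>_nat)
    qed
    show "f \<in> {f. \<forall>g. f g \<in> CC_part s V ip g}" if "f \<in> (\<lambda>x g. \<pi> g x) ` CC s V ip" for f
      using that \<pi>_in by auto
    fix f assume "f \<in> {f. \<forall>g. f g \<in> CC_part s V ip g}"
    then have f: "f g \<in> CC_part s V ip g" for g by blast
    \<comment> \<open>Gluing an infinite family: on a list of length \<open>n\<close> only the two
      members of degree \<open>n - 1\<close> can be nonzero, so the sum is finite at every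
      list.\<close>
    define \<phi> where "\<phi> xs = f (0, int (length xs) - 1) xs + f (1, int (length xs) - 1) xs" for xs
    have arity: "has_arity (Suc n) (f (a, int n))" for a n
      using f[of "(a, int n)"] by (auto simp: CC_part_def has_arity_def)
    have par: "parities V (\<lambda>_. a) (f (a, int n))" for a n
      using f[of "(a, int n)"] by (auto simp: CC_part_def parities_iff_has_parity)
    have f_CC: "f g \<in> CC s V ip" for g using f CC_part_subset by blast
    have Suc: "arity_part (Suc n) \<phi> = f (0, int n) + f (1, int n)" for n
      using has_arityD[OF arity] by (auto simp: fun_eq_iff arity_part_def \<phi>_def)
    have "arity_part 0 \<phi> = 0"
      using C.hom_ext_alg_nil[OF CC_D(1)[OF f_CC]] by (auto simp: fun_eq_iff arity_part_def \<phi>_def)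
    then have "arity_part k \<phi> \<in> CC s V ip" for k
      using CC_0 CC_add[OF f_CC f_CC] Suc by (cases k) auto
    then have \<phi>: "\<phi> \<in> CC s V ip" using CC_iff_arity_parts by blast
    have "component (Suc n) a \<phi> = f (a, int n)" for n a
      unfolding component_def Suc parity_part_add parity_part_parities[OF CC_D(1)[OF f_CC] par]
      by (cases a) simp_all
    then have "\<pi> g \<phi> = f g" for g
      using neg[OF f, of g] by (cases g) (auto simp: \<pi>_def)
    then show "f \<in> (\<lambda>x g. \<pi> g x) ` CC s V ip" using \<phi> by (intro image_eqI[of _ _ \<phi>]) (auto simp: fun_eq_iff)
  qed
  moreover have "linear_map_on (pointwise_scale s) (pointwise_scale s) (CC s V ip) (\<pi> g)" for g
    by (simp add: linear_map_on_def \<pi>_def component_add component_scale)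
      (simp add: pointwise_scale_def zero_fun_def)
  ultimately show ?thesis
    unfolding product_graded_def
    using C.module_pointwise subspace_CC subspace_CC_part CC_part_subset homog by blast
qed

lemma total_parity_nat: "total_parity (a, int n) = a + of_nat n"
  by (simp add: total_parity_def)

lemma bracket_degree:
  assumes "x \<in> CC_part s V ip g" "y \<in> CC_part s V ip h"
  shows "bracket s V x y \<in> CC_part s V ip (g + h)"
  using assms(1)
proof (cases rule: CC_part_cases)
  case 1
  then show ?thesis using bracket_zero(2)[OF CC_D(1)[OF subsetD[OF CC_part_subset assms(2)]]] by simp
next
  case x: (2 a r)
  show ?thesis
    using assms(2)
  proof (cases rule: CC_part_cases)
    case 1
    then show ?thesis using bracket_zero(1)[OF CC_D(1)[OF x(2)]] by simp
  next
    case y: (2 b q)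
    note x0 = CC_D(1)[OF x(2)] and y0 = CC_D(1)[OF y(2)]
    have "hbr r q a b x y \<in> CC_part s V ip (a + b, int (r + q))"
      by (intro CC_part_I hbr_CC parities_hbr hbr_has_arity x y x0 y0)
    then show ?thesis
      by (simp add: bracket_homog[OF x0 x(3,4) y0 y(3,4)] x(1) y(1))
  qed
qed

lemma bracket_antisym:
  assumes "x \<in> CC_part s V ip g" "y \<in> CC_part s V ip h"
  shows "bracket s V x y = - pointwise_scale s (psgn (bidegree_form g h)) (bracket s V y x)"
proof -
  have sc0: "pointwise_scale s c 0 = 0" for c by (simp add: pointwise_scale_def zero_fun_def)
  show ?thesis
    using assms(1)
  proof (cases rule: CC_part_cases)
    case 1
    then show ?thesis
      using bracket_zero[OF CC_D(1)[OF subsetD[OF CC_part_subset assms(2)]]] sc0 by simp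
  next
    case x: (2 a r)
    show ?thesis
      using assms(2)
    proof (cases rule: CC_part_cases)
      case 1
      then show ?thesis using bracket_zero[OF CC_D(1)[OF x(2)]] sc0 by simp
    next
      case y: (2 b q)
      note x0 = CC_D(1)[OF x(2)] and y0 = CC_D(1)[OF y(2)]
      show ?thesis
        unfolding bracket_homog[OF x0 x(3,4) y0 y(3,4)] bracket_homog[OF y0 y(3,4) x0 x(3,4)]
          x(1) y(1) bidegree_form_def total_parity_nat
        by (rule hbr_antisym)
    qed
  qed
qed

lemma bracket_jacobi:
  assumes "x \<in> CC_part s V ip g" "y \<in> CC_part s V ip h" "z \<in> CC_part s V ip i"
  shows "bracket s V x (bracket s V y z) = bracket s V (bracket s V x y) z +
    pointwise_scale s (psgn (bidegree_form g h)) (bracket s V y (bracket s V x z))"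
proof -
  have sc0: "pointwise_scale s c 0 = 0" for c by (simp add: pointwise_scale_def zero_fun_def)
  have CC: "x \<in> CC s V ip" "y \<in> CC s V ip" "z \<in> CC s V ip"
    using assms CC_part_subset by blast+
  note hom = CC[THEN CC_D(1)] bracket_CC[OF CC(1,2), THEN CC_D(1)] bracket_CC[OF CC(1,3), THEN CC_D(1)]
    bracket_CC[OF CC(2,3), THEN CC_D(1)]
  consider "x = 0 \<or> y = 0 \<or> z = 0" | a r b q c t where
      "g = (a, int r)" "has_arity (Suc r) x" "parities V (\<lambda>_. a) x"
      "h = (b, int q)" "has_arity (Suc q) y" "parities V (\<lambda>_. b) y"
      "i = (c, int t)" "has_arity (Suc t) z" "parities V (\<lambda>_. c) z"
    using CC_part_cases[OF assms(1)] CC_part_cases[OF assms(2)] CC_part_cases[OF assms(3)] by metis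
  then show ?thesis
  proof cases
    case 1
    then show ?thesis using hom sc0 by (auto simp: bracket_zero)
  next
    case h: 2
    note x = hom(1) h(2,3) and y = hom(2) h(5,6) and z = hom(3) h(8,9)
    note xy = hbr_in[OF x(1) y(1)] hbr_has_arity[OF x(1,2) y(1,2)] parities_hbr[OF x(1,3) y(1,3)]
    note xz = hbr_in[OF x(1) z(1)] hbr_has_arity[OF x(1,2) z(1,2)] parities_hbr[OF x(1,3) z(1,3)]
    note yz = hbr_in[OF y(1) z(1)] hbr_has_arity[OF y(1,2) z(1,2)] parities_hbr[OF y(1,3) z(1,3)]
    show ?thesis
      unfolding bracket_homog[OF x y] bracket_homog[OF x z] bracket_homog[OF y z]
        bracket_homog[OF x yz] bracket_homog[OF xy z] bracket_homog[OF y xz]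
        h(1,4) bidegree_form_def total_parity_nat
      by (rule hbr_jacobi[OF x(1,3,2) y(1,3,2) z(1,3,2)])
  qed
qed

lemma linear_bracket:
  assumes "x \<in> CC s V ip"
  shows "linear_map_on (pointwise_scale s) (pointwise_scale s) (CC s V ip) (bracket s V x)"
    and "linear_map_on (pointwise_scale s) (pointwise_scale s) (CC s V ip) (\<lambda>y. bracket s V y x)"
  using assms CC_D(1)
  by (auto simp: linear_map_on_def bracket_add_right bracket_add_left bracket_scale_right bracket_scale_left)

lemma graded_lie_CC:
  "graded_lie_algebra (pointwise_scale s) (CC s V ip) (CC_part s V ip) bidegree_form (bracket s V)"
  unfolding graded_lie_algebra_def
  using product_graded_CC bracket_CC linear_bracket bracket_degree bracket_antisym bracket_jacobi by blast

text \<open>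
  By the Jacobi identity, \<open>{\<cdot>, l}\<close> is a derivation when all components of \<open>l\<close> are odd. The value of a
  bracket on a list only involves finitely many components.
\<close>

lemma bracket_derivation:
  assumes x: "x \<in> CC s V ip" and y: "y \<in> CC_part s V ip g" and l: "l \<in> CC s V ip"
    and odd: "\<And>k. k \<ge> 1 \<Longrightarrow> has_parity V V (of_nat k) (arity_part k l)"
  shows "bracket s V (bracket s V x y) l = bracket s V x (bracket s V y l) +
    pointwise_scale s (psgn (total_parity g)) (bracket s V (bracket s V x l) y)"
proof -
  define sc :: "('v list \<Rightarrow> 'v) \<Rightarrow> 'v list \<Rightarrow> 'v" where "sc = pointwise_scale s (psgn (total_parity g))"
  define J where "J x l \<longleftrightarrow> bracket s V (bracket s V x y) l = bracket s V x (bracket s V y l) +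
    sc (bracket s V (bracket s V x l) y)" for x l
  have yC: "y \<in> CC s V ip" using y CC_part_subset by blast
  have sc_add: "sc (\<alpha> + \<beta>) = sc \<alpha> + sc \<beta>" for \<alpha> \<beta>
    by (simp add: sc_def pointwise_scale_def fun_eq_iff scale_right_distrib)
  have sc_0: "sc 0 = 0" by (simp add: sc_def pointwise_scale_def zero_fun_def)
  note mem = bracket_CC CC_add
  have J_add_left: "J (x + x') l" if "J x l" "J x' l" "x \<in> CC s V ip" "x' \<in> CC s V ip" "l \<in> CC s V ip" for x x' l
    using that(1,2) unfolding J_def
    by (simp add: bracket_add_left bracket_add_right CC_D(1) that(3-) yC mem sc_add)
  have J_add_right: "J x (l + l')" if "J x l" "J x l'" "x \<in> CC s V ip" "l \<in> CC s V ip" "l' \<in> CC s V ip" for x l l'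
    using that(1,2) unfolding J_def
    by (simp add: bracket_add_left bracket_add_right CC_D(1) that(3-) yC mem sc_add)
  have J_0: "J 0 l" "J l 0" if "l \<in> CC s V ip" for l
    using that yC by (simp_all add: J_def bracket_zero CC_D(1) mem sc_0)
  \<comment> \<open>The Jacobi identity for \<open>x\<close>, \<open>y\<close>, \<open>l\<close>, in
    which the bracket of \<open>y\<close> with \<open>{x, l}\<close> is turned around by
    antisymmetry. As \<open>l\<close> is odd, the two signs combine to that of
    \<open>total_parity g\<close>.\<close>
  have J_homog: "J x l" if x: "x \<in> CC_part s V ip h" and l: "l \<in> CC_part s V ip i" "total_parity i = 1" for x l h i
  proof -
    have hom: "x \<in> CC s V ip" "l \<in> CC s V ip" using x l CC_part_subset by blast+
    have "bracket s V y (bracket s V x l) =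
        - pointwise_scale s (psgn (total_parity g * total_parity (h + i))) (bracket s V (bracket s V x l) y)"
      using bracket_antisym[OF y bracket_degree[OF x l(1)]] by (simp add: bidegree_form_def)
    moreover have "total_parity (h + i) = total_parity h + 1"
      using l(2) by (cases h; cases i) (simp add: total_parity_def algebra_simps)
    moreover have "bracket s V x (bracket s V y l) = bracket s V (bracket s V x y) l +
        pointwise_scale s (psgn (total_parity h * total_parity g)) (bracket s V y (bracket s V x l))"
      using bracket_jacobi[OF x y l(1)] by (simp add: bidegree_form_def)
    ultimately show ?thesis
      by (cases "total_parity g"; cases "total_parity h") (simp_all add: J_def sc_def fun_eq_iff pointwise_scale_def scale_psgn)
  qed
  have J_sum_left: "J (sum f I) l" if "finite I" "\<And>i. i \<in> I \<Longrightarrow> J (f i) l" "\<And>i. i \<in> I \<Longrightarrow> f i \<in> CC s V ip" "l \<in> CC s V ip"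
    for f l and I :: "nat set"
    using that by (induction I rule: finite_induct) (auto intro!: J_0 J_add_left CC_sum)
  have J_sum_right: "J x (sum f I)" if "finite I" "\<And>i. i \<in> I \<Longrightarrow> J x (f i)" "\<And>i. i \<in> I \<Longrightarrow> f i \<in> CC s V ip" "x \<in> CC s V ip"
    for f x and I :: "nat set"
    using that by (induction I rule: finite_induct) (auto intro!: J_0 J_add_right CC_sum)
  have l_part: "arity_part k l \<in> CC_part s V ip (of_nat k, int (k - 1))"
    "total_parity (of_nat k, int (k - 1)) = 1" if "k \<ge> 1" for k
  proof -
    have k: "k = Suc (k - 1)" using that by simp
    have "has_arity (Suc (k - 1)) (arity_part k l)" using has_arity_arity_part[of k l] k by simp
    then show "arity_part k l \<in> CC_part s V ip (of_nat k, int (k - 1))"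
      using odd[OF that] by (intro CC_part_I arity_part_CC l) (simp_all add: parities_iff_has_parity)
    \<comment> \<open>The parity \<open>k\<close> and the degree \<open>k - 1\<close> of a component
      of \<open>l\<close> add up to an odd number.\<close>
    have "of_nat k = (of_nat (k - 1) + 1 :: bit)" by (subst k) (simp add: add.commute)
    then show "total_parity (of_nat k, int (k - 1)) = 1" by (simp only: total_parity_nat) (simp add: bit_ring)
  qed
  have J_parts: "J (arity_part m x) (arity_part k l)" if "m \<ge> 1" "k \<ge> 1" for m k
  proof -
    have m: "m = Suc (m - 1)" using that by simp
    have c: "component m a x \<in> CC_part s V ip (a, int (m - 1))" for a
      using component_CC_part[OF x, of "m - 1" a] m by simp
    have "J (component m 0 x + component m 1 x) (arity_part k l)"
      using J_homog[OF c l_part[OF that(2)]] by (intro J_add_left component_CC arity_part_CC x l)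
    then show ?thesis by (simp only: component_sum[OF CC_D(1)[OF x]])
  qed
  have "bracket s V (bracket s V x y) l xs = (bracket s V x (bracket s V y l) +
    sc (bracket s V (bracket s V x l) y)) xs" for xs
  proof -
    define N where "N = length xs"
    \<comment> \<open>\<open>J\<close> passes only to finite sums, so \<open>x\<close> and
      \<open>l\<close> are cut off above arity \<open>N\<close>; by \<open>bracket_cong\<close> this
      does not affect the values at \<open>xs\<close>.\<close>
    define tr where "tr \<phi> = (\<Sum>k\<in>{1..N}. arity_part k \<phi>)" for \<phi> :: "'v list \<Rightarrow> 'v"
    have tr: "tr \<phi> ys = \<phi> ys" if "\<phi> \<in> CC s V ip" "length ys \<le> N" for \<phi> ys
    proof -
      have "tr \<phi> ys = (if length ys \<in> {1..N} then \<phi> ys else 0)"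
        unfolding tr_def sum_fun_apply arity_part_def by (simp add: sum.delta)
      then show ?thesis using that C.hom_ext_alg_nil[OF CC_D(1)[OF that(1)]] by (cases ys) auto
    qed
    have "J (tr x) (tr l)"
      unfolding tr_def
      by (intro J_sum_left J_sum_right J_parts arity_part_CC CC_sum x l) auto
    then have "bracket s V (bracket s V (tr x) y) (tr l) xs = (bracket s V (tr x) (bracket s V y (tr l)) +
      sc (bracket s V (bracket s V (tr x) (tr l)) y)) xs" by (simp add: J_def)
    moreover have "bracket s V (bracket s V (tr x) y) (tr l) xs = bracket s V (bracket s V x y) l xs"
      "bracket s V (tr x) (bracket s V y (tr l)) xs = bracket s V x (bracket s V y l) xs"
      "bracket s V (bracket s V (tr x) (tr l)) y xs = bracket s V (bracket s V x l) y xs"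
      by (intro bracket_cong[of N] tr x l refl; simp add: N_def)+
    ultimately show ?thesis by (simp add: sc_def pointwise_scale_def)
  qed
  then show ?thesis by (simp add: fun_eq_iff sc_def)
qed

end


section \<open>Transport along an isomorphism\<close>

context
  fixes sc :: "'k::comm_ring_1 \<Rightarrow> 'a::ab_group_add \<Rightarrow> 'a" and sc' :: "'k \<Rightarrow> 'b::ab_group_add \<Rightarrow> 'b"
    and L L' f and H :: "'g::ab_group_add \<Rightarrow> 'a set" and H' :: "'g \<Rightarrow> 'b set"
  assumes linear: "linear_map_on sc sc' L f" and bij: "bij_betw f L L'"
    and parts: "\<And>g. f ` H g = H' g" and module': "module sc'"
begin

text \<open>The projections are conjugated by \<open>f\<close>. A family in the parts of
  \<open>L'\<close> is lifted through \<open>f\<close>, assembled in \<open>L\<close> and mapped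
  back.\<close>

lemma product_graded_transport:
  assumes L: "product_graded sc L H"
  shows "product_graded sc' L' H'"
proof -
  interpret M: module sc using L by (simp add: product_graded_def)
  interpret M': module sc' by (rule module')
  have subL: "M.subspace L" and subH: "M.subspace (H g)" and HL: "H g \<subseteq> L" for g
    using L by (simp_all add: product_graded_def)
  obtain \<pi> where "\<forall>g. linear_map_on sc sc L (\<pi> g)"
    "\<forall>g h. \<forall>x\<in>H g. \<pi> h x = (if h = g then x else 0)"
    and \<pi>3: "bij_betw (\<lambda>x g. \<pi> g x) L {F. \<forall>g. F g \<in> H g}"
    using L unfolding product_graded_def by blast
  then have \<pi>: "linear_map_on sc sc L (\<pi> g)" "x \<in> H g \<Longrightarrow> \<pi> h x = (if h = g then x else 0)" for g h x
    by blast+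
  have add: "f (x + y) = f x + f y" if "x \<in> L" "y \<in> L" for x y
    using linear that by (simp add: linear_map_on_def)
  have scale: "f (sc c x) = sc' c (f x)" if "x \<in> L" for c x
    using linear that by (simp add: linear_map_on_def)
  have f0: "f 0 = 0" using add[of 0 0] M.subspace_0[OF subL] by simp
  have image: "f ` L = L'" and inj: "inj_on f L" using bij by (auto simp: bij_betw_def)
  have subspace: "M'.subspace (f ` S)" if S: "M.subspace S" "S \<subseteq> L" for S
  proof (rule M'.subspaceI)
    show "0 \<in> f ` S" using f0 M.subspace_0[OF S(1)] by (metis imageI)
    show "x + y \<in> f ` S" if xy: "x \<in> f ` S" "y \<in> f ` S" for x y
    proof -
      obtain u v where uv: "x = f u" "y = f v" "u \<in> S" "v \<in> S" using xy by blast
      then have "x + y = f (u + v)" using add S(2) by (simp add: subsetD)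
      then show ?thesis using M.subspace_add[OF S(1) uv(3,4)] by simp
    qed
    show "sc' c x \<in> f ` S" if x: "x \<in> f ` S" for c x
    proof -
      obtain u where u: "x = f u" "u \<in> S" using x by blast
      then have "sc' c x = f (sc c u)" using scale S(2) by (simp add: subsetD)
      then show ?thesis using M.subspace_scale[OF S(1) u(2)] by simp
    qed
  qed
  define i where "i = inv_into L f"
  have i_f: "i (f x) = x" if "x \<in> L" for x using that inj by (simp add: i_def)
  define \<pi>' where "\<pi>' g y = f (\<pi> g (i y))" for g y
  have \<pi>'_f: "\<pi>' g (f x) = f (\<pi> g x)" if "x \<in> L" for g x by (simp add: \<pi>'_def i_f that)
  have \<pi>H: "\<pi> g x \<in> H g" if "x \<in> L" for g x using \<pi>3 that by (auto simp: bij_betw_def)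
  then have \<pi>L: "\<pi> g x \<in> L" if "x \<in> L" for g x using HL that by blast
  have "linear_map_on sc' sc' L' (\<pi>' g)" for g
    unfolding linear_map_on_def image[symmetric]
  proof (intro conjI ballI allI)
    have \<pi>_add: "\<pi> g (x + y) = \<pi> g x + \<pi> g y" if "x \<in> L" "y \<in> L" for x y
      using \<pi>(1)[of g] that by (simp add: linear_map_on_def)
    have \<pi>_scale: "\<pi> g (sc c x) = sc c (\<pi> g x)" if "x \<in> L" for x c
      using \<pi>(1)[of g] that by (simp add: linear_map_on_def)
    fix y assume "y \<in> f ` L"
    then obtain x where x: "x \<in> L" "y = f x" by blast
    show "\<pi>' g (sc' c y) = sc' c (\<pi>' g y)" for c
    proof -
      have "\<pi>' g (sc' c y) = \<pi>' g (f (sc c x))" by (simp only: x scale)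
      also have "\<dots> = f (\<pi> g (sc c x))" by (rule \<pi>'_f[OF M.subspace_scale[OF subL x(1)]])
      finally show ?thesis using x \<pi>L by (simp add: \<pi>'_f \<pi>_scale scale)
    qed
    fix y' assume "y' \<in> f ` L"
    then obtain x' where x': "x' \<in> L" "y' = f x'" by blast
    have "\<pi>' g (y + y') = \<pi>' g (f (x + x'))" by (simp only: x x' add)
    also have "\<dots> = f (\<pi> g (x + x'))" by (rule \<pi>'_f[OF M.subspace_add[OF subL x(1) x'(1)]])
    finally show "\<pi>' g (y + y') = \<pi>' g y + \<pi>' g y'" using x x' \<pi>L by (simp add: \<pi>'_f \<pi>_add add)
  qed
  moreover have "\<pi>' h y = (if h = g then y else 0)" if y: "y \<in> H' g" for g h y
  proof -
    obtain x where x: "x \<in> H g" "y = f x" using y parts by blast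
    then have "x \<in> L" using HL by blast
    then show ?thesis using \<pi>(2)[OF x(1)] x(2) f0 by (simp add: \<pi>'_f)
  qed
  moreover have "bij_betw (\<lambda>y g. \<pi>' g y) L' {F. \<forall>g. F g \<in> H' g}"
    unfolding bij_betw_def
  proof (intro conjI equalityI subsetI)
    show "inj_on (\<lambda>y g. \<pi>' g y) L'"
    proof (rule inj_onI)
      fix y y' assume h: "y \<in> L'" "y' \<in> L'" "(\<lambda>g. \<pi>' g y) = (\<lambda>g. \<pi>' g y')"
      obtain x x' where x: "x \<in> L" "x' \<in> L" "y = f x" "y' = f x'" using h(1,2) image by blast
      have "f (\<pi> g x) = f (\<pi> g x')" for g using fun_cong[OF h(3), of g] x by (simp add: \<pi>'_f)
      then have "(\<lambda>g. \<pi> g x) = (\<lambda>g. \<pi> g x')" using inj \<pi>L x by (auto simp: inj_on_def)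
      then have "x = x'" using \<pi>3 x by (auto simp: bij_betw_def inj_on_def)
      then show "y = y'" using x by simp
    qed
    show "F \<in> {F. \<forall>g. F g \<in> H' g}" if "F \<in> (\<lambda>y g. \<pi>' g y) ` L'" for F
      using that \<pi>H by (auto simp: image[symmetric] parts[symmetric] \<pi>'_f)
    fix F assume "F \<in> {F. \<forall>g. F g \<in> H' g}"
    then have "\<forall>g. \<exists>x. x \<in> H g \<and> F g = f x" using parts by blast
    then obtain G where G: "\<And>g. G g \<in> H g" "\<And>g. F g = f (G g)" by metis
    then have "G \<in> (\<lambda>x g. \<pi> g x) ` L" using \<pi>3 by (auto simp: bij_betw_def)
    then obtain x where "x \<in> L" "\<And>g. G g = \<pi> g x" by (auto simp: fun_eq_iff)
    then show "F \<in> (\<lambda>y g. \<pi>' g y) ` L'"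
      using G(2) image by (intro image_eqI[of _ _ "f x"]) (auto simp: fun_eq_iff \<pi>'_f)
  qed
  moreover have "M'.subspace L'" "M'.subspace (H' g)" "H' g \<subseteq> L'" for g
    using subspace[OF subL] subspace[OF subH HL] image_mono[OF HL[of g], of f] image parts by simp_all
  ultimately show ?thesis
    unfolding product_graded_def using module' by blast
qed

lemma graded_lie_algebra_transport:
  assumes L: "graded_lie_algebra sc L H form br"
    and br': "\<And>x y. x \<in> L \<Longrightarrow> y \<in> L \<Longrightarrow> br' (f x) (f y) = f (br x y)"
  shows "graded_lie_algebra sc' L' H' form br'"
proof -
  have pg: "product_graded sc L H" using L by (simp add: graded_lie_algebra_def)
  interpret M: module sc using pg by (simp add: product_graded_def)
  interpret M': module sc' by (rule module')
  have subL: "M.subspace L" and HL: "\<And>g. H g \<subseteq> L" using pg by (simp_all add: product_graded_def)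
  have add: "f (x + y) = f x + f y" if "x \<in> L" "y \<in> L" for x y
    using linear that by (simp add: linear_map_on_def)
  have scale: "f (sc c x) = sc' c (f x)" if "x \<in> L" for c x
    using linear that by (simp add: linear_map_on_def)
  have minus: "f (- x) = - f x" if "x \<in> L" for x using scale[OF that, of "- 1"] by simp
  have image: "f ` L = L'" using bij by (simp add: bij_betw_def)
  have closed: "x + y \<in> L" "sc c x \<in> L" "br x y \<in> L" if "x \<in> L" "y \<in> L" for x y c
    using that L M.subspace_add[OF subL] M.subspace_scale[OF subL] by (simp_all add: graded_lie_algebra_def)
  note L' = L[unfolded graded_lie_algebra_def linear_map_on_def]
  show ?thesis
    unfolding graded_lie_algebra_def
  proof (intro conjI)
    show "product_graded sc' L' H'" by (rule product_graded_transport[OF pg])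
    show "\<forall>x\<in>L'. \<forall>y\<in>L'. br' x y \<in> L'" using closed by (auto simp: image[symmetric] br')
    show "\<forall>x\<in>L'. linear_map_on sc' sc' L' (br' x)" "\<forall>y\<in>L'. linear_map_on sc' sc' L' (\<lambda>x. br' x y)"
      unfolding linear_map_on_def image[symmetric]
      using closed L' by (auto simp: br' simp flip: add scale)
    show "\<forall>g h. \<forall>x\<in>H' g. \<forall>y\<in>H' h. br' x y \<in> H' (g + h)"
    proof (intro allI ballI)
      fix g h x y assume "x \<in> H' g" "y \<in> H' h"
      then obtain u v where uv: "u \<in> H g" "v \<in> H h" "x = f u" "y = f v" unfolding parts[symmetric] by blast
      then have "u \<in> L" "v \<in> L" using HL by blast+
      moreover have "br u v \<in> H (g + h)" using L' uv by blast
      ultimately show "br' x y \<in> H' (g + h)" by (simp add: uv br' flip: parts)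
    qed
    show "\<forall>g h. \<forall>x\<in>H' g. \<forall>y\<in>H' h. br' x y = - sc' (psgn (form g h)) (br' y x)"
    proof (intro allI ballI)
      fix g h x y assume "x \<in> H' g" "y \<in> H' h"
      then obtain u v where uv: "u \<in> H g" "v \<in> H h" "x = f u" "y = f v" unfolding parts[symmetric] by blast
      then have "u \<in> L" "v \<in> L" using HL by blast+
      moreover have "br u v = - sc (psgn (form g h)) (br v u)" using L' uv by blast
      ultimately show "br' x y = - sc' (psgn (form g h)) (br' y x)"
        using closed by (simp add: uv br' minus scale)
    qed
    show "\<forall>g h i. \<forall>x\<in>H' g. \<forall>y\<in>H' h. \<forall>z\<in>H' i.
        br' x (br' y z) = br' (br' x y) z + sc' (psgn (form g h)) (br' y (br' x z))"
    proof (intro allI ballI)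
      fix g h i x y z assume "x \<in> H' g" "y \<in> H' h" "z \<in> H' i"
      then obtain u v w where uvw: "u \<in> H g" "v \<in> H h" "w \<in> H i" "x = f u" "y = f v" "z = f w"
        unfolding parts[symmetric] by blast
      then have "u \<in> L" "v \<in> L" "w \<in> L" using HL by blast+
      moreover have "br u (br v w) = br (br u v) w + sc (psgn (form g h)) (br v (br u w))"
        using L' uvw by blast
      ultimately show "br' x (br' y z) = br' (br' x y) z + sc' (psgn (form g h)) (br' y (br' x z))"
        using closed by (simp add: uvw br' add scale)
    qed
  qed
qed

end

section \<open>Forms, and the differential on forms and on cyclic elements\<close>

context inner_product_maps
begin

lemma untilde_tilde: "\<phi> \<in> CC s V ip \<Longrightarrow> untilde s V ip (tilde ip \<phi>) = \<phi>"
  unfolding untilde_def using bij_tilde by (intro the_inv_into_f_f) (simp_all add: bij_betw_def)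

lemma form_bracket_tilde:
  "\<phi> \<in> CC s V ip \<Longrightarrow> \<psi> \<in> CC s V ip \<Longrightarrow>
    form_bracket s V ip (tilde ip \<phi>) (tilde ip \<psi>) = tilde ip (bracket s V \<phi> \<psi>)"
  by (simp add: form_bracket_def untilde_tilde)

lemma CC_form_obtain:
  assumes "\<Phi> \<in> CC_form s V"
  obtains \<phi> where "\<phi> \<in> CC s V ip" "\<Phi> = tilde ip \<phi>"
  using bij_tilde assms by (auto simp: bij_betw_def)

lemma graded_lie_CC_form:
  "graded_lie_algebra (pointwise_scale (*)) (CC_form s V) (CC_form_part s V) bidegree_form (form_bracket s V ip)"
  using graded_lie_algebra_transport[OF linear_tilde bij_tilde tilde_part K.module_pointwise graded_lie_CC]
    form_bracket_tilde by blast

lemma form_diff_tagged: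
  assumes "\<Phi> \<in> CC_form s V" "l \<in> Coch" "tagged V zs"
  shows "form_diff V l \<Phi> (map snd zs) = (\<Sum>(k, j)\<in>arity_pairs (length zs).
    psgn (of_nat (k - 1) * of_nat j) * insertion (*) (map fst zs) j k \<Phi> l (map snd zs))"
  unfolding form_diff_eq_ins[OF assms(1,2)] K.ins_eq[OF CC_formD(1)[OF assms(1)] assms(2,3)] psgn_mult
  using K.sum_insertion_eq_ins_tagged[of \<Phi> l of_nat zs] CC_formD[OF assms(1)] C.hom_ext_alg_nil[OF assms(2)]
  by simp

lemma differential_form_diff:
  assumes l: "L_infinity s V l"
  shows "differential (pointwise_scale (*)) (CC_form s V) (form_diff V l)"
proof -
  have l0: "l \<in> Coch" using l by (simp add: L_infinity_def cochains_def)
  note sub = module.subspace_add[OF K.module_pointwise subspace_CC_form]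
    module.subspace_scale[OF K.module_pointwise subspace_CC_form]
  show ?thesis
    unfolding differential_def linear_map_on_def
    using form_diff_in_CC_form[OF _ l0] form_diff_form_diff[OF l] sub
    by (simp add: form_diff_eq_ins[OF _ l0] ins_add_left K.W.ins_scale_left)
qed

text \<open>\<open>untilde\<close> inverts \<open>tilde\<close> only on \<open>CC_form\<close>, so
  \<open>cyclic_diff\<close> makes sense because \<open>form_diff\<close> stays there. This holds
  for every L_infinity structure, cyclic or not.\<close>

lemma cyclic_diff:
  assumes l: "L_infinity s V l" and \<phi>: "\<phi> \<in> CC s V ip"
  shows "cyclic_diff s V ip l \<phi> \<in> CC s V ip"
    and "tilde ip (cyclic_diff s V ip l \<phi>) = form_diff V l (tilde ip \<phi>)"
proof -
  have "form_diff V l (tilde ip \<phi>) \<in> CC_form s V"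
    using differential_form_diff[OF l] CC_D(2)[OF \<phi>] by (simp add: differential_def)
  then obtain \<psi> where "\<psi> \<in> CC s V ip" "form_diff V l (tilde ip \<phi>) = tilde ip \<psi>"
    by (rule CC_form_obtain)
  then show "cyclic_diff s V ip l \<phi> \<in> CC s V ip"
    "tilde ip (cyclic_diff s V ip l \<phi>) = form_diff V l (tilde ip \<phi>)"
    by (simp_all add: cyclic_diff_def untilde_tilde)
qed

lemma differential_cyclic_diff:
  assumes l: "L_infinity s V l"
  shows "differential (pointwise_scale s) (CC s V ip) (cyclic_diff s V ip l)"
proof -
  note D = differential_form_diff[OF l, unfolded differential_def linear_map_on_def]
  have "tilde ip 0 = 0" by (simp add: fun_eq_iff tilde_def)
  then show ?thesis
    unfolding differential_def linear_map_on_def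
    using D CC_D(2) CC_add CC_scale cyclic_diff[OF l]
    by (auto intro!: tilde_inj simp: tilde_add tilde_scale)
qed

text \<open>The component of \<open>l\<close> of arity \<open>j\<close> has parity \<open>j\<close>,
  so the exponent \<open>(k - 1) * c j\<close> in \<open>tilde_bracket\<close> becomes the exponent
  \<open>(k - 1) * j\<close> of the differential.\<close>

lemma form_diff_eq_bracket:
  assumes l: "L_infinity s V l" "l \<in> CC s V ip" and \<phi>: "\<phi> \<in> CC s V ip"
  shows "form_diff V l (tilde ip \<phi>) = tilde ip (bracket s V \<phi> l)"
proof (rule K.hom_ext_alg_eqI)
  show "form_diff V l (tilde ip \<phi>) \<in> hom_ext_alg s V (*)"
    using differential_form_diff[OF l(1)] CC_D(2)[OF \<phi>] CC_formD(1) by (simp add: differential_def)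
  show "tilde ip (bracket s V \<phi> l) \<in> hom_ext_alg s V (*)"
    by (rule CC_D(3)[OF bracket_CC[OF \<phi> l(2)]])
  fix zs assume zs: "tagged V zs"
  show "form_diff V l (tilde ip \<phi>) (map snd zs) = tilde ip (bracket s V \<phi> l) (map snd zs)"
    unfolding form_diff_tagged[OF CC_D(2)[OF \<phi>] CC_D(1)[OF l(2)] zs]
    by (rule tilde_bracket[OF \<phi> l(2) _ zs, symmetric]) (use l(1) in \<open>simp add: L_infinity_def\<close>)
qed

lemma cyclic_diff_eq_bracket:
  assumes "L_infinity s V l" "l \<in> CC s V ip" "\<phi> \<in> CC s V ip"
  shows "cyclic_diff s V ip l \<phi> = bracket s V \<phi> l"
  by (rule tilde_inj) (simp add: cyclic_diff[OF assms(1,3)] form_diff_eq_bracket[OF assms])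

lemma dg_lie_CC:
  assumes l: "L_infinity s V l" "l \<in> CC s V ip"
  shows "dg_lie_algebra (pointwise_scale s) (CC s V ip) (CC_part s V ip) (bracket s V) (cyclic_diff s V ip l)"
  unfolding dg_lie_algebra_def
proof (intro conjI graded_lie_CC differential_cyclic_diff l(1) ballI allI)
  fix x g y assume x: "x \<in> CC s V ip" and y: "y \<in> CC_part s V ip g"
  then have "y \<in> CC s V ip" using CC_part_subset by blast
  then show "cyclic_diff s V ip l (bracket s V x y) = bracket s V x (cyclic_diff s V ip l y) +
      pointwise_scale s (psgn (total_parity g)) (bracket s V (cyclic_diff s V ip l x) y)"
    using bracket_derivation[OF x y l(2)] l(1) x
    by (simp add: cyclic_diff_eq_bracket[OF l] bracket_CC L_infinity_def)
qed

lemma dg_lie_CC_form: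
  assumes l: "L_infinity s V l" "l \<in> CC s V ip"
  shows "dg_lie_algebra (pointwise_scale (*)) (CC_form s V) (CC_form_part s V)
    (form_bracket s V ip) (form_diff V l)"
  unfolding dg_lie_algebra_def
proof (intro conjI graded_lie_CC_form differential_form_diff l(1) ballI allI)
  fix \<Phi> g \<Psi> assume "\<Phi> \<in> CC_form s V" "\<Psi> \<in> CC_form_part s V g"
  then obtain x y where xy: "x \<in> CC s V ip" "\<Phi> = tilde ip x" "y \<in> CC_part s V ip g" "\<Psi> = tilde ip y"
    unfolding tilde_part[symmetric] by (auto elim: CC_form_obtain)
  have y: "y \<in> CC s V ip" using xy(3) CC_part_subset by blast
  have "bracket s V (bracket s V x y) l = bracket s V x (bracket s V y l) +
      pointwise_scale s (psgn (total_parity g)) (bracket s V (bracket s V x l) y)"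
    using bracket_derivation[OF xy(1,3) l(2)] l(1) by (simp add: L_infinity_def)
  then show "form_diff V l (form_bracket s V ip \<Phi> \<Psi>) = form_bracket s V ip \<Phi> (form_diff V l \<Psi>) +
      pointwise_scale (*) (psgn (total_parity g)) (form_bracket s V ip (form_diff V l \<Phi>) \<Psi>)"
    by (simp add: xy(2,4) form_diff_eq_bracket[OF l] form_bracket_tilde bracket_CC l(2) xy(1) y
        tilde_add tilde_scale)
qed

end

theorem theorem4:
  fixes s :: "'k::comm_ring_1 \<Rightarrow> 'v::ab_group_add \<Rightarrow> 'v"
    and V :: "bit \<Rightarrow> 'v set"
    and ip :: "'v \<Rightarrow> 'v \<Rightarrow> 'k"
  assumes "super_module s V"
    and "inner_product s V ip"
  shows "(\<forall>\<phi>\<in>CC s V ip. \<forall>\<psi>\<in>CC s V ip.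
        bracket s V \<phi> \<psi> \<in> CC s V ip \<and>
        (\<forall>q n xs es. (\<forall>j\<ge>1. has_parity V V (q j) (arity_part j \<psi>)) \<and>
            n \<ge> 1 \<and> length xs = n + 1 \<and> homog_args V xs es \<longrightarrow>
            tilde ip (bracket s V \<phi> \<psi>) xs =
              (\<Sum>(k, j)\<in>arity_pairs (n + 1).
                 psgn (of_nat (k - 1) * q j) * insertion (*) es j k (tilde ip \<phi>) \<psi> xs)))
    \<and> graded_lie_algebra (pointwise_scale s) (CC s V ip) (CC_part s V ip)
        bidegree_form (bracket s V)
    \<and> linear_map_on (pointwise_scale s) (pointwise_scale (*)) (CC s V ip) (tilde ip)
    \<and> bij_betw (tilde ip) (CC s V ip) (CC_form s V)
    \<and> (\<forall>g. tilde ip ` CC_part s V ip g = CC_form_part s V g)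
    \<and> (\<forall>\<phi>\<in>CC s V ip. \<forall>\<psi>\<in>CC s V ip.
        form_bracket s V ip (tilde ip \<phi>) (tilde ip \<psi>) = tilde ip (bracket s V \<phi> \<psi>))
    \<and> graded_lie_algebra (pointwise_scale (*)) (CC_form s V) (CC_form_part s V)
        bidegree_form (form_bracket s V ip)
    \<and> (\<forall>l. L_infinity s V l \<longrightarrow>
        differential (pointwise_scale (*)) (CC_form s V) (form_diff V l) \<and>
        (\<forall>\<phi>\<in>CC s V ip. \<forall>n xs es. n \<ge> 1 \<and> length xs = n + 1 \<and> homog_args V xs es \<longrightarrow>
            form_diff V l (tilde ip \<phi>) xs =
              (\<Sum>(k, j)\<in>arity_pairs (n + 1).
                 psgn (of_nat (k - 1) * of_nat j) * insertion (*) es j k (tilde ip \<phi>) l xs)) \<and>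
        differential (pointwise_scale s) (CC s V ip) (cyclic_diff s V ip l) \<and>
        (\<forall>\<phi>\<in>CC s V ip. tilde ip (cyclic_diff s V ip l \<phi>) = form_diff V l (tilde ip \<phi>)))
    \<and> (\<forall>l. L_infinity s V l \<and> l \<in> CC s V ip \<longrightarrow>
        (\<forall>\<phi>\<in>CC s V ip.
            form_diff V l (tilde ip \<phi>) = form_bracket s V ip (tilde ip \<phi>) (tilde ip l) \<and>
            cyclic_diff s V ip l \<phi> = bracket s V \<phi> l) \<and>
        dg_lie_algebra (pointwise_scale s) (CC s V ip) (CC_part s V ip)
          (bracket s V) (cyclic_diff s V ip l) \<and>
        dg_lie_algebra (pointwise_scale (*)) (CC_form s V) (CC_form_part s V)
          (form_bracket s V ip) (form_diff V l))"
proof -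
  interpret inner_product_maps s V ip
    using assms by (intro inner_product_maps.intro k_valued_maps.intro inner_product_maps_axioms.intro)
  have formula: "tilde ip (bracket s V \<phi> \<psi>) xs = (\<Sum>(k, j)\<in>arity_pairs (n + 1).
      psgn (of_nat (k - 1) * q j) * insertion (*) es j k (tilde ip \<phi>) \<psi> xs)"
    if h: "\<phi> \<in> CC s V ip" "\<psi> \<in> CC s V ip" "\<forall>j\<ge>1. has_parity V V (q j) (arity_part j \<psi>)"
      "length xs = n + 1" "homog_args V xs es" for \<phi> \<psi> q n xs es
  proof -
    obtain zs where "xs = map snd zs" "es = map fst zs" "tagged V zs"
      using h(5) by (rule homog_args_obtain_tagged)
    then show ?thesis using tilde_bracket[of \<phi> \<psi> q zs] h(1-4) by simp
  qed
  have formula_diff: "form_diff V l (tilde ip \<phi>) xs = (\<Sum>(k, j)\<in>arity_pairs (n + 1).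
      psgn (of_nat (k - 1) * of_nat j) * insertion (*) es j k (tilde ip \<phi>) l xs)"
    if h: "L_infinity s V l" "\<phi> \<in> CC s V ip" "length xs = n + 1" "homog_args V xs es" for l \<phi> n xs es
  proof -
    obtain zs where "xs = map snd zs" "es = map fst zs" "tagged V zs"
      using h(4) by (rule homog_args_obtain_tagged)
    then show ?thesis
      using form_diff_tagged[OF CC_D(2)[OF h(2)], of l zs] h(1,3) by (simp add: L_infinity_def cochains_def)
  qed
  show ?thesis
    by (intro conjI ballI allI impI; (elim conjE)?)
      (simp_all add: bracket_CC formula graded_lie_CC linear_tilde bij_tilde tilde_part form_bracket_tilde
        graded_lie_CC_form differential_form_diff formula_diff differential_cyclic_diff cyclic_diff(2)
        form_diff_eq_bracket cyclic_diff_eq_bracket dg_lie_CC dg_lie_CC_form)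
qed

end
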